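(* For any real number $C>0$, there exists a finite family $\{P_i(z_1,\dots,z_{n_i})\}_{i\in I}$ of polynomials $P_i$ with cyclotomic integer coefficients such that the set of cyclotomic integers $\alpha$ with $h(\alpha)^2\le C$ is equal to $$\{P_i(\zeta_1,\dots,\zeta_{n_i}) : i\in I;\ \zeta_1,\dots,\zeta_{n_i}\in\mu\}.$$
   Context: $\mathbb{Q}^{\mathrm{cycl}}$ denotes the maximal abelian extension of $\mathbb{Q}$ (the field generated over $\mathbb{Q}$ by all roots of unity), and $\mu\subset\mathbb{Q}^{\mathrm{cycl}}$ is the group of all roots of unity. A cyclotomic integer is an algebraic integer contained in $\mathbb{Q}^{\mathrm{cycl}}$. For an algebraic integer $\alpha$, the house $h(\alpha)$ is the maximum of $|\beta|$ as $\beta$ ranges over the conjugates of $\alpha$ over $\mathbb{Q}$ in $\mathbb{C}$; the quantity $h(\alpha)^2$ is called the castle of $\alpha$. The number of variables $n_i\ge 0$ may depend on $i$. *)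

theory Defs
  imports
    "HOL-Algebra.Generated_Fields"
    "HOL-Algebra.Algebraic_Closure_Type"
    "HOL-Library.Poly_Mapping"
    "HOL-Computational_Algebra.Computational_Algebra"
    Complex_Main
begin

definition roots_of_unity :: "complex set" where
  "roots_of_unity = {z. \<exists>n>0. z ^ n = 1}"

definition cyclotomic_numbers :: "complex set" where
  "cyclotomic_numbers =
     generate_field (ring_of_type_algebra :: complex ring) (\<rat> \<union> roots_of_unity)"

definition cyclotomic_integers :: "complex set" where
  "cyclotomic_integers = {\<alpha> \<in> cyclotomic_numbers. algebraic_int \<alpha>}"

text \<open>The qualified name avoids the carrier-based notion of irreducibility of HOL-Algebra. For
  algebraic \<open>\<alpha>\<close>, any irreducible \<open>p\<close> below is a unit multiple of the minimal polynomial of \<open>\<alpha>\<close>,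
  so that the conjugates form a finite set containing \<open>\<alpha>\<close>, and the maximum defining the
  house is a genuine one. Otherwise there are no conjugates and the house is unspecified.\<close>

definition conjugates :: "complex \<Rightarrow> complex set" where
  "conjugates \<alpha> = {\<beta>. \<exists>p :: rat poly. Factorial_Ring.irreducible p \<and>
     poly (map_poly of_rat p) \<alpha> = 0 \<and> poly (map_poly of_rat p) \<beta> = 0}"

definition house :: "complex \<Rightarrow> real" where
  "house \<alpha> = Max (norm ` conjugates \<alpha>)"

text \<open>A polynomial in the variables \<open>z\<^sub>0, z\<^sub>1, \<dots>\<close> is a finitely supported map from monomials to
  coefficients; a monomial is a finitely supported map from variable indices to exponents.
  Variables are thus numbered from 0: a polynomial in \<open>n\<close> variables only uses
  \<open>z\<^sub>0, \<dots>, z\<^sub>n\<^sub>-\<^sub>1\<close>.\<close>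

type_synonym multi_poly = "(nat \<Rightarrow>\<^sub>0 nat) \<Rightarrow>\<^sub>0 complex"

definition multi_polys_over :: "complex set \<Rightarrow> nat \<Rightarrow> multi_poly set" where
  "multi_polys_over A n =
     {P. \<forall>m \<in> Poly_Mapping.keys P.
        Poly_Mapping.lookup P m \<in> A \<and> Poly_Mapping.keys m \<subseteq> {..<n}}"

definition eval_multi_poly :: "multi_poly \<Rightarrow> (nat \<Rightarrow> complex) \<Rightarrow> complex" where
  "eval_multi_poly P z =
     (\<Sum>m \<in> Poly_Mapping.keys P.
        Poly_Mapping.lookup P m * (\<Prod>j \<in> Poly_Mapping.keys m. z j ^ Poly_Mapping.lookup m j))"

end

(*
  Two facts combine.  First, a cyclotomic integer of castle at most C is a sum of boundedly many
  roots of unity (Loxton).  For this one follows the mean M of |.|^2 over the conjugates, following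
  Cassels: writing alpha as a combination of p-th (or N-th) roots of unity with coefficients of
  conductor N / p, either one coefficient suffices and the conductor drops, or each of the at most
  2 M coefficients has mean at most M - 1/2.  Primes p that are small compared with M and divide N
  exactly once escape this argument, but they leave only finitely many conductors.

  Second, consider the torsion points y in a torus for which the sum of the coordinates of y has
  castle at most C.  If a parametrised family of such points is not entirely of this kind, some
  conjugate of the sum exceeds the bound, hence so does the sum on an open set of the torus.
  Conjugates of a torsion point of the family equidistribute unless it satisfies one of finitely
  many character equations, so all good points lie in finitely many families of smaller dimension.
  Induction on the dimension describes the good points by finitely many monomial families.
*)
theory Submission
  imports Defs "HOL-Number_Theory.Number_Theory" "HOL-Library.FuncSet"
begin

subsection \<open>Integer polynomials evaluated at roots of unity\<close>

text \<open>No Galois theory is presupposed. An element of Z[zeta_N] is carried by an integer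
  polynomial \<open>f\<close>, and its conjugates are the values of \<open>f\<close> at the powers
  of \<open>zeta N\<close> with exponent prime to \<open>N\<close>. That this does not depend on
  \<open>f\<close> amounts to the irreducibility of the cyclotomic polynomial. The descent needs
  coefficients that are again algebraic integers, because its gain of 1/2 rests on nonzero integers
  having mean at least 1; hence the proof that every cyclotomic integer lies in some Z[zeta_N]. The
  second half needs finitely many character equations that serve all torsion points at once, so
  equidistribution is made effective, with constants depending on the family and on one bad point
  but not on the point tested. A conjugation that approximates the bad one must also agree with it
  on the constant coefficients of the family, so the averages run over units in a fixed residue
  class. The families obtained consist of Laurent monomials, whereas polynomials are wanted.
  Multiplication by a root of unity preserves the castle, so one further variable can absorb the
  negative exponents.\<close>

lemma map_poly_hom_mult:
  assumes "h 0 = 0" "\<And>a b. h (a + b) = h a + h b" "\<And>a b. h (a * b) = h a * h b"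
  shows "map_poly h (p * q) = map_poly h p * map_poly h (q :: 'a :: comm_semiring_0 poly)"
proof (rule poly_eqI)
  fix n
  have sum: "h (sum g A) = (\<Sum>x\<in>A. h (g x))" for g and A :: "nat set"
    by (induction A rule: infinite_finite_induct) (auto simp: assms)
  show "coeff (map_poly h (p * q)) n = coeff (map_poly h p * map_poly h q) n"
    by (simp add: coeff_map_poly assms coeff_mult sum)
qed

text \<open>The homomorphism is arbitrary in order to cover also the evaluation of polynomials whose
  coefficients are themselves integer polynomials.\<close>

lemma map_poly_hom_prod:
  assumes "h 0 = 0" "h 1 = 1" "\<And>a b. h (a + b) = h a + h b" "\<And>a b. h (a * b) = h a * h b"
  shows "map_poly h (\<Prod>i\<in>A. g i) = (\<Prod>i\<in>A. map_poly h (g i :: 'a :: comm_semiring_1 poly))"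
  by (induction A rule: infinite_finite_induct)
     (auto simp: map_poly_hom_mult assms map_poly_1)

text \<open>For fixed \<open>N\<close>, one polynomial \<open>f\<close> encodes an element of
  Z[zeta_N] together with all its conjugates \<open>ipoly f (zeta N ^ k)\<close>; conjugation is
  substitution.\<close>

definition ipoly :: "int poly \<Rightarrow> complex \<Rightarrow> complex" where
  "ipoly f x = poly (map_poly of_int f) x"

lemma map_poly_of_int_add: "map_poly of_int (f + g) = map_poly of_int f + (map_poly of_int g :: 'a :: ring_1 poly)"
  by (rule poly_eqI) (simp add: coeff_map_poly)

lemma ipoly_0 [simp]: "ipoly 0 x = 0"
  and ipoly_1 [simp]: "ipoly 1 x = 1"
  and ipoly_pCons [simp]: "ipoly (pCons a f) x = of_int a + x * ipoly f x"
  by (auto simp: ipoly_def map_poly_pCons map_poly_1)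

lemma ipoly_add [simp]: "ipoly (f + g) x = ipoly f x + ipoly g x"
  by (simp add: ipoly_def map_poly_of_int_add)

lemma ipoly_mult [simp]: "ipoly (f * g) x = ipoly f x * ipoly g x"
  by (simp add: ipoly_def map_poly_hom_mult)

lemma ipoly_smult [simp]: "ipoly (smult a f) x = of_int a * ipoly f x"
  by (induction f) (auto simp: algebra_simps)

lemma ipoly_minus [simp]: "ipoly (- f) x = - ipoly f x"
  using ipoly_smult[of "-1" f x] by simp

lemma ipoly_diff [simp]: "ipoly (f - g) x = ipoly f x - ipoly g x"
  using ipoly_add[of f "-g" x] by simp

lemma ipoly_power [simp]: "ipoly (f ^ n) x = ipoly f x ^ n"
  by (induction n) auto

lemma ipoly_sum [simp]: "ipoly (\<Sum>i\<in>A. f i) x = (\<Sum>i\<in>A. ipoly (f i) x)"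
  by (induction A rule: infinite_finite_induct) auto

lemma ipoly_monom [simp]: "ipoly (monom a n) x = of_int a * x ^ n"
  by (simp add: ipoly_def map_poly_monom poly_monom)

lemma ipoly_pcompose [simp]: "ipoly (pcompose f g) x = ipoly f (ipoly g x)"
  by (induction f) (auto simp: pcompose_pCons)

section \<open>Roots of unity of order \<open>N\<close> and the residues prime to
  \<open>N\<close>\<close>

definition zeta :: "nat \<Rightarrow> complex" where
  "zeta N = cis (2 * pi / real N)"

lemma zeta_power: "zeta N ^ k = cis (2 * pi * real k / real N)"
  by (simp add: zeta_def DeMoivre field_simps)

lemma zeta_power_N [simp]: "zeta N ^ N = 1"
  by (cases "N = 0") (auto simp: zeta_power)

lemma norm_zeta [simp]: "cmod (zeta N) = 1"
  by (simp add: zeta_def)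

lemma zeta_1 [simp]: "zeta (Suc 0) = 1"
  by (simp add: zeta_def)

lemma zeta_power_mod: "zeta N ^ (k mod N) = zeta N ^ k"
proof -
  have "zeta N ^ k = zeta N ^ (N * (k div N) + k mod N)" by simp
  also have "\<dots> = zeta N ^ (k mod N)"
    by (simp only: power_add power_mult zeta_power_N power_one mult_1)
  finally show ?thesis by simp
qed

lemma zeta_power_cong: "[a = b] (mod N) \<Longrightarrow> zeta N ^ a = zeta N ^ b"
  by (metis cong_def zeta_power_mod)

lemma zeta_power_eq_1_iff:
  assumes "N > 0"
  shows "zeta N ^ k = 1 \<longleftrightarrow> N dvd k"
proof
  assume "zeta N ^ k = 1"
  hence "cos (2 * pi * real k / real N) = 1"
    by (simp add: zeta_power complex_eq_iff)
  then obtain z :: int where "2 * pi * real k / real N = of_int z * 2 * pi"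
    by (auto simp: cos_one_2pi_int)
  hence "real k = of_int z * real N"
    using assms by (simp add: field_simps)
  hence "real_of_int (int k) = real_of_int (z * int N)" by simp
  hence "int k = z * int N" by (simp only: of_int_eq_iff)
  thus "N dvd k" by (metis dvd_triv_right int_dvd_int_iff)
next
  assume "N dvd k"
  then show "zeta N ^ k = 1" by (auto simp: dvd_def power_mult)
qed

lemma zeta_power_eq_iff:
  assumes "N > 0"
  shows "zeta N ^ a = zeta N ^ b \<longleftrightarrow> [a = b] (mod N)"
proof
  assume eq: "zeta N ^ a = zeta N ^ b"
  have "zeta N ^ (a + (N - b mod N)) = zeta N ^ b * zeta N ^ (N - b mod N)"
    by (simp add: power_add eq)
  also have "\<dots> = zeta N ^ (b mod N + (N - b mod N))"
    by (simp only: power_add zeta_power_mod)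
  also have "b mod N + (N - b mod N) = N"
    using assms by (simp add: less_imp_le)
  finally have "N dvd a + (N - b mod N)"
    using zeta_power_eq_1_iff[OF assms] by simp
  hence "[a + (N - b mod N) = b mod N + (N - b mod N)] (mod N)"
    using assms by (simp add: cong_def less_imp_le)
  hence "[a = b mod N] (mod N)"
    using cong_add_rcancel_nat by blast
  thus "[a = b] (mod N)" by (simp add: cong_def)
qed (rule zeta_power_cong)

lemma zeta_mult_power:
  assumes "p > 0"
  shows "zeta (p * N) ^ p = zeta N"
  using assms by (simp add: zeta_power) (simp add: zeta_def)

text \<open>Representatives of the Galois group of Q(zeta_N). For \<open>N = 1\<close> the only one
  is 0, which is why the identity is written \<open>1 mod N\<close>.\<close>

definition units_below :: "nat \<Rightarrow> nat set" where
  "units_below N = {k. k < N \<and> coprime k N}"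

lemma finite_units_below [simp]: "finite (units_below N)"
  by (simp add: units_below_def)

lemma units_below_1 [simp]: "units_below (Suc 0) = {0}"
  by (auto simp: units_below_def)

lemma mod_in_units_below: "N > 0 \<Longrightarrow> coprime k N \<Longrightarrow> k mod N \<in> units_below N"
  by (auto simp: units_below_def coprime_mod_left_iff)

lemma one_mod_in_units_below: "N > 0 \<Longrightarrow> 1 mod N \<in> units_below N"
  by (rule mod_in_units_below) auto

lemma bij_betw_mult_units_below:
  assumes "N > 0" "coprime j N"
  shows "bij_betw (\<lambda>k. (j * k) mod N) (units_below N) (units_below N)"
proof -
  have inj: "inj_on (\<lambda>k. (j * k) mod N) (units_below N)"
  proof (rule inj_onI)
    fix x y assume *: "x \<in> units_below N" "y \<in> units_below N" "j * x mod N = j * y mod N"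
    hence "[j * x = j * y] (mod N)" by (simp add: cong_def)
    hence "[x = y] (mod N)" using assms(2) by (simp add: cong_mult_lcancel_nat)
    thus "x = y" using * by (auto simp: units_below_def cong_def)
  qed
  moreover have "(\<lambda>k. (j * k) mod N) ` units_below N \<subseteq> units_below N"
    using assms by (auto intro!: mod_in_units_below simp: units_below_def)
  ultimately show ?thesis
    by (simp add: bij_betw_def endo_inj_surj)
qed

subsection \<open>The minimal polynomial of a primitive root of unity\<close>

text \<open>Gauss's lemma: contents are multiplicative, so \<open>c\<close> divides the content of
  the cofactor and cancels.\<close>

lemma primitive_dvd_smultD:
  fixes m f :: "int poly"
  assumes "m dvd smult c f" "content m = 1" "c \<noteq> 0"
  shows "m dvd f"
proof -
  from assms(1) obtain q where q: "smult c f = m * q" by (elim dvdE)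
  have "normalize c * content f = content q"
    using arg_cong[OF q, of content] assms(2) by (simp add: content_mult)
  hence "c dvd content q" by (metis dvd_triv_left normalize_dvd_iff)
  then obtain q' where q': "q = smult c q'"
    by (metis const_poly_dvd_iff_dvd_content dvdE mult.commute smult_conv_map_poly
        mult_pCons_left mult_zero_left pCons_0_0 add.right_neutral)
  have "smult c (f - m * q') = 0" using q q' by (simp add: smult_diff_right)
  hence "f = m * q'" using assms(3) by simp
  thus ?thesis by simp
qed

text \<open>A primitive polynomial of least degree vanishing at \<open>zeta N\<close> divides all
  others by pseudo-division and Gauss's lemma; dividing X^N - 1, it has a unit as leading
  coefficient. Being monic permits division with remainder over the integers, and the cofactor
  \<open>h\<close> serves in the derivative arguments.\<close>

lemma zeta_min_poly:
  assumes "N > 0"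
  obtains m h :: "int poly" where "lead_coeff m = 1" "m * h = monom 1 N - 1" "ipoly m (zeta N) = 0"
    "\<And>f. ipoly f (zeta N) = 0 \<Longrightarrow> m dvd f"
proof -
  define S where "S = {f :: int poly. f \<noteq> 0 \<and> ipoly f (zeta N) = 0}"
  define xN where "xN = (monom 1 N - 1 :: int poly)"
  have lcX: "lead_coeff xN = 1" and X0: "xN \<noteq> 0"
  proof -
    have "degree xN = N" unfolding xN_def using assms
      by (subst diff_conv_add_uminus, subst degree_add_eq_left) (auto simp: degree_monom_eq)
    thus "lead_coeff xN = 1" using assms by (simp add: xN_def)
    thus "xN \<noteq> 0" by auto
  qed
  have XS: "xN \<in> S" using X0 by (auto simp: S_def xN_def)
  define f0 where "f0 = arg_min degree (\<lambda>f. f \<in> S)"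
  have f0: "f0 \<in> S" "\<And>f. f \<in> S \<Longrightarrow> degree f0 \<le> degree f"
    unfolding f0_def using arg_min_natI[of "\<lambda>f. f \<in> S", OF XS] arg_min_nat_le[of "\<lambda>f. f \<in> S"] by blast+
  define g where "g = primitive_part f0"
  have f0g: "f0 = smult (content f0) g" by (simp add: g_def)
  have c0: "content f0 \<noteq> 0" using f0(1) by (auto simp: S_def)
  have g: "g \<noteq> 0" "ipoly g (zeta N) = 0" "content g = 1" "degree g = degree f0"
    using f0(1) c0 f0g by (auto simp: S_def g_def simp flip: content_eq_zero_iff) 
       (metis f0g g_def ipoly_smult mult_eq_0_iff of_int_eq_0_iff content_eq_zero_iff)
  have dvd: "g dvd f" if "ipoly f (zeta N) = 0" for f
  proof -
    obtain q r where qr: "pseudo_divmod f g = (q, r)" by force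
    from pseudo_divmod[OF g(1) qr]
    have 1: "smult (coeff g (degree g) ^ (Suc (degree f) - degree g)) f = g * q + r"
      and 2: "r = 0 \<or> degree r < degree g" by auto
    from arg_cong[OF 1, of "\<lambda>f. ipoly f (zeta N)"] that g(2) have "ipoly r (zeta N) = 0" by simp
    hence "r = 0" using 2 f0(2)[of r] g(4) by (cases "r = 0") (auto simp: S_def)
    hence "g dvd smult (coeff g (degree g) ^ (Suc (degree f) - degree g)) f" using 1 by simp
    thus ?thesis by (rule primitive_dvd_smultD) (use g(1,3) leading_coeff_0_iff[of g] in simp_all)
  qed
  have "g dvd xN" using dvd XS by (simp add: S_def)
  then obtain h where h: "xN = g * h" by (elim dvdE)
  hence lc: "lead_coeff g * lead_coeff h = 1" using lcX by (simp add: lead_coeff_mult)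
  define s where "s = lead_coeff g"
  have ss: "s * s = 1" using lc unfolding s_def
    by (metis mult_minus_right mult_minus_left mult_1 minus_minus pos_zmult_eq_1_iff_lemma zmult_eq_1_iff)
  show ?thesis
  proof (rule that[of "smult s g" "smult s h"])
    show "lead_coeff (smult s g) = 1" using ss g(1) by (simp add: s_def)
    show "smult s g * smult s h = monom 1 N - 1" using h ss by (simp add: xN_def)
    show "ipoly (smult s g) (zeta N) = 0" by (simp add: g)
    show "smult s g dvd f" if "ipoly f (zeta N) = 0" for f
    proof -
      from dvd[OF that] obtain q where "f = g * q" by (elim dvdE)
      hence "f = smult s g * smult s q" using ss by simp
      thus ?thesis by (rule dvdI)
    qed
  qed
qed

lemma monic_division:
  fixes m f :: "int poly"
  assumes "lead_coeff m = 1"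
  obtains q r where "f = m * q + r" "r = 0 \<or> degree r < degree m"
proof -
  obtain q r where qr: "pseudo_divmod f m = (q, r)" by force
  have "m \<noteq> 0" using assms by auto
  from pseudo_divmod[OF this qr] assms show ?thesis by (intro that[of q r]) auto
qed

subsection \<open>Frobenius congruence\<close>

lemma prime_power_add_cong:
  fixes u v :: "'a :: comm_ring_1"
  assumes "prime p"
  obtains w where "(u + v) ^ p = u ^ p + v ^ p + of_nat p * w"
proof -
  have p: "p \<ge> 2" using assms by (simp add: prime_ge_2_nat)
  have "(u + v) ^ p = (\<Sum>k\<le>p. of_nat (p choose k) * u ^ k * v ^ (p - k))"
    by (rule binomial_ring)
  also have "{..p} = insert 0 (insert p {0<..<p})" using p by auto
  also have "(\<Sum>k\<in>\<dots>. of_nat (p choose k) * u ^ k * v ^ (p - k)) =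
      v ^ p + u ^ p + (\<Sum>k\<in>{0<..<p}. of_nat (p choose k) * u ^ k * v ^ (p - k))"
    using p by (subst sum.insert, simp, simp, subst sum.insert) auto
  also have "(\<Sum>k\<in>{0<..<p}. of_nat (p choose k) * u ^ k * v ^ (p - k)) =
     (\<Sum>k\<in>{0<..<p}. of_nat p * (of_nat ((p choose k) div p) * u ^ k * v ^ (p - k)))"
  proof (intro sum.cong refl)
    fix k assume "k \<in> {0<..<p}"
    hence "p dvd (p choose k)" using assms by (intro dvd_choose_prime) auto
    hence "p choose k = p * ((p choose k) div p)" by simp
    hence "(of_nat (p choose k) :: 'a) = of_nat p * of_nat ((p choose k) div p)"
      by (metis of_nat_mult)
    thus "of_nat (p choose k) * u ^ k * v ^ (p - k) =
      of_nat p * (of_nat ((p choose k) div p) * u ^ k * v ^ (p - k))" by (simp add: mult_ac)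
  qed
  also have "\<dots> = of_nat p * (\<Sum>k\<in>{0<..<p}. of_nat ((p choose k) div p) * u ^ k * v ^ (p - k))"
    by (simp add: sum_distrib_left)
  finally show ?thesis by (intro that) (simp add: add_ac)
qed

lemma int_power_prime_cong:
  assumes "prime p"
  obtains w :: int where "a ^ p = a + int p * w"
proof -
  have nat: "\<exists>w. int n ^ p = int n + int p * w" for n
  proof (induction n)
    case 0 thus ?case using assms by (intro exI[of _ 0]) (auto simp: prime_gt_0_nat)
  next
    case (Suc n)
    then obtain w where "int n ^ p = int n + int p * w" by auto
    moreover obtain w' where "(int n + 1) ^ p = int n ^ p + 1 ^ p + of_nat p * w'"
      using prime_power_add_cong[OF assms] .
    ultimately show ?case by (intro exI[of _ "w + w'"]) (simp add: algebra_simps)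
  qed
  have "int p dvd a ^ p - a"
  proof -
    define n where "n = nat (a mod int p)"
    have n: "[a = int n] (mod int p)" using prime_gt_0_nat[OF assms] by (simp add: n_def cong_def)
    obtain w where "int n ^ p = int n + int p * w" using nat by blast
    hence "[int n ^ p = int n] (mod int p)" by (simp add: cong_def)
    moreover have "[a ^ p = int n ^ p] (mod int p)" using n by (rule cong_pow)
    ultimately have "[a ^ p = a] (mod int p)" using n by (meson cong_sym cong_trans)
    thus ?thesis by (simp add: cong_iff_dvd_diff)
  qed
  then obtain w where "a ^ p - a = int p * w" by (elim dvdE)
  thus ?thesis by (intro that[of w]) simp
qed

text \<open>Evaluated at \<open>zeta N\<close>, this says that the p-th power acts modulo p like the
  substitution of \<open>zeta N ^ p\<close> for \<open>zeta N\<close>.\<close>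

lemma poly_frobenius:
  fixes f :: "int poly"
  assumes "prime p"
  obtains r where "f ^ p = pcompose f (monom 1 p) + smult (int p) r"
proof -
  have "\<exists>r. f ^ p = pcompose f (monom 1 p) + smult (int p) r"
  proof (induction f)
    case 0 thus ?case using prime_gt_0_nat[OF assms] by (intro exI[of _ 0]) auto
  next
    case (pCons a f)
    then obtain r where r: "f ^ p = pcompose f (monom 1 p) + smult (int p) r" by auto
    have eq: "pCons a f = [:a:] + monom 1 (Suc 0) * f" by (simp add: monom_altdef)
    obtain w where w: "([:a:] + monom 1 (Suc 0) * f) ^ p = [:a:] ^ p + (monom 1 (Suc 0) * f) ^ p + of_nat p * w"
      using prime_power_add_cong[OF assms] .
    obtain z where z: "a ^ p = a + int p * z" using int_power_prime_cong[OF assms] .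
    have "pCons a f ^ p = [:a + int p * z:] + monom 1 p * (pcompose f (monom 1 p) + smult (int p) r) + smult (int p) w"
      by (subst eq) (simp add: w power_mult_distrib r poly_const_pow z monom_power of_nat_poly)
    also have "\<dots> = pcompose (pCons a f) (monom 1 p) + smult (int p) ([:z:] + monom 1 p * r + w)"
      by (simp add: pcompose_pCons algebra_simps smult_add_right)
    finally show ?case by blast
  qed
  thus ?thesis using that by blast
qed

text \<open>Dedekind's argument. If the minimal polynomial \<open>m\<close> did not vanish at z =
  zeta^p, its cofactor \<open>h\<close> would, and differentiating m h = X^N - 1 would give m(z)
  h'(z) = N z^(N-1). By Frobenius, m(z) is a multiple of p in Z[zeta_N], so p would divide N
  there.\<close>

lemma ipoly_zeta_prime_conj:
  assumes "N > 0" "prime p" "\<not> p dvd N" "ipoly f (zeta N) = 0"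
  shows "ipoly f (zeta N ^ p) = 0"
proof -
  obtain m h where m: "lead_coeff m = 1" "m * h = monom 1 N - 1" "ipoly m (zeta N) = 0"
    "\<And>f. ipoly f (zeta N) = 0 \<Longrightarrow> m dvd f" using zeta_min_poly[OF assms(1)] by blast
  have "ipoly m (zeta N ^ p) = 0"
  proof (rule ccontr)
    assume nz: "ipoly m (zeta N ^ p) \<noteq> 0"
    define z where "z = zeta N ^ p"
    have zN: "z ^ N = 1" by (simp add: z_def mult.commute flip: power_mult) (simp add: power_mult)
    have "ipoly (m * h) z = 0" unfolding m(2) using zN by simp
    hence hz: "ipoly h z = 0" using nz by (simp add: z_def)
    obtain r where r: "m ^ p = pcompose m (monom 1 p) + smult (int p) r"
      using poly_frobenius[OF assms(2)] .
    from arg_cong[OF r, of "\<lambda>f. ipoly f (zeta N)"] m(3)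
    have mz: "ipoly m z = - of_nat p * ipoly r (zeta N)" using prime_gt_0_nat[OF assms(2)]
      by (simp add: z_def eq_neg_iff_add_eq_0 power_0_left split: if_splits)
    have "pderiv (m * h) = smult (int N) (monom 1 (N - 1))"
      by (simp add: m(2) pderiv_diff pderiv_monom smult_monom pderiv_1)
    from arg_cong[OF this, of "\<lambda>f. ipoly f z"] hz
    have "ipoly m z * ipoly (pderiv h) z = of_nat N * z ^ (N - 1)"
      by (simp add: pderiv_mult)
    hence "of_nat N * z ^ N = z * (ipoly m z * ipoly (pderiv h) z)"
      using assms(1) by (cases N) auto
    hence 1: "of_nat N = - of_nat p * (z * ipoly r (zeta N) * ipoly (pderiv h) z)"
      using zN mz by (simp add: mult_ac)
    \<comment> \<open>Divisibility in Z[zeta_N] is brought down to the integers: reduced modulo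
      \<open>m\<close>, the relation is a polynomial \<open>F\<close> of degree below that of
      \<open>m\<close> which vanishes at \<open>zeta N\<close>, so \<open>F = 0\<close>, and its
      constant coefficient shows that p divides N.\<close>
    define g where "g = monom 1 p * r * pcompose (pderiv h) (monom 1 p)"
    obtain q s where s: "g = m * q + s" "s = 0 \<or> degree s < degree m"
      using monic_division[OF m(1)] .
    define F where "F = [:int N:] + smult (int p) s"
    have degm: "degree m > 0"
    proof (rule ccontr)
      assume "\<not> degree m > 0"
      hence "m = 1" using m(1) by (metis degree_eq_zeroE gr0I lead_coeff_pCons(2) one_pCons pCons_eq_0_iff)
      thus False using m(3) by simp
    qed
    have "ipoly g (zeta N) = z * ipoly r (zeta N) * ipoly (pderiv h) z"
      by (simp add: g_def z_def)
    moreover have "ipoly g (zeta N) = ipoly s (zeta N)" using s(1) m(3) by simp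
    ultimately have "ipoly F (zeta N) = 0" using 1 by (simp add: F_def)
    hence "m dvd F" by (rule m(4))
    moreover have "degree F < degree m" unfolding F_def using s(2) degm
      by (intro degree_add_less) (auto intro: le_less_trans[OF degree_smult_le])
    ultimately have "F = 0" using dvd_imp_degree_le by (metis not_less)
    hence "coeff F 0 = 0" by simp
    hence "int N = - int p * coeff s 0" by (simp add: F_def)
    hence "int p dvd int N" by simp
    thus False using assms(3) by simp
  qed
  moreover obtain q where "f = m * q" using m(4)[OF assms(4)] by (elim dvdE)
  ultimately show ?thesis by simp
qed

text \<open>Primes are split off \<open>k\<close> one by one. As a consequence
  \<open>ipoly f (zeta N) \<mapsto> ipoly f (zeta N ^ k)\<close> is well defined: this is the
  irreducibility of the cyclotomic polynomial.\<close>

theorem ipoly_zeta_conj: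
  assumes "N > 0" "coprime k N" "ipoly f (zeta N) = 0"
  shows "ipoly f (zeta N ^ k) = 0"
  using assms(2,3)
proof (induction k arbitrary: f rule: less_induct)
  case (less k)
  consider "k = 0" | "k = 1" | "k > 1" by linarith
  thus ?case
  proof cases
    case 1
    hence "N = 1" using less.prems by simp
    thus ?thesis using less.prems 1 by simp
  next
    case 2 thus ?thesis using less.prems by simp
  next
    case 3
    then obtain p where p: "prime p" "p dvd k" using prime_factor_nat by (metis less_numeral_extra(4))
    then obtain j where j: "k = p * j" by (elim dvdE)
    have "\<not> p dvd N" using p less.prems by (meson coprime_common_divisor not_prime_unit)
    hence "ipoly f (zeta N ^ p) = 0" using less.prems p assms(1) ipoly_zeta_prime_conj by blast
    hence "ipoly (pcompose f (monom 1 p)) (zeta N) = 0" by simp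
    moreover have "j < k" "coprime j N" using j 3 prime_gt_1_nat[OF p(1)] less.prems by (auto intro: Nat.gr0I)
    ultimately have "ipoly (pcompose f (monom 1 p)) (zeta N ^ j) = 0" using less.IH by blast
    thus ?thesis by (simp add: j mult.commute flip: power_mult)
  qed
qed

subsection \<open>Galois conjugates\<close>

lemma root_of_unity_eq_zeta_power:
  assumes "N > 0" "z ^ N = 1"
  obtains k where "k < N" "z = zeta N ^ k"
proof -
  have "z \<in> {z. z ^ N = 1}" using assms by simp
  also have "\<dots> = (\<lambda>k. cis (2 * pi * real k / real N)) ` {..<N}"
    using bij_betw_roots_unity[OF assms(1)] by (simp add: bij_betw_def)
  finally show ?thesis using that by (auto simp: zeta_power)
qed

text \<open>The zeros of \<open>m\<close> are simple N-th roots of unity, and all are primitive: if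
  gcd(k, N) = g > 1 and d = N / g, then \<open>m\<close> divides w = (X^N - 1) / (X^d - 1), since
  \<open>zeta N\<close> is no zero of X^d - 1. A zero \<open>zeta N ^ k\<close> of \<open>m\<close>
  would be a common zero of \<open>w\<close> and X^d - 1, contradicting the separability of X^N -
  1.\<close>

lemma degree_min_poly_le:
  fixes m h :: "int poly"
  assumes "N > 0" and m: "m * h = monom 1 N - 1" 
    "\<And>f. ipoly f (zeta N) = 0 \<Longrightarrow> m dvd f"
  shows "degree m \<le> card (units_below N)"
proof -
  define M where "M = (map_poly of_int m :: complex poly)"
  have M: "poly M a = ipoly m a" for a by (simp add: M_def ipoly_def)
  have pderiv_M: "poly (pderiv M) a = ipoly (pderiv m) a" for a
  proof -
    have "pderiv M = map_poly of_int (pderiv m)"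
      by (rule poly_eqI) (simp add: M_def coeff_map_poly coeff_pderiv)
    thus ?thesis by (simp add: ipoly_def)
  qed
  have "m * h \<noteq> 0"
  proof
    assume "m * h = 0"
    hence "coeff (monom 1 N - 1 :: int poly) N = 0" using m(1) by simp
    thus False using assms(1) by (simp add: coeff_1)
  qed
  hence "m \<noteq> 0" by auto
  hence M0: "M \<noteq> 0" by (simp add: M_def map_poly_eq_0_iff)
  have root: "a ^ N = 1" if "ipoly m a = 0" for a
    using arg_cong[OF m(1), of "\<lambda>f. ipoly f a"] that by simp
  have simple: "ipoly g a \<noteq> 0" if fg: "f * g = monom 1 N - 1" and *: "ipoly f a = 0" for f g a
  proof
    assume **: "ipoly g a = 0"
    have "pderiv (f * g) = smult (int N) (monom 1 (N - 1))"
      by (simp add: fg pderiv_diff pderiv_monom smult_monom)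
    from arg_cong[OF this, of "\<lambda>f. ipoly f a"] * ** have "of_nat N * a ^ (N - 1) = 0"
      by (simp add: pderiv_mult)
    moreover have "a ^ N = 1" using arg_cong[OF fg, of "\<lambda>f. ipoly f a"] * by simp
    ultimately show False using assms(1) by (auto simp: power_0_left split: if_splits)
  qed
  have "rsquarefree M"
    unfolding rsquarefree_roots
  proof (intro allI notI)
    fix a assume "poly M a = 0 \<and> poly (pderiv M) a = 0"
    hence *: "ipoly m a = 0" "ipoly (pderiv m) a = 0" by (auto simp: M pderiv_M)
    have "pderiv (m * h) = smult (int N) (monom 1 (N - 1))"
      by (simp add: m(1) pderiv_diff pderiv_monom smult_monom)
    from arg_cong[OF this, of "\<lambda>f. ipoly f a"] * have "of_nat N * a ^ (N - 1) = 0"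
      by (auto simp: pderiv_mult)
    moreover have "a \<noteq> 0" using root[OF *(1)] assms(1) by (auto simp: power_0_left)
    ultimately show False using assms(1) by simp
  qed
  hence decomp: "smult (lead_coeff M) (\<Prod>z | poly M z = 0. [:- z, 1:]) = M"
    by (rule complex_poly_decompose_rsquarefree)
  have "degree M = degree (smult (lead_coeff M) (\<Prod>z | poly M z = 0. [:- z, 1:]))"
    by (simp only: decomp)
  also have "\<dots> = degree (\<Prod>z | poly M z = 0. [:- z, 1:])"
    using M0 by simp
  also have "\<dots> = card {x. poly M x = 0}"
    by (subst degree_prod_eq_sum_degree) auto
  finally have "degree M = card {x. poly M x = 0}" .
  also have "\<dots> \<le> card ((\<lambda>k. zeta N ^ k) ` units_below N)"
  proof (rule card_mono)
    show "{x. poly M x = 0} \<subseteq> (\<lambda>k. zeta N ^ k) ` units_below N"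
    proof
      fix a assume "a \<in> {x. poly M x = 0}"
      hence a: "ipoly m a = 0" by (simp add: M)
      obtain k where k: "k < N" "a = zeta N ^ k"
        using root_of_unity_eq_zeta_power[OF assms(1) root[OF a]] .
      have "coprime k N"
      proof (rule ccontr)
        assume nc: "\<not> coprime k N"
        define g where "g = gcd k N"
        have "g \<noteq> 1" unfolding g_def using nc by (rule contrapos_nn) (rule coprime_iff_gcd_eq_1[THEN iffD2])
        moreover have "g > 0" using assms(1) by (simp add: g_def)
        ultimately
        have g: "g > 1" by linarith
        obtain d where d: "N = d * g" unfolding g_def by (metis dvdE gcd_dvd2 mult.commute)
        obtain k' where k': "k = g * k'" unfolding g_def by (metis dvdE gcd_dvd1)
        have d0: "d > 0" "d < N" using d assms(1) g by (auto intro: Nat.gr0I)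
        define w where "w = (\<Sum>i<g. (monom 1 d :: int poly) ^ i)"
        have fw: "(monom 1 d - 1) * w = monom 1 N - 1"
          using power_diff_1_eq[of "monom 1 d :: int poly" g] by (simp add: w_def monom_power d)
        have "ipoly ((monom 1 d - 1) * w) (zeta N) = 0" by (simp add: fw)
        moreover have "zeta N ^ d \<noteq> 1" using d0 by (simp add: zeta_power_eq_1_iff assms(1) dvd_imp_le nat_dvd_not_less)
        ultimately have "ipoly w (zeta N) = 0" by simp
        hence "m dvd w" by (rule m(2))
        hence "ipoly w a = 0" using a by (auto elim!: dvdE)
        moreover have "a ^ d = (zeta N ^ N) ^ k'"
          by (simp only: k k' d flip: power_mult) (simp add: mult_ac)
        hence "ipoly (monom 1 d - 1) a = 0" by simp
        ultimately show False using simple[OF fw] by blast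
      qed
      thus "a \<in> (\<lambda>k. zeta N ^ k) ` units_below N" using k by (auto simp: units_below_def)
    qed
  qed auto
  also have "\<dots> \<le> card (units_below N)" by (rule card_image_le) auto
  also have "degree M = degree m" by (simp add: M_def degree_map_poly)
  finally show ?thesis .
qed

lemma inj_on_zeta_power: "N > 0 \<Longrightarrow> inj_on (\<lambda>k. zeta N ^ k) (units_below N)"
  by (auto simp: inj_on_def zeta_power_eq_iff units_below_def cong_def)

text \<open>Replaces the fixed field together with integral closedness: modulo the minimal
  polynomial, \<open>q\<close> has a remainder \<open>r\<close> of degree below the number of units,
  but \<open>r - c\<close> vanishes at as many distinct points, so \<open>r\<close> is the constant
  \<open>c\<close>.\<close>

lemma conj_invariant_in_Ints:
  assumes "N > 0" "\<And>j. j \<in> units_below N \<Longrightarrow> ipoly q (zeta N ^ j) = c"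
  shows "c \<in> \<int>"
proof -
  obtain m h where m: "lead_coeff m = 1" "m * h = monom 1 N - 1" "ipoly m (zeta N) = 0"
    "\<And>f. ipoly f (zeta N) = 0 \<Longrightarrow> m dvd f" using zeta_min_poly[OF assms(1)] by blast
  obtain s r where r: "q = m * s + r" "r = 0 \<or> degree r < degree m"
    using monic_division[OF m(1)] .
  have deg: "degree m \<le> card (units_below N)"
    using degree_min_poly_le[OF assms(1) m(2,4)] .
  define P where "P = map_poly of_int r - [:c:]"
  have root: "poly P (zeta N ^ j) = 0" if "j \<in> units_below N" for j
  proof -
    have "ipoly m (zeta N ^ j) = 0"
      using ipoly_zeta_conj[OF assms(1) _ m(3)] that by (simp add: units_below_def)
    thus ?thesis using assms(2)[OF that] r(1) by (simp add: P_def flip: ipoly_def)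
  qed
  have "P = 0"
  proof (rule ccontr)
    assume P0: "P \<noteq> 0"
    have card_pos: "card (units_below N) > 0"
      using one_mod_in_units_below[OF assms(1)] by (auto simp: card_gt_0_iff)
    have "card (units_below N) = card ((\<lambda>k. zeta N ^ k) ` units_below N)"
      by (simp add: card_image inj_on_zeta_power assms(1))
    also have "\<dots> \<le> card {x. poly P x = 0}"
      by (rule card_mono) (use root poly_roots_finite[OF P0] in auto)
    also have "\<dots> \<le> degree P" using P0 by (rule card_poly_roots_bound)
    also have "degree P \<le> degree r"
      unfolding P_def by (rule degree_diff_le) (auto simp: degree_map_poly)
    finally have le: "card (units_below N) \<le> degree r" .
    hence "r \<noteq> 0" using card_pos by auto
    thus False using le r(2) deg by auto
  qed
  hence "coeff P 0 = 0" by simp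
  hence "c = of_int (coeff r 0)" by (simp add: P_def coeff_map_poly)
  thus ?thesis by simp
qed

lemma conj_poly:
  assumes "N > 0"
  obtains G :: "int poly" where "lead_coeff G = 1"
    "map_poly of_int G = (\<Prod>k\<in>units_below N. [:- ipoly f (zeta N ^ k), 1:])"
proof -
  define P where "P = (\<Prod>k\<in>units_below N. [:- ipoly f (zeta N ^ k), 1:])"
  \<comment> \<open>\<open>PP\<close> lifts the characteristic polynomial \<open>P\<close> to
    coefficients in \<open>int poly\<close>, on which the substitution of \<open>zeta N ^ j\<close>
    can act. It only permutes the factors, so every coefficient of \<open>P\<close> is
    invariant.\<close>
  define PP where "PP = (\<Prod>k\<in>units_below N. [:- pcompose f (monom 1 k), 1:])"
  have hom: "map_poly (\<lambda>q. ipoly q y) PP = (\<Prod>k\<in>units_below N. [:- ipoly f (y ^ k), 1:])" for y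
    unfolding PP_def by (subst map_poly_hom_prod) (auto simp: map_poly_pCons)
  have int: "coeff P i \<in> \<int>" for i
  proof (rule conj_invariant_in_Ints[OF assms, of "coeff PP i"])
    fix j assume j: "j \<in> units_below N"
    have "map_poly (\<lambda>q. ipoly q (zeta N ^ j)) PP =
            (\<Prod>k\<in>units_below N. [:- ipoly f (zeta N ^ ((j * k) mod N)), 1:])"
      by (simp add: hom zeta_power_mod power_mult)
    also have "\<dots> = P" unfolding P_def
      by (rule prod.reindex_bij_betw[OF bij_betw_mult_units_below])
         (use assms j in \<open>auto simp: units_below_def\<close>)
    finally show "ipoly (coeff PP i) (zeta N ^ j) = coeff P i"
      by (metis coeff_map_poly ipoly_0)
  qed
  define G where "G = map_poly (\<lambda>c. \<lfloor>Re c\<rfloor>) P"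
  have PG: "map_poly of_int G = P"
  proof (rule poly_eqI)
    fix i
    have "of_int \<lfloor>Re (coeff P i)\<rfloor> = coeff P i" using int[of i] by (auto elim!: Ints_cases)
    thus "coeff (map_poly of_int G) i = coeff P i" by (simp add: G_def coeff_map_poly)
  qed
  have "lead_coeff (map_poly of_int G :: complex poly) = 1"
    by (simp add: PG P_def lead_coeff_prod)
  hence "lead_coeff G = 1" by (simp add: degree_map_poly coeff_map_poly)
  thus ?thesis using PG that by (simp add: P_def)
qed

lemma ipoly_conj_poly:
  assumes "N > 0" "map_poly of_int G = (\<Prod>k\<in>units_below N. [:- ipoly f (zeta N ^ k), 1:])"
  shows "ipoly G x = (\<Prod>k\<in>units_below N. x - ipoly f (zeta N ^ k))"
  by (simp add: ipoly_def assms poly_prod)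

lemma ipoly_zeta_mod_1:
  assumes "N > 0"
  shows "ipoly f (zeta N ^ (1 mod N)) = ipoly f (zeta N)"
  by (simp only: zeta_power_mod power_one_right)

lemma ipoly_conj_poly_root:
  assumes "N > 0" "map_poly of_int G = (\<Prod>k\<in>units_below N. [:- ipoly f (zeta N ^ k), 1:])"
  shows "ipoly G x = 0 \<longleftrightarrow> x \<in> (\<lambda>k. ipoly f (zeta N ^ k)) ` units_below N"
  by (auto simp: ipoly_conj_poly[OF assms])

lemma algebraic_int_ipoly_zeta:
  assumes "N > 0"
  shows "algebraic_int (ipoly f (zeta N))"
proof -
  obtain G where G: "lead_coeff G = 1"
    "map_poly of_int G = (\<Prod>k\<in>units_below N. [:- ipoly f (zeta N ^ k), 1:])"
    using conj_poly[OF assms] .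
  have "ipoly G (ipoly f (zeta N)) = 0"
    using ipoly_conj_poly_root[OF assms G(2)] one_mod_in_units_below[OF assms] ipoly_zeta_mod_1[OF assms]
    by (metis image_eqI)
  thus ?thesis using G(1) by (auto simp: algebraic_int_altdef_ipoly ipoly_def)
qed

section \<open>Comparison with conjugates defined by irreducible rational polynomials\<close>

lemma rat_poly_clear_denominators:
  fixes p :: "rat poly"
  obtains c P where "c \<noteq> 0" "smult (of_int c) p = map_poly of_int P"
proof -
  have "\<exists>c P. c \<noteq> 0 \<and> smult (of_int c) p = map_poly of_int P"
  proof (induction p)
    case 0 thus ?case by (intro exI[of _ 1] exI[of _ 0]) auto
  next
    case (pCons a p)
    then obtain c P where P: "c \<noteq> 0" "smult (of_int c) p = map_poly of_int P" by auto
    obtain u v where uv: "a = of_int u / of_int v" "v \<noteq> 0"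
      by (cases a) (auto simp: Fract_of_int_quotient)
    have "smult (of_int (c * v)) (pCons a p) = map_poly of_int (pCons (c * u) (smult v P))"
    proof -
      have "smult (of_int v) (smult (of_int c) p) = smult (of_int v) (map_poly of_int P)"
        by (simp only: P)
      also have "\<dots> = map_poly of_int (smult v P)"
        by (rule poly_eqI) (simp add: coeff_map_poly)
      finally show ?thesis using uv(2) by (simp add: map_poly_pCons uv(1) mult_ac)
    qed
    thus ?case using P(1) uv(2) by (intro exI[of _ "c * v"] exI conjI) auto
  qed
  thus ?thesis using that by blast
qed

lemma poly_of_rat_add: "poly (map_poly of_rat (p + q)) x = poly (map_poly of_rat p) x + poly (map_poly of_rat q) (x :: complex)"
proof -
  have "map_poly of_rat (p + q) = map_poly of_rat p + (map_poly of_rat q :: complex poly)"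
    by (rule poly_eqI) (simp add: coeff_map_poly of_rat_add)
  thus ?thesis by simp
qed

lemma poly_of_rat_mult: "poly (map_poly of_rat (p * q)) x = poly (map_poly of_rat p) x * poly (map_poly of_rat q) (x :: complex)"
  by (simp add: map_poly_hom_mult of_rat_add of_rat_mult)

lemma poly_of_rat_of_int: "poly (map_poly of_rat (map_poly of_int G)) x = ipoly G x"
proof -
  have "map_poly of_rat (map_poly of_int G) = (map_poly of_int G :: complex poly)"
    by (rule poly_eqI) (simp add: coeff_map_poly)
  thus ?thesis by (simp add: ipoly_def)
qed

lemma rat_min_poly:
  fixes \<alpha> :: complex and G :: "rat poly"
  assumes "G \<noteq> 0" "poly (map_poly of_rat G) \<alpha> = 0"
  obtains p :: "rat poly" where "Factorial_Ring.irreducible p" "poly (map_poly of_rat p) \<alpha> = 0"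
    "\<And>F. poly (map_poly of_rat F) \<alpha> = 0 \<Longrightarrow> p dvd F"
proof -
  define S where "S = {f :: rat poly. f \<noteq> 0 \<and> poly (map_poly of_rat f) \<alpha> = 0}"
  have GS: "G \<in> S" using assms by (simp add: S_def)
  define p where "p = arg_min degree (\<lambda>f. f \<in> S)"
  have p: "p \<in> S" "\<And>f. f \<in> S \<Longrightarrow> degree p \<le> degree f"
    unfolding p_def using arg_min_natI[of "\<lambda>f. f \<in> S", OF GS] arg_min_nat_le[of "\<lambda>f. f \<in> S"] by blast+
  have p0: "p \<noteq> 0" "poly (map_poly of_rat p) \<alpha> = 0" using p(1) by (auto simp: S_def)
  have dvd: "p dvd F" if "poly (map_poly of_rat F) \<alpha> = 0" for F
  proof -
    have "F = p * (F div p) + F mod p" by simp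
    hence "poly (map_poly of_rat F) \<alpha> = poly (map_poly of_rat (p * (F div p))) \<alpha> + poly (map_poly of_rat (F mod p)) \<alpha>"
      by (metis poly_of_rat_add)
    hence "poly (map_poly of_rat (F mod p)) \<alpha> = 0" using that p0(2) by (simp add: poly_of_rat_mult)
    hence "F mod p = 0" using p(2)[of "F mod p"] degree_mod_less[OF p0(1), of F]
      by (cases "F mod p = 0") (auto simp: S_def)
    thus ?thesis by auto
  qed
  have nu: "\<not> p dvd 1"
  proof
    assume "p dvd 1"
    then obtain q where "1 = p * q" by (elim dvdE)
    from arg_cong[OF this, of "\<lambda>f. poly (map_poly of_rat f) \<alpha>"] p0(2) show False
      by (simp add: poly_of_rat_mult map_poly_1)
  qed
  have "Factorial_Ring.irreducible p"
  proof (rule Factorial_Ring.irreducibleI)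
    fix a b assume ab: "p = a * b"
    have *: "b dvd 1" if ab: "p = a * b" and a0: "poly (map_poly of_rat a) \<alpha> = 0" for a b
    proof -
      obtain c where c: "a = p * c" using dvd[OF a0] by (elim dvdE)
      hence "a * b = p * (c * b)" by (simp only: mult.assoc)
      hence "p * 1 = p * (c * b)" using ab by simp
      hence "1 = c * b" using p0(1) by (metis mult_cancel_left)
      thus ?thesis by (metis dvd_triv_right)
    qed
    from p0(2) ab have "poly (map_poly of_rat a) \<alpha> = 0 \<or> poly (map_poly of_rat b) \<alpha> = 0"
      by (simp add: poly_of_rat_mult)
    thus "a dvd 1 \<or> b dvd 1" using *[of a b] *[of b a] ab by (auto simp: mult.commute)
  qed (use p0 nu in auto)
  thus ?thesis using that p0 dvd by blast
qed

text \<open>An irreducible polynomial vanishing at the number divides the characteristic polynomial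
  up to a unit, so its zeros are among the listed values. Conversely, composing an integral multiple
  of it with \<open>f\<close> gives a polynomial vanishing at \<open>zeta N\<close>, hence at every
  \<open>zeta N ^ k\<close>.\<close>

theorem conjugates_ipoly_zeta:
  assumes "N > 0"
  shows "conjugates (ipoly f (zeta N)) = (\<lambda>k. ipoly f (zeta N ^ k)) ` units_below N"
proof -
  define \<alpha> where "\<alpha> = ipoly f (zeta N)"
  obtain G where G: "lead_coeff G = 1"
    "map_poly of_int G = (\<Prod>k\<in>units_below N. [:- ipoly f (zeta N ^ k), 1:])"
    using conj_poly[OF assms] .
  define G' where "G' = (map_poly of_int G :: rat poly)"
  have "ipoly G \<alpha> = 0" unfolding \<alpha>_def
    using ipoly_conj_poly_root[OF assms G(2)] one_mod_in_units_below[OF assms] ipoly_zeta_mod_1[OF assms]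
    by (metis image_eqI)
  hence G\<alpha>: "poly (map_poly of_rat G') \<alpha> = 0" by (simp add: G'_def poly_of_rat_of_int)
  have "G \<noteq> 0" using G(1) by auto
  hence "G' \<noteq> 0" by (simp add: G'_def map_poly_eq_0_iff)
  from rat_min_poly[OF this G\<alpha>] obtain p where p: "Factorial_Ring.irreducible p" "poly (map_poly of_rat p) \<alpha> = 0"
    "\<And>F. poly (map_poly of_rat F) \<alpha> = 0 \<Longrightarrow> p dvd F" by blast
  show ?thesis
  proof (fold \<alpha>_def, intro equalityI subsetI)
    fix \<beta> assume "\<beta> \<in> conjugates \<alpha>"
    then obtain q where q: "Factorial_Ring.irreducible q" "poly (map_poly of_rat q) \<alpha> = 0" "poly (map_poly of_rat q) \<beta> = 0"
      by (auto simp: conjugates_def)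
    obtain u where u: "q = p * u" using p(3)[OF q(2)] by (elim dvdE)
    have "\<not> p dvd 1" using p(1) by (simp add: Factorial_Ring.irreducible_def)
    hence "u dvd 1" using Factorial_Ring.irreducibleD[OF q(1) u] by blast
    then obtain w where w: "1 = u * w" by (elim dvdE)
    have "poly (map_poly of_rat u) \<beta> * poly (map_poly of_rat w) \<beta> = 1"
      using arg_cong[OF w, of "\<lambda>f. poly (map_poly of_rat f) \<beta>"] by (simp add: poly_of_rat_mult map_poly_1)
    hence "poly (map_poly of_rat p) \<beta> = 0" using q(3) u by (auto simp: poly_of_rat_mult)
    moreover obtain v where "G' = p * v" using p(3)[OF G\<alpha>] by (elim dvdE)
    ultimately have "poly (map_poly of_rat G') \<beta> = 0" by (simp add: poly_of_rat_mult)
    hence "ipoly G \<beta> = 0" by (simp add: G'_def poly_of_rat_of_int)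
    thus "\<beta> \<in> (\<lambda>k. ipoly f (zeta N ^ k)) ` units_below N"
      using ipoly_conj_poly_root[OF assms G(2)] by blast
  next
    fix \<beta> assume "\<beta> \<in> (\<lambda>k. ipoly f (zeta N ^ k)) ` units_below N"
    then obtain k where k: "coprime k N" "\<beta> = ipoly f (zeta N ^ k)" by (auto simp: units_below_def)
    obtain c P where P: "c \<noteq> 0" "smult (of_int c) p = map_poly of_int P"
      using rat_poly_clear_denominators .
    have eq: "of_int c * poly (map_poly of_rat p) x = ipoly P x" for x
    proof -
      have "map_poly of_rat (smult (of_int c) p) = (smult (of_int c) (map_poly of_rat p) :: complex poly)"
        by (rule poly_eqI) (simp add: coeff_map_poly of_rat_mult)
      thus ?thesis using P(2) poly_of_rat_of_int[of P x] by simp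
    qed
    have "ipoly (pcompose P f) (zeta N) = 0" using eq[of \<alpha>] p(2) by (simp add: \<alpha>_def)
    hence "ipoly (pcompose P f) (zeta N ^ k) = 0" using ipoly_zeta_conj[OF assms k(1)] by blast
    hence "poly (map_poly of_rat p) \<beta> = 0" using eq[of \<beta>] P(1) k(2) by simp
    thus "\<beta> \<in> conjugates \<alpha>" using p(1,2) by (auto simp: conjugates_def)
  qed
qed

theorem house_ipoly_zeta_le_iff:
  assumes "N > 0"
  shows "(house (ipoly f (zeta N)))\<^sup>2 \<le> C \<longleftrightarrow> (\<forall>k\<in>units_below N. (cmod (ipoly f (zeta N ^ k)))\<^sup>2 \<le> C)"
proof -
  define A where "A = norm ` (\<lambda>k. ipoly f (zeta N ^ k)) ` units_below N"
  have A: "finite A" "A \<noteq> {}" using one_mod_in_units_below[OF assms] by (auto simp: A_def)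
  have h: "house (ipoly f (zeta N)) = Max A" by (simp add: house_def conjugates_ipoly_zeta[OF assms] A_def)
  have "Max A \<in> A" using A by simp
  moreover have "(\<forall>x\<in>A. x\<^sup>2 \<le> C)" if "(Max A)\<^sup>2 \<le> C"
  proof
    fix x assume x: "x \<in> A"
    hence "0 \<le> x" "x \<le> Max A" using A by (auto simp: A_def)
    hence "x\<^sup>2 \<le> (Max A)\<^sup>2" by (intro power_mono)
    thus "x\<^sup>2 \<le> C" using that by simp
  qed
  ultimately have "(Max A)\<^sup>2 \<le> C \<longleftrightarrow> (\<forall>x\<in>A. x\<^sup>2 \<le> C)" by blast
  thus ?thesis by (simp add: h) (simp add: A_def)
qed

subsection \<open>The ring of integers of a cyclotomic field\<close>

text \<open>The ring Z[zeta_N], which \<open>algebraic_int_in_zeta_ring\<close> identifies with the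
  ring of integers of Q(zeta_N).\<close>

definition zeta_ring :: "nat \<Rightarrow> complex set" where
  "zeta_ring N = range (\<lambda>f. ipoly f (zeta N))"

lemma zeta_ringI: "ipoly f (zeta N) \<in> zeta_ring N"
  by (simp add: zeta_ring_def)

lemma zeta_ringE:
  assumes "x \<in> zeta_ring N"
  obtains f where "x = ipoly f (zeta N)"
  using assms by (auto simp: zeta_ring_def)

lemma zeta_ring_add [intro]: "x \<in> zeta_ring N \<Longrightarrow> y \<in> zeta_ring N \<Longrightarrow> x + y \<in> zeta_ring N"
  by (metis zeta_ringE zeta_ringI ipoly_add)

lemma zeta_ring_mult [intro]: "x \<in> zeta_ring N \<Longrightarrow> y \<in> zeta_ring N \<Longrightarrow> x * y \<in> zeta_ring N"
  by (metis zeta_ringE zeta_ringI ipoly_mult)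

lemma zeta_ring_diff [intro]: "x \<in> zeta_ring N \<Longrightarrow> y \<in> zeta_ring N \<Longrightarrow> x - y \<in> zeta_ring N"
  by (metis zeta_ringE zeta_ringI ipoly_diff)

lemma zeta_ring_of_int [simp, intro]: "of_int c \<in> zeta_ring N"
  using zeta_ringI[of "[:c:]" N] by simp

lemma zeta_ring_of_nat [simp, intro]: "of_nat c \<in> zeta_ring N"
  using zeta_ring_of_int[of "int c" N] by simp

lemma zeta_ring_0_1 [simp]: "0 \<in> zeta_ring N" "1 \<in> zeta_ring N"
  using zeta_ring_of_nat[of 0 N] zeta_ring_of_nat[of 1 N] by simp_all

lemma zeta_ring_power [intro]: "x \<in> zeta_ring N \<Longrightarrow> x ^ n \<in> zeta_ring N"
  by (induction n) auto

lemma zeta_in_zeta_ring [simp]: "zeta N \<in> zeta_ring N"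
  using zeta_ringI[of "monom 1 1" N] by simp

lemma zeta_ring_sum [intro]: "(\<And>i. i \<in> A \<Longrightarrow> f i \<in> zeta_ring N) \<Longrightarrow> sum f A \<in> zeta_ring N"
  by (induction A rule: infinite_finite_induct) auto

lemma poly_frobenius_iterate:
  fixes f :: "int poly"
  assumes "prime p"
  shows "\<exists>r. f ^ (p ^ k) = pcompose f (monom 1 (p ^ k)) + smult (int p) r"
proof (induction k)
  case 0
  show ?case by (intro exI[of _ 0]) (simp add: monom_altdef pcompose_idR)
next
  case (Suc k)
  then obtain r where r: "f ^ (p ^ k) = pcompose f (monom 1 (p ^ k)) + smult (int p) r" by blast
  obtain r' where r': "(f ^ (p ^ k)) ^ p = pcompose (f ^ (p ^ k)) (monom 1 p) + smult (int p) r'"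
    using poly_frobenius[OF assms] .
  have "f ^ (p ^ Suc k) = pcompose (f ^ (p ^ k)) (monom 1 p) + smult (int p) r'"
    using r' by (simp only: power_Suc2 power_mult)
  also have "pcompose (f ^ (p ^ k)) (monom 1 p) = 
      pcompose f (pcompose (monom 1 (p ^ k)) (monom 1 p)) + smult (int p) (pcompose r (monom 1 p))"
    by (simp add: r pcompose_add pcompose_smult pcompose_assoc)
  also have "pcompose (monom 1 (p ^ k)) (monom 1 p) = (monom 1 (p ^ Suc k) :: int poly)"
  proof -
    have "pcompose (monom 1 n) g = g ^ n" for n and g :: "int poly"
      by (induction n) (auto simp: monom_Suc pcompose_pCons one_pCons)
    thus ?thesis by (simp add: monom_power)
  qed
  finally show ?case
    by (intro exI[of _ "pcompose r (monom 1 p) + r'"]) (simp add: smult_add_right)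
qed

lemma ipoly_in_zeta_ring:
  assumes "x \<in> zeta_ring N"
  shows "ipoly f x \<in> zeta_ring N"
proof -
  obtain g where "x = ipoly g (zeta N)" using assms by (rule zeta_ringE)
  thus ?thesis using zeta_ringI[of "pcompose f g" N] by simp
qed

lemma ipoly_diff_dvd:
  assumes "x \<in> zeta_ring N" "y \<in> zeta_ring N"
  obtains u where "u \<in> zeta_ring N" "ipoly f x - ipoly f y = (x - y) * u"
proof -
  have "\<exists>u. u \<in> zeta_ring N \<and> ipoly f x - ipoly f y = (x - y) * u"
  proof (induction f)
    case 0 show ?case by (intro exI[of _ 0]) auto
  next
    case (pCons a f)
    then obtain u where u: "u \<in> zeta_ring N" "ipoly f x - ipoly f y = (x - y) * u" by blast
    have "ipoly (pCons a f) x - ipoly (pCons a f) y = x * (ipoly f x - ipoly f y) + (x - y) * ipoly f y"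
      by (simp add: algebra_simps)
    also have "\<dots> = (x - y) * (x * u + ipoly f y)" by (simp add: u algebra_simps)
    finally have "ipoly (pCons a f) x - ipoly (pCons a f) y = (x - y) * (x * u + ipoly f y)" .
    moreover have "ipoly f y \<in> zeta_ring N" using assms(2) by (rule ipoly_in_zeta_ring)
    hence "x * u + ipoly f y \<in> zeta_ring N" using u(1) assms(1) by (intro zeta_ring_add zeta_ring_mult)
    ultimately show ?case by blast
  qed
  thus ?thesis using that by blast
qed

text \<open>The heart of the maximality of \<open>\<int>[\<zeta>]\<close> at \<open>q\<close>: the residue ring modulo \<open>\<pi>\<close> is perfect, while
  large powers of \<open>\<pi> * x\<close> are divisible by \<open>\<pi>\<close> as the powers of \<open>x\<close> have bounded denominators.\<close>

lemma zeta_ring_cancel_uniformizer: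
  fixes \<pi> x :: complex
  assumes "\<pi> \<noteq> 0" and R: "\<pi> \<in> zeta_ring N" "u \<in> zeta_ring N" and "e > 0" "\<pi> ^ e = of_nat q * u"
    and perfect: "\<And>y K. y \<in> zeta_ring N \<Longrightarrow> \<exists>t\<ge>K. \<exists>w\<in>zeta_ring N. y ^ t - y = \<pi> * w"
    and denom: "\<And>t. of_nat q ^ v * x ^ t \<in> zeta_ring N"
    and "\<pi> * x \<in> zeta_ring N"
  shows "x \<in> zeta_ring N"
proof -
  define y where "y = \<pi> * x"
  \<comment> \<open>Of the factors \<pi> in \<open>y ^ t\<close>, \<open>e * v\<close> supply the
    power \<open>q ^ v\<close> that clears the denominator of \<open>x ^ t\<close>, and one more is
    left over for divisibility by \<pi>.\<close>
  obtain t w where t: "t \<ge> Suc (e * v)" "w \<in> zeta_ring N" "y ^ t - y = \<pi> * w"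
    using perfect[OF assms(8)] unfolding y_def by blast
  define s where "s = t - Suc (e * v)"
  have "\<pi> ^ t = \<pi> ^ (e * v) * \<pi> * \<pi> ^ s" 
    using t(1) by (simp add: s_def flip: power_add power_Suc2 del: power_Suc)
  also have "\<pi> ^ (e * v) = of_nat q ^ v * u ^ v" by (simp add: power_mult assms(5) power_mult_distrib)
  finally have \<pi>t: "\<pi> ^ t = of_nat q ^ v * u ^ v * \<pi> * \<pi> ^ s" .
  have "y ^ t = \<pi> ^ t * x ^ t" by (simp add: y_def power_mult_distrib)
  also have "\<dots> = \<pi> * (u ^ v * \<pi> ^ s * (of_nat q ^ v * x ^ t))" by (simp only: \<pi>t mult_ac)
  finally have "y ^ t = \<pi> * (u ^ v * \<pi> ^ s * (of_nat q ^ v * x ^ t))" .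
  hence "\<pi> * x = \<pi> * (u ^ v * \<pi> ^ s * (of_nat q ^ v * x ^ t)) - \<pi> * w"
    using t(3) unfolding y_def by (metis add_diff_cancel_left' diff_add_cancel)
  hence "\<pi> * x = \<pi> * (u ^ v * \<pi> ^ s * (of_nat q ^ v * x ^ t) - w)"
    by (simp only: right_diff_distrib)
  hence "x = u ^ v * \<pi> ^ s * (of_nat q ^ v * x ^ t) - w" using assms(1) by simp
  also have "\<dots> \<in> zeta_ring N"
    by (intro zeta_ring_diff zeta_ring_mult zeta_ring_power R t denom)
  finally show ?thesis .
qed

text \<open>The monic equation writes each power of \<open>x\<close> as an integral combination of
  the powers below its degree \<open>d\<close>, and \<open>q ^ d\<close> clears the denominators of
  those.\<close>

lemma algebraic_int_bounded_denominators:
  fixes x :: complex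
  assumes "algebraic_int x" "of_nat q * x \<in> zeta_ring N"
  obtains v where "\<And>t. of_nat q ^ v * x ^ t \<in> zeta_ring N"
proof -
  obtain p where p: "poly (map_poly of_int p) x = 0" "lead_coeff p = 1"
    using assms(1) by (auto simp: algebraic_int_altdef_ipoly)
  define d where "d = degree p"
  have rel: "x ^ d = - (\<Sum>i<d. of_int (coeff p i) * x ^ i)"
  proof -
    have "0 = (\<Sum>i\<le>d. of_int (coeff p i) * x ^ i)"
      using p(1) by (simp add: poly_altdef d_def degree_map_poly coeff_map_poly)
    also have "\<dots> = (\<Sum>i<d. of_int (coeff p i) * x ^ i) + x ^ d"
      using p(2) by (simp add: d_def flip: lessThan_Suc_atMost)
    finally show ?thesis by (simp add: eq_neg_iff_add_eq_0 add.commute)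
  qed
  have "of_nat q ^ d * x ^ t \<in> zeta_ring N" for t
  proof (induction t rule: less_induct)
    case (less t)
    show ?case
    proof (cases "t < d")
      case True
      hence "(of_nat q :: complex) ^ d = of_nat q ^ (d - t) * of_nat q ^ t"
        by (simp flip: power_add)
      hence "of_nat q ^ d * x ^ t = of_nat q ^ (d - t) * (of_nat q * x) ^ t"
        by (simp only: power_mult_distrib mult.assoc)
      also have "\<dots> \<in> zeta_ring N" using assms(2) by auto
      finally show ?thesis .
    next
      case False
      hence "x ^ t = x ^ (t - d) * x ^ d" by (simp flip: power_add)
      also have "\<dots> = - (\<Sum>i<d. of_int (coeff p i) * x ^ (t - d + i))"
        unfolding rel by (simp add: sum_distrib_left power_add mult_ac)
      finally have "of_nat q ^ d * x ^ t = 0 - (\<Sum>i<d. of_int (coeff p i) * (of_nat q ^ d * x ^ (t - d + i)))"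
        by (simp add: sum_distrib_left mult_ac)
      also have "\<dots> \<in> zeta_ring N"
        by (intro zeta_ring_diff zeta_ring_sum zeta_ring_mult less.IH) (use False in auto)
      finally show ?thesis .
    qed
  qed
  thus ?thesis using that by blast
qed

text \<open>If \<open>q\<close> does not divide \<open>N\<close>, \<pi> is \<open>q\<close> itself.
  Otherwise \<pi> = 1 - \<omega>, where \<omega> has order the full power of \<open>q\<close> in
  \<open>N\<close>. In both cases a suitable iterate of Frobenius is the identity modulo \<pi>,
  because it fixes \<open>zeta N\<close> there.\<close>

lemma zeta_ring_prime_uniformizer:
  assumes "N > 0" "prime q"
  obtains \<pi> u e w where "\<pi> \<noteq> 0" "\<pi> \<in> zeta_ring N" "u \<in> zeta_ring N" "e > 0" "\<pi> ^ e = of_nat q * u"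
    "w \<in> zeta_ring N" "of_nat q = \<pi> * w"
    "\<And>y K. y \<in> zeta_ring N \<Longrightarrow> \<exists>t\<ge>K. \<exists>w\<in>zeta_ring N. y ^ t - y = \<pi> * w"
proof (cases "q dvd N")
  case False
  show ?thesis
  proof (rule that[of "of_nat q" 1 1 1])
    show "of_nat q \<noteq> (0 :: complex)" using assms(2) by (simp add: prime_gt_0_nat)
    fix y K assume "y \<in> zeta_ring N"
    then obtain f where f: "y = ipoly f (zeta N)" by (elim zeta_ringE)
    define k where "k = totient N * K"
    obtain r where r: "f ^ (q ^ k) = pcompose f (monom 1 (q ^ k)) + smult (int q) r"
      using poly_frobenius_iterate[OF assms(2)] by blast
    have "coprime q N" using False assms(2) by (simp add: prime_imp_coprime)
    hence "[q ^ totient N = 1] (mod N)" by (rule euler_theorem)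
    hence "[(q ^ totient N) ^ K = 1 ^ K] (mod N)" by (rule cong_pow)
    hence "[q ^ k = 1] (mod N)" by (simp add: k_def power_mult)
    from zeta_power_cong[OF this] have "zeta N ^ (q ^ k) = zeta N" by simp
    hence "y ^ (q ^ k) - y = of_nat q * ipoly r (zeta N)"
      using arg_cong[OF r, of "\<lambda>f. ipoly f (zeta N)"] by (simp add: f)
    moreover have "q ^ k \<ge> K"
    proof -
      have "totient N > 0" using assms(1) by simp
      hence "K \<le> k" by (simp add: k_def Suc_le_eq)
      also have "k < 2 ^ k" by (rule less_exp)
      also have "2 ^ k \<le> q ^ k" using prime_ge_2_nat[OF assms(2)] by (rule power_mono) auto
      finally show ?thesis by simp
    qed
    ultimately show "\<exists>t\<ge>K. \<exists>w\<in>zeta_ring N. y ^ t - y = of_nat q * w" using zeta_ringI by blast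
  qed auto
next
  case True
  define a where "a = multiplicity q N"
  obtain N' where N': "N = q ^ a * N'" "\<not> q dvd N'"
    unfolding a_def
    by (rule multiplicity_decompose'[of N q]) (use assms in \<open>auto simp: prime_nat_iff\<close>)
  have N'0: "N' > 0" using N' assms(1) by (auto intro: Nat.gr0I)
  have a0: "a > 0" using N' True by (auto intro: Nat.gr0I)
  have q2: "q \<ge> 2" using prime_ge_2_nat[OF assms(2)] .
  define \<omega> where "\<omega> = zeta N ^ N'"
  define \<pi> where "\<pi> = 1 - \<omega>"
  have \<omega>R: "\<omega> \<in> zeta_ring N" by (auto simp: \<omega>_def)
  have "q ^ a > 1" using a0 q2 by (intro one_less_power) auto
  hence "N' < N" using N'(1) N'0 by simp
  hence \<omega>1: "\<omega> \<noteq> 1" using N'0 by (auto simp: \<omega>_def zeta_power_eq_1_iff assms(1) dest: dvd_imp_le)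
  have "N' * q ^ a = N" using N'(1) by (simp only: mult.commute)
  hence \<omega>q: "\<omega> ^ (q ^ a) = 1"
    unfolding \<omega>_def by (simp only: zeta_power_N flip: power_mult)
  obtain r where r: "[:1, -1:] ^ (q ^ a) = pcompose [:1, -1:] (monom 1 (q ^ a)) + smult (int q) r"
    using poly_frobenius_iterate[OF assms(2)] by blast
  from arg_cong[OF r, of "\<lambda>f. ipoly f \<omega>"] \<omega>q have e: "\<pi> ^ (q ^ a) = of_nat q * ipoly r \<omega>"
    by (simp add: \<pi>_def)
  define \<eta> where "\<eta> = \<omega> ^ (q ^ (a - 1))"
  have qa: "q ^ a = q ^ (a - 1) * q" using a0 by (cases a) auto
  have \<eta>q: "\<eta> ^ q = 1" unfolding \<eta>_def by (simp only: \<omega>q flip: power_mult qa)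
  have "\<eta> \<noteq> 1"
  proof
    assume "\<eta> = 1"
    hence "zeta N ^ (N' * q ^ (a - 1)) = 1" by (simp only: \<eta>_def \<omega>_def power_mult)
    hence "N dvd N' * q ^ (a - 1)" by (simp only: zeta_power_eq_1_iff assms(1))
    hence "N \<le> N' * q ^ (a - 1)" using N'0 q2 by (intro dvd_imp_le) auto
    moreover have "N = N' * q ^ (a - 1) * q" using N'(1) qa by (simp only: mult_ac)
    moreover have "N' * q ^ (a - 1) > 0" using N'0 q2 by simp
    hence "N' * q ^ (a - 1) < N' * q ^ (a - 1) * q" using q2 by simp
    ultimately show False by simp
  qed
  have geo: "(\<Sum>i<q. \<eta> ^ i) = 0"
    using power_diff_1_eq[of \<eta> q] \<eta>q \<open>\<eta> \<noteq> 1\<close> by simp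
  have \<eta>R: "\<eta> \<in> zeta_ring N" using \<omega>R by (auto simp: \<eta>_def)
  \<comment> \<open>With Y = X^(q^(a-1)), the polynomial 1 + Y + ... + Y^(q-1) takes the value q at
    1 and 0 at \<omega>, so \<pi> = 1 - \<omega> divides q.\<close>
  obtain w1 where w1: "w1 \<in> zeta_ring N" "ipoly (\<Sum>i<q. (monom 1 (q ^ (a - 1))) ^ i) 1 - 
      ipoly (\<Sum>i<q. (monom 1 (q ^ (a - 1))) ^ i) \<omega> = (1 - \<omega>) * w1"
    by (rule ipoly_diff_dvd[OF zeta_ring_0_1(2) \<omega>R])
  hence w1': "of_nat q = \<pi> * w1" using geo by (simp add: \<pi>_def \<eta>_def flip: power_mult)
  have "ipoly r \<omega> \<in> zeta_ring N"
    using \<omega>R by (rule ipoly_in_zeta_ring)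
  show ?thesis
  proof (rule that[OF _ _ \<open>ipoly r \<omega> \<in> zeta_ring N\<close> _ e w1(1) w1'])
    show "\<pi> \<noteq> 0" using \<omega>1 by (simp add: \<pi>_def)
    show "\<pi> \<in> zeta_ring N" using \<omega>R by (auto simp: \<pi>_def)
    show "q ^ a > 0" using q2 by simp
    fix y K assume "y \<in> zeta_ring N"
    then obtain f where f: "y = ipoly f (zeta N)" by (elim zeta_ringE)
    \<comment> \<open>Now \<open>q ^ k\<close> is 1 modulo \<open>N'\<close> only, so
      \<open>zeta N\<close> is sent to \<open>zeta N * \<omega> ^ s\<close>, which is still
      congruent to it modulo \<pi>. The factor \<open>K\<close> merely makes the exponent
      large.\<close>
    define k where "k = totient N' * K"
    obtain r where r: "f ^ (q ^ k) = pcompose f (monom 1 (q ^ k)) + smult (int q) r"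
      using poly_frobenius_iterate[OF assms(2)] by blast
    have "coprime q N'" using N'(2) assms(2) by (simp add: prime_imp_coprime)
    hence "[q ^ totient N' = 1] (mod N')" by (rule euler_theorem)
    hence "[(q ^ totient N') ^ K = 1 ^ K] (mod N')" by (rule cong_pow)
    hence "[q ^ k = 1] (mod N')" by (simp add: k_def power_mult)
    hence "N' dvd q ^ k - 1" by (rule cong_to_1_nat)
    then obtain s where s: "q ^ k - 1 = N' * s" by (elim dvdE)
    have "q ^ k = Suc (q ^ k - 1)" using q2 by simp
    hence "zeta N ^ (q ^ k) = zeta N * zeta N ^ (q ^ k - 1)" by (metis power_Suc)
    also have "\<dots> = zeta N * \<omega> ^ s" by (simp only: s \<omega>_def power_mult)
    finally have zq: "zeta N ^ (q ^ k) = zeta N * \<omega> ^ s" .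
    have "\<omega> ^ s - 1 = (\<omega> - 1) * (\<Sum>i<s. \<omega> ^ i)" by (rule power_diff_1_eq)
    moreover have "zeta N ^ (q ^ k) - zeta N = zeta N * (\<omega> ^ s - 1)" by (simp add: zq algebra_simps)
    ultimately have "zeta N ^ (q ^ k) - zeta N = zeta N * ((\<omega> - 1) * (\<Sum>i<s. \<omega> ^ i))" by simp
    hence zq': "zeta N ^ (q ^ k) - zeta N = \<pi> * (- zeta N * (\<Sum>i<s. \<omega> ^ i))"
      by (simp add: \<pi>_def algebra_simps)
    obtain w2 where w2: "w2 \<in> zeta_ring N" "ipoly f (zeta N ^ (q ^ k)) - ipoly f (zeta N) = 
        (zeta N ^ (q ^ k) - zeta N) * w2"
      by (rule ipoly_diff_dvd[OF zeta_ring_power[OF zeta_in_zeta_ring] zeta_in_zeta_ring])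
    have "y ^ (q ^ k) - y = ipoly f (zeta N ^ (q ^ k)) - ipoly f (zeta N) + of_nat q * ipoly r (zeta N)"
      using arg_cong[OF r, of "\<lambda>f. ipoly f (zeta N)"] by (simp add: f)
    also have "\<dots> = \<pi> * ((0 - zeta N * (\<Sum>i<s. \<omega> ^ i)) * w2 + w1 * ipoly r (zeta N))"
      by (simp only: w2(2) zq' w1') (simp add: algebra_simps)
    finally have "y ^ (q ^ k) - y = \<pi> * ((0 - zeta N * (\<Sum>i<s. \<omega> ^ i)) * w2 + w1 * ipoly r (zeta N))" .
    moreover have "(0 - zeta N * (\<Sum>i<s. \<omega> ^ i)) * w2 + w1 * ipoly r (zeta N) \<in> zeta_ring N"
      by (intro zeta_ring_add zeta_ring_mult zeta_ring_diff zeta_ring_sum zeta_ring_power w1 w2 \<omega>R zeta_ringI) auto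
    moreover have "q ^ k \<ge> K"
    proof -
      have "totient N' > 0" using N'0 by simp
      hence "K \<le> k" by (simp add: k_def Suc_le_eq)
      also have "k < 2 ^ k" by (rule less_exp)
      also have "2 ^ k \<le> q ^ k" using q2 by (rule power_mono) auto
      finally show ?thesis by simp
    qed
    ultimately show "\<exists>t\<ge>K. \<exists>w\<in>zeta_ring N. y ^ t - y = \<pi> * w" by blast
  qed
qed

text \<open>Since \<open>\<pi> ^ e\<close> is a multiple of \<open>q\<close>, the product
  \<open>\<pi> ^ e * x\<close> lies in the ring; the factors \<pi> are then cancelled one at a
  time.\<close>

lemma algebraic_int_prime_denominator:
  fixes x :: complex
  assumes "N > 0" "prime q" "algebraic_int x" "of_nat q * x \<in> zeta_ring N"
  shows "x \<in> zeta_ring N"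
proof -
  obtain \<pi> u e w where *: "\<pi> \<noteq> 0" "\<pi> \<in> zeta_ring N" "u \<in> zeta_ring N" "e > 0" "\<pi> ^ e = of_nat q * u"
    "w \<in> zeta_ring N" "of_nat q = \<pi> * w"
    "\<And>y K. y \<in> zeta_ring N \<Longrightarrow> \<exists>t\<ge>K. \<exists>w\<in>zeta_ring N. y ^ t - y = \<pi> * w"
    using zeta_ring_prime_uniformizer[OF assms(1,2)] by metis
  obtain v where v: "\<And>t. of_nat q ^ v * x ^ t \<in> zeta_ring N"
    using algebraic_int_bounded_denominators[OF assms(3,4)] by blast
  have "\<pi> ^ i * x \<in> zeta_ring N \<Longrightarrow> x \<in> zeta_ring N" for i
  proof (induction i)
    case (Suc i)
    have "of_nat q ^ v * (\<pi> ^ i * x) ^ t \<in> zeta_ring N" for t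
    proof -
      have "(\<pi> ^ i) ^ t * (of_nat q ^ v * x ^ t) \<in> zeta_ring N"
        by (rule zeta_ring_mult[OF zeta_ring_power[OF zeta_ring_power[OF *(2)]] v])
      thus ?thesis by (simp add: power_mult_distrib mult_ac)
    qed
    from zeta_ring_cancel_uniformizer[OF *(1-5,8) this] Suc.prems
    have "\<pi> ^ i * x \<in> zeta_ring N" by (simp add: mult_ac)
    thus ?case by (rule Suc.IH)
  qed simp
  moreover have "\<pi> ^ e * x = u * (of_nat q * x)" by (simp add: *)
  hence "\<pi> ^ e * x \<in> zeta_ring N" using *(3) assms(4) by (metis zeta_ring_mult)
  ultimately show ?thesis by blast
qed

lemma algebraic_int_of_nat_mult:
  fixes x :: complex
  assumes "algebraic_int x"
  shows "algebraic_int (of_nat c * x)"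
proof -
  obtain p where p: "poly (map_poly of_int p) x = 0" "lead_coeff p = 1"
    using assms by (auto simp: algebraic_int_altdef_ipoly)
  define d where "d = degree p"
  define P where "P = (\<Sum>i\<le>d. monom (coeff p i * int c ^ (d - i)) i)"
  have coeff: "coeff P j = (if j \<le> d then coeff p j * int c ^ (d - j) else 0)" for j
    by (simp add: P_def coeff_sum)
  have "degree P = d"
  proof (rule antisym)
    show "degree P \<le> d" by (rule degree_le) (auto simp: coeff)
    show "d \<le> degree P" using p(2) by (intro le_degree) (simp add: coeff d_def)
  qed
  hence "lead_coeff P = 1" using p(2) by (simp add: coeff d_def)
  moreover have "poly (map_poly of_int P) (of_nat c * x) = of_nat c ^ d * poly (map_poly of_int p) x"
  proof -
    have "poly (map_poly of_int P) (of_nat c * x) = (\<Sum>i\<le>d. of_int (coeff P i) * (of_nat c * x) ^ i)"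
      by (simp add: poly_altdef \<open>degree P = d\<close> degree_map_poly coeff_map_poly)
    also have "\<dots> = (\<Sum>i\<le>d. of_nat c ^ d * (of_int (coeff p i) * x ^ i))"
    proof (intro sum.cong refl)
      fix i assume "i \<in> {..d}"
      hence "(of_nat c :: complex) ^ d = of_nat c ^ (d - i) * of_nat c ^ i" by (simp flip: power_add)
      thus "of_int (coeff P i) * (of_nat c * x) ^ i = of_nat c ^ d * (of_int (coeff p i) * x ^ i)"
        using \<open>i \<in> {..d}\<close> by (simp add: coeff power_mult_distrib mult_ac)
    qed
    also have "\<dots> = of_nat c ^ d * poly (map_poly of_int p) x"
      by (simp add: poly_altdef d_def degree_map_poly coeff_map_poly sum_distrib_left)
    finally show ?thesis .
  qed
  ultimately show ?thesis using p(1) by (auto simp: algebraic_int_altdef_ipoly intro!: exI[of _ P])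
qed

text \<open>The prime factors of the denominator \<open>n\<close> are removed one at a time.\<close>

theorem algebraic_int_in_zeta_ring:
  fixes x :: complex
  assumes "N > 0" "algebraic_int x" "n > 0" "of_nat n * x \<in> zeta_ring N"
  shows "x \<in> zeta_ring N"
  using assms(2-)
proof (induction n arbitrary: x rule: less_induct)
  case (less n)
  show ?case
  proof (cases "n = 1")
    case True thus ?thesis using less.prems by simp
  next
    case False
    then obtain q where q: "prime q" "q dvd n" using prime_factor_nat by blast
    then obtain n' where n': "n = q * n'" by (elim dvdE)
    have "of_nat n' * x \<in> zeta_ring N"
      using algebraic_int_prime_denominator[OF assms(1) q(1) algebraic_int_of_nat_mult[OF less.prems(1)], of n']
        less.prems(3) n' by (simp add: mult_ac)
    moreover have "n' < n" "n' > 0" using n' less.prems(2) prime_gt_1_nat[OF q(1)] by (auto intro: Nat.gr0I)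
    ultimately show ?thesis using less.IH[of n' x] less.prems by blast
  qed
qed

subsection \<open>Cyclotomic numbers\<close>

lemma zeta_ring_mono:
  assumes "M > 0" "x \<in> zeta_ring N"
  shows "x \<in> zeta_ring (M * N)"
  using assms by (metis ipoly_monom ipoly_pcompose mult_1 of_int_1 zeta_mult_power zeta_ringE zeta_ringI)

text \<open>The characteristic polynomial has constant term \<open>g\<close>, the norm of
  \<open>x\<close> up to sign; writing it as g + X H turns G(x) = 0 into
  \<open>x * H(x) = - g\<close>, so \<bar>g\<bar> clears the denominator of the inverse.\<close>

lemma zeta_ring_inverse:
  assumes "N > 0" "x \<in> zeta_ring N" "x \<noteq> 0"
  obtains n where "n > 0" "of_nat n * inverse x \<in> zeta_ring N"
proof -
  obtain f where f: "x = ipoly f (zeta N)" using assms(2) by (elim zeta_ringE)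
  obtain G where G: "lead_coeff G = 1"
    "map_poly of_int G = (\<Prod>k\<in>units_below N. [:- ipoly f (zeta N ^ k), 1:])"
    using conj_poly[OF assms(1)] .
  obtain g H where gH: "G = pCons g H" by (cases G)
  have "ipoly G x = 0"
    using ipoly_conj_poly_root[OF assms(1) G(2)] one_mod_in_units_below[OF assms(1)] ipoly_zeta_mod_1[OF assms(1)]
    by (metis f image_eqI)
  hence eq: "of_int g + x * ipoly H x = 0" by (simp add: gH)
  \<comment> \<open>An irreducible rational polynomial vanishing at 0 is a constant multiple of X,
    so 0 is conjugate to no other number.\<close>
  have "ipoly f (zeta N ^ k) \<noteq> 0" if "k \<in> units_below N" for k
  proof
    assume "ipoly f (zeta N ^ k) = 0"
    hence "0 \<in> conjugates x" using that by (force simp: f conjugates_ipoly_zeta[OF assms(1)])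
    then obtain p :: "rat poly" where p: "Factorial_Ring.irreducible p" "poly (map_poly of_rat p) x = 0"
      "poly (map_poly of_rat p) (0 :: complex) = 0"
      by (auto simp: conjugates_def)
    have "coeff p 0 = 0" using p(3) by (simp add: poly_0_coeff_0 coeff_map_poly)
    then obtain r where r: "p = [:0, 1:] * r" by (cases p) (auto simp: pCons_eq_iff)
    have "\<not> [:0, 1:] dvd (1 :: rat poly)" by (simp add: is_unit_pCons_iff)
    hence "r dvd 1" using Factorial_Ring.irreducibleD[OF p(1) r] by blast
    then obtain c where "r = [:c:]" "c \<noteq> 0" by (metis is_unit_polyE not_is_unit_0)
    hence "p = [:0, c:]" using r by simp
    thus False using p(2) \<open>c \<noteq> 0\<close> assms(3) by (simp add: map_poly_pCons)
  qed
  hence "ipoly G 0 \<noteq> 0" using ipoly_conj_poly[OF assms(1) G(2), of 0] by simp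
  hence g: "g \<noteq> 0" by (simp add: gH)
  have "x * ipoly H x = - of_int g" using eq by (simp add: eq_neg_iff_add_eq_0 add.commute)
  hence "of_int g * inverse x = - ipoly H x" using assms(3) by (simp add: field_simps)
  moreover have "of_int \<bar>g\<bar> * inverse x = of_int (sgn g) * (of_int g * inverse x)"
    by (simp add: abs_sgn mult_ac)
  ultimately have "of_int \<bar>g\<bar> * inverse x = - of_int (sgn g) * ipoly H x" by simp
  also have "\<dots> \<in> zeta_ring N"
    unfolding f by (metis ipoly_pcompose ipoly_smult of_int_minus zeta_ringI)
  finally have "of_nat (nat \<bar>g\<bar>) * inverse x \<in> zeta_ring N" by simp
  thus ?thesis using that[of "nat \<bar>g\<bar>"] g by simp
qed

lemma inv_ring_of_type_algebra:
  assumes "(x :: complex) \<noteq> 0"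
  shows "inv\<^bsub>ring_of_type_algebra\<^esub> x = inverse x"
proof -
  interpret field "ring_of_type_algebra :: complex ring" by (rule field_from_type_algebra)
  show ?thesis using assms by (intro comm_inv_char) (auto simp: ring_of_type_algebra_def)
qed

text \<open>Numbers with such a multiple form a field containing all generators: sums and products
  pass to a common conductor and denominator, inverses use the norm.\<close>

lemma cyclotomic_numbers_cases:
  assumes "x \<in> cyclotomic_numbers"
  shows "\<exists>N n. N > 0 \<and> n > 0 \<and> of_nat n * x \<in> zeta_ring N"
proof -
  have common: "\<exists>N n. N > 0 \<and> n > 0 \<and> of_nat n * x \<in> zeta_ring N \<and> of_nat n * y \<in> zeta_ring N"
    if "\<exists>N n. N > 0 \<and> n > 0 \<and> of_nat n * x \<in> zeta_ring N" "\<exists>N n. N > 0 \<and> n > 0 \<and> of_nat n * y \<in> zeta_ring N"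
    for x y
  proof -
    from that obtain N1 n1 N2 n2 where *: "N1 > 0" "n1 > 0" "of_nat n1 * x \<in> zeta_ring N1"
      "N2 > 0" "n2 > 0" "of_nat n2 * y \<in> zeta_ring N2" by blast
    have "of_nat n1 * x \<in> zeta_ring (N1 * N2)" using zeta_ring_mono[OF *(4,3)] by (simp add: mult.commute)
    hence "of_nat n2 * (of_nat n1 * x) \<in> zeta_ring (N1 * N2)" by blast
    moreover have "of_nat n2 * y \<in> zeta_ring (N1 * N2)" using zeta_ring_mono[OF *(1,6)] .
    hence "of_nat n1 * (of_nat n2 * y) \<in> zeta_ring (N1 * N2)" by blast
    ultimately show ?thesis using * by (intro exI[of _ "N1 * N2"] exI[of _ "n1 * n2"]) (auto simp: mult_ac)
  qed
  let ?R = "ring_of_type_algebra :: complex ring"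
  have "x \<in> generate_field ?R (\<rat> \<union> roots_of_unity)" using assms by (simp add: cyclotomic_numbers_def)
  thus ?thesis
  proof induction
    case one
    show ?case by (intro exI[of _ 1]) (auto simp: ring_of_type_algebra_def)
  next
    case (incl h)
    thus ?case
    proof
      assume "h \<in> \<rat>"
      then obtain a b where "b > 0" "h = of_int a / of_int b" by (auto elim: Rats_cases')
      hence "of_nat (nat b) * h = of_int a" by simp
      thus ?thesis using \<open>b > 0\<close> by (intro exI[of _ 1] exI[of _ "nat b"]) auto
    next
      assume "h \<in> roots_of_unity"
      then obtain n where n: "n > 0" "h ^ n = 1" by (auto simp: roots_of_unity_def)
      then obtain k where "h = zeta n ^ k" using root_of_unity_eq_zeta_power by blast
      thus ?thesis using n by (intro exI[of _ n] exI[of _ 1]) auto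
    qed
  next
    case (a_inv h)
    interpret field ?R by (rule field_from_type_algebra)
    have "\<ominus>\<^bsub>?R\<^esub> h = - h" by (rule minus_equality) (auto simp: ring_of_type_algebra_def)
    moreover obtain N n where "N > 0" "n > 0" "of_nat n * h \<in> zeta_ring N" using a_inv by blast
    moreover from this have "0 - of_nat n * h \<in> zeta_ring N" by (intro zeta_ring_diff) auto
    ultimately show ?case by (intro exI[of _ N] exI[of _ n]) auto
  next
    case (m_inv h)
    have h: "h \<noteq> 0" using m_inv by (simp add: ring_of_type_algebra_def)
    obtain N n where N: "N > 0" "n > 0" "of_nat n * h \<in> zeta_ring N" using m_inv by blast
    obtain m where m: "m > 0" "of_nat m * inverse (of_nat n * h) \<in> zeta_ring N"
      using zeta_ring_inverse[OF N(1,3)] N(2) h by auto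
    have "of_nat n * (of_nat m * inverse (of_nat n * h)) \<in> zeta_ring N" using m by blast
    also have "of_nat n * (of_nat m * inverse (of_nat n * h)) = of_nat m * inverse h"
      using N(2) h by (simp add: field_simps)
    finally show ?case using N m h by (auto simp: inv_ring_of_type_algebra)
  next
    case (eng_add h1 h2)
    obtain N n where N: "N > 0" "n > 0" "of_nat n * h1 \<in> zeta_ring N" "of_nat n * h2 \<in> zeta_ring N"
      using common[OF eng_add(3,4)] by blast
    hence "of_nat n * h1 + of_nat n * h2 \<in> zeta_ring N" by blast
    thus ?case using N by (intro exI[of _ N] exI[of _ n]) (auto simp: ring_of_type_algebra_def distrib_left)
  next
    case (eng_mult h1 h2)
    obtain N n where N: "N > 0" "n > 0" "of_nat n * h1 \<in> zeta_ring N" "of_nat n * h2 \<in> zeta_ring N"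
      using common[OF eng_mult(3,4)] by blast
    hence "(of_nat n * h1) * (of_nat n * h2) \<in> zeta_ring N" by blast
    thus ?case using N by (intro exI[of _ N] exI[of _ "n * n"]) (auto simp: ring_of_type_algebra_def mult_ac)
  qed
qed

theorem cyclotomic_integers_cases:
  assumes "x \<in> cyclotomic_integers"
  obtains N where "N > 0" "x \<in> zeta_ring N"
proof -
  from assms have x: "x \<in> cyclotomic_numbers" "algebraic_int x" by (auto simp: cyclotomic_integers_def)
  obtain N n where "N > 0" "n > 0" "of_nat n * x \<in> zeta_ring N" using cyclotomic_numbers_cases[OF x(1)] by blast
  thus ?thesis using algebraic_int_in_zeta_ring[OF _ x(2)] that by blast
qed

lemma zeta_ring_subset_cyclotomic_integers:
  assumes "N > 0" "x \<in> zeta_ring N"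
  shows "x \<in> cyclotomic_integers"
proof -
  let ?G = "generate_field (ring_of_type_algebra :: complex ring) (\<rat> \<union> roots_of_unity)"
  have add: "a + b \<in> ?G" if "a \<in> ?G" "b \<in> ?G" for a b
    using generate_field.eng_add[OF that] by (simp add: ring_of_type_algebra_def)
  have mult: "a * b \<in> ?G" if "a \<in> ?G" "b \<in> ?G" for a b
    using generate_field.eng_mult[OF that] by (simp add: ring_of_type_algebra_def)
  have "zeta N \<in> roots_of_unity" using assms(1) by (auto simp: roots_of_unity_def intro!: exI[of _ N])
  hence "zeta N \<in> ?G" by (intro generate_field.incl) auto
  moreover have "of_int a \<in> ?G" for a by (intro generate_field.incl) auto
  ultimately have "ipoly f (zeta N) \<in> ?G" for f
  proof (induction f)
    case 0
    show ?case using 0(2)[of 0] by simp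
  next
    case (pCons a f)
    thus ?case by (simp add: add mult)
  qed
  moreover obtain f where "x = ipoly f (zeta N)" using assms(2) by (elim zeta_ringE)
  ultimately show ?thesis
    using algebraic_int_ipoly_zeta[OF assms(1)] by (auto simp: cyclotomic_integers_def cyclotomic_numbers_def)
qed

subsection \<open>Mean values over conjugates\<close>

text \<open>Cassels's mean of the squared conjugates, multiplied by
  \<open>card (units_below N)\<close> so that it splits additively along a factorisation of the
  conductor.\<close>

definition conj_sq_sum :: "nat \<Rightarrow> int poly \<Rightarrow> real" where
  "conj_sq_sum N f = (\<Sum>k\<in>units_below N. (cmod (ipoly f (zeta N ^ k)))\<^sup>2)"

lemma conj_sq_sum_nonneg: "conj_sq_sum N f \<ge> 0"
  by (simp add: conj_sq_sum_def sum_nonneg)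

section \<open>Fourier analysis modulo \<open>p\<close>\<close>

lemma geometric_sum_zeta:
  assumes "p > 0" "\<not> p dvd j"
  shows "(\<Sum>s<p. zeta p ^ (j * s)) = 0"
proof -
  have "zeta p ^ j \<noteq> 1" using assms by (simp add: zeta_power_eq_1_iff)
  moreover have "(zeta p ^ j) ^ p = 1"
    by (metis mult.commute power_mult power_one zeta_power_N)
  ultimately show ?thesis
    using power_diff_1_eq[of "zeta p ^ j" p] by (simp add: power_mult)
qed

lemma parseval_zeta:
  assumes "p > 0"
  shows "(\<Sum>s<p. (cmod (\<Sum>j<p. zeta p ^ (j * s) * c j))\<^sup>2) = real p * (\<Sum>j<p. (cmod (c j))\<^sup>2)"
proof -
  have orth: "(\<Sum>s<p. zeta p ^ (j * s) * cnj (zeta p ^ (l * s))) = (if j = l then of_nat p else 0)"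
    if "j < p" "l < p" for j l
  proof (cases "j = l")
    case True
    have "zeta p ^ i * cnj (zeta p ^ i) = 1" for i
      by (metis complex_norm_square norm_power norm_zeta of_real_1 power_one)
    thus ?thesis using True by simp
  next
    case False
    define x where "x = zeta p ^ j * cnj (zeta p ^ l)"
    have cn: "cnj (zeta p ^ l) * zeta p ^ l = 1"
      by (metis complex_norm_square mult.commute norm_power norm_zeta of_real_1 power_one)
    have "x \<noteq> 1"
    proof
      assume "x = 1"
      hence "zeta p ^ j = zeta p ^ l" using cn unfolding x_def by (metis mult.assoc mult.right_neutral mult_1)
      thus False using that False assms by (simp add: zeta_power_eq_iff cong_def)
    qed
    moreover have "x ^ p = 1"
    proof -
      have "(zeta p ^ i) ^ p = 1" for i by (metis mult.commute power_mult power_one zeta_power_N)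
      thus ?thesis by (simp add: x_def power_mult_distrib flip: complex_cnj_power)
    qed
    ultimately have "(\<Sum>s<p. x ^ s) = 0" using power_diff_1_eq[of x p] by simp
    thus ?thesis using False by (simp add: x_def power_mult_distrib power_mult)
  qed
  have "complex_of_real (\<Sum>s<p. (cmod (\<Sum>j<p. zeta p ^ (j * s) * c j))\<^sup>2) =
      (\<Sum>s<p. (\<Sum>j<p. zeta p ^ (j * s) * c j) * cnj (\<Sum>l<p. zeta p ^ (l * s) * c l))"
    by (simp only: of_real_sum complex_norm_square)
  also have "\<dots> = (\<Sum>s<p. \<Sum>j<p. \<Sum>l<p. c j * cnj (c l) * (zeta p ^ (j * s) * cnj (zeta p ^ (l * s))))"
    by (simp add: sum_product mult_ac)
  also have "\<dots> = (\<Sum>j<p. \<Sum>l<p. \<Sum>s<p. c j * cnj (c l) * (zeta p ^ (j * s) * cnj (zeta p ^ (l * s))))"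
    by (subst sum.swap, rule sum.cong[OF refl], subst sum.swap, rule refl)
  also have "\<dots> = (\<Sum>j<p. \<Sum>l<p. c j * cnj (c l) * (if j = l then of_nat p else 0))"
    by (intro sum.cong refl, subst sum_distrib_left[symmetric], subst orth) auto
  also have "\<dots> = (\<Sum>j<p. c j * cnj (c j) * of_nat p)"
  proof (rule sum.cong[OF refl])
    fix j assume "j \<in> {..<p}"
    have "(\<Sum>l<p. c j * cnj (c l) * (if j = l then of_nat p else 0)) =
        (\<Sum>l<p. if j = l then c j * cnj (c l) * of_nat p else 0)"
      by (intro sum.cong) auto
    thus "(\<Sum>l<p. c j * cnj (c l) * (if j = l then of_nat p else 0)) = c j * cnj (c j) * of_nat p"
      using \<open>j \<in> {..<p}\<close> by simp
  qed
  also have "\<dots> = complex_of_real (real p * (\<Sum>j<p. (cmod (c j))\<^sup>2))"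
    by (simp add: sum_distrib_left mult_ac flip: complex_norm_square)
  finally show ?thesis by (simp only: of_real_eq_iff)
qed

section \<open>Splitting a prime off the conductor\<close>

lemma ipoly_decompose:
  assumes "\<And>i. zeta N ^ i = \<theta> ^ h i * zeta M ^ m i" "\<And>i. h i < p"
  obtains g where "\<And>k. ipoly f (zeta N ^ k) = (\<Sum>j<p. \<theta> ^ (j * k) * ipoly (g j) (zeta M ^ k))"
proof -
  \<comment> \<open>The exponents are grouped by \<open>h\<close> before any power is taken, so the
    same coefficients serve every \<open>k\<close> and the decomposition commutes with all
    conjugations.\<close>
  define g where "g j = (\<Sum>i\<in>{i. i \<in> {..degree f} \<and> h i = j}. monom (coeff f i) (m i))" for j :: nat
  have "ipoly f (zeta N ^ k) = (\<Sum>j<p. \<theta> ^ (j * k) * ipoly (g j) (zeta M ^ k))" for k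
  proof -
    have pow: "(zeta N ^ k) ^ i = \<theta> ^ (h i * k) * (zeta M ^ k) ^ m i" for i
    proof -
      have "(zeta N ^ k) ^ i = (zeta N ^ i) ^ k" by (simp add: mult.commute flip: power_mult)
      thus ?thesis by (simp add: assms(1) power_mult_distrib mult.commute flip: power_mult)
    qed
    have "ipoly f (zeta N ^ k) = (\<Sum>i\<le>degree f. of_int (coeff f i) * (zeta N ^ k) ^ i)"
      by (simp add: ipoly_def poly_altdef degree_map_poly coeff_map_poly)
    also have "\<dots> = (\<Sum>j<p. \<Sum>i\<in>{i. i \<in> {..degree f} \<and> h i = j}. of_int (coeff f i) * (zeta N ^ k) ^ i)"
      by (rule sum.group[symmetric]) (use assms(2) in auto)
    also have "\<dots> = (\<Sum>j<p. \<theta> ^ (j * k) * ipoly (g j) (zeta M ^ k))"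
      by (intro sum.cong refl) (simp add: g_def pow sum_distrib_left mult_ac)
    finally show ?thesis .
  qed
  thus ?thesis using that by blast
qed

text \<open>As \<open>p\<close> divides \<open>M\<close>, being prime to \<open>p * M\<close> is the
  same as being prime to \<open>M\<close>, so every lift of a unit is a unit.\<close>

lemma bij_betw_units_below_ramified:
  assumes "p > 0" "M > 0" "prime p" "p dvd M"
  shows "bij_betw (\<lambda>(k, s). k + M * s) (units_below M \<times> {..<p}) (units_below (p * M))"
proof (rule bij_betwI')
  fix x y assume xy: "x \<in> units_below M \<times> {..<p}" "y \<in> units_below M \<times> {..<p}"
  obtain k s k' s' where *: "x = (k, s)" "y = (k', s')" by (cases x, cases y) auto
  have "(k + M * s) mod M = k" "(k + M * s) div M = s" "(k' + M * s') mod M = k'" "(k' + M * s') div M = s'"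
    using xy assms(2) by (auto simp: * units_below_def)
  thus "((case x of (k, s) \<Rightarrow> k + M * s) = (case y of (k, s) \<Rightarrow> k + M * s)) = (x = y)"
    unfolding * by auto
next
  fix x assume x: "x \<in> units_below M \<times> {..<p}"
  obtain k s where *: "x = (k, s)" by (cases x)
  have k: "k < M" "coprime k M" "s < p" using x by (auto simp: * units_below_def)
  have "k + M * s < M + M * s" using k by simp
  also have "\<dots> = M * Suc s" by simp
  also have "\<dots> \<le> M * p" using k by (intro mult_left_mono) auto
  finally have lt: "k + M * s < p * M" by (simp add: mult.commute)
  have "(k + M * s) mod M = k" using k by simp
  hence cM: "coprime (k + M * s) M" using k(2) assms(2)
    by (metis coprime_mod_left_iff less_numeral_extra(3))
  moreover have "coprime (k + M * s) p" using cM assms(4) by (meson coprime_divisors dvd_refl)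
  ultimately show "(case x of (k, s) \<Rightarrow> k + M * s) \<in> units_below (p * M)"
    using lt by (simp add: * units_below_def)
next
  fix y assume y: "y \<in> units_below (p * M)"
  hence "y < p * M" "coprime y M" by (auto simp: units_below_def)
  hence "(y mod M, y div M) \<in> units_below M \<times> {..<p}"
    using assms(2) mod_in_units_below[OF assms(2)] by (auto simp: less_mult_imp_div_less)
  moreover have "y = (case (y mod M, y div M) of (k, s) \<Rightarrow> k + M * s)" by simp
  ultimately show "\<exists>x\<in>units_below M \<times> {..<p}. y = (case x of (k, s) \<Rightarrow> k + M * s)" by blast
qed

lemma bij_betw_units_below_tame:
  assumes "M > 0" "prime p" "\<not> p dvd M"
  shows "bij_betw (\<lambda>k. (k mod p, k mod M)) (units_below (p * M)) ({1..<p} \<times> units_below M)"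
proof -
  have p0: "p > 0" using assms(2) by (simp add: prime_gt_0_nat)
  have cop: "coprime p M" using assms by (simp add: prime_imp_coprime)
  show ?thesis
  proof (rule bij_betwI')
    fix x y assume xy: "x \<in> units_below (p * M)" "y \<in> units_below (p * M)"
    show "((x mod p, x mod M) = (y mod p, y mod M)) = (x = y)"
    proof
      assume "(x mod p, x mod M) = (y mod p, y mod M)"
      hence "[x = y] (mod p * M)" using cop by (intro coprime_cong_mult_nat) (auto simp: cong_def)
      thus "x = y" using xy by (simp add: units_below_def cong_def)
    qed simp
  next
    fix x assume x: "x \<in> units_below (p * M)"
    hence "coprime x p" "coprime x M" by (auto simp: units_below_def)
    moreover from this have "\<not> p dvd x" using assms(2) by (meson coprime_common_divisor dvd_refl not_prime_unit)
    hence "x mod p > 0" by (simp add: dvd_eq_mod_eq_0)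
    ultimately show "(x mod p, x mod M) \<in> {1..<p} \<times> units_below M"
      using mod_in_units_below[OF assms(1)] p0 by auto
  next
    fix y assume y: "y \<in> {1..<p} \<times> units_below M"
    obtain r k where *: "y = (r, k)" by (cases y)
    have rk: "0 < r" "r < p" "k < M" "coprime k M" using y by (auto simp: * units_below_def)
    obtain z where z: "[z = r] (mod p)" "[z = k] (mod M)" using binary_chinese_remainder_nat[OF cop] by blast
    define x where "x = z mod (p * M)"
    have x: "x mod p = r" "x mod M = k" using z rk p0
      by (auto simp: x_def cong_def mod_mod_cancel)
    have "\<not> p dvd x" using x(1) rk(1) by (auto simp: dvd_eq_mod_eq_0)
    hence "coprime x p" using assms(2) by (metis coprime_commute prime_imp_coprime)
    moreover have "coprime x M" using x(2) rk(4) by (metis assms(1) coprime_mod_left_iff less_numeral_extra(3))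
    ultimately have "x \<in> units_below (p * M)" using p0 assms(1) by (simp add: units_below_def x_def)
    thus "\<exists>x\<in>units_below (p * M). y = (x mod p, x mod M)" using x * by auto
  qed
qed

lemma card_units_below_ramified:
  assumes "M > 0" "prime p" "p dvd M"
  shows "card (units_below (p * M)) = p * card (units_below M)"
  using bij_betw_same_card[OF bij_betw_units_below_ramified[OF prime_gt_0_nat[OF assms(2)] assms]]
  by (simp add: card_cartesian_product mult.commute)

lemma card_units_below_tame:
  assumes "M > 0" "prime p" "\<not> p dvd M"
  shows "card (units_below (p * M)) = (p - 1) * card (units_below M)"
  using bij_betw_same_card[OF bij_betw_units_below_tame[OF assms]]
  by (simp add: card_cartesian_product)

lemma card_units_below_pos: "N > 0 \<Longrightarrow> card (units_below N) > 0"
  using one_mod_in_units_below[of N] by (auto simp: card_gt_0_iff)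

text \<open>The exponents k + M s with k fixed act alike on Q(zeta_M) and multiply the j-th basis
  element by zeta_p^(j s); Parseval over s removes the cross terms.\<close>

lemma ramified_decomposition:
  assumes "M > 0" "prime p" "p dvd M"
  obtains g where "\<And>k. ipoly f (zeta (p * M) ^ k) = (\<Sum>j<p. zeta (p * M) ^ (j * k) * ipoly (g j) (zeta M ^ k))"
    "conj_sq_sum (p * M) f = real p * (\<Sum>j<p. conj_sq_sum M (g j))"
proof -
  have p0: "p > 0" using assms(2) by (simp add: prime_gt_0_nat)
  have eq: "zeta (p * M) ^ i = zeta (p * M) ^ (i mod p) * zeta M ^ (i div p)" for i
    by (simp add: p0 flip: zeta_mult_power[of p M] power_mult power_add)
  obtain g where g: "\<And>k. ipoly f (zeta (p * M) ^ k) = (\<Sum>j<p. zeta (p * M) ^ (j * k) * ipoly (g j) (zeta M ^ k))"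
    using ipoly_decompose[of "p * M" "zeta (p * M)" "\<lambda>i. i mod p" M "\<lambda>i. i div p" p f, OF eq] p0 by auto
  have zM: "zeta (p * M) ^ M = zeta p" using zeta_mult_power[OF assms(1), of p] by (simp add: mult.commute)
  have "conj_sq_sum (p * M) f = (\<Sum>(k, s)\<in>units_below M \<times> {..<p}. (cmod (ipoly f (zeta (p * M) ^ (k + M * s))))\<^sup>2)"
    unfolding conj_sq_sum_def
    using sum.reindex_bij_betw[OF bij_betw_units_below_ramified[OF p0 assms], symmetric, 
        of "\<lambda>k. (cmod (ipoly f (zeta (p * M) ^ k)))\<^sup>2"] by (simp add: case_prod_unfold)
  also have "\<dots> = (\<Sum>k\<in>units_below M. \<Sum>s<p. (cmod (ipoly f (zeta (p * M) ^ (k + M * s))))\<^sup>2)"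
    by (simp add: sum.cartesian_product)
  also have "\<dots> = (\<Sum>k\<in>units_below M. \<Sum>s<p. (cmod (\<Sum>j<p. zeta p ^ (j * s) * (zeta (p * M) ^ (j * k) * ipoly (g j) (zeta M ^ k))))\<^sup>2)"
  proof (intro sum.cong refl)
    fix k s
    have "zeta (p * M) ^ (j * (k + M * s)) = zeta p ^ (j * s) * zeta (p * M) ^ (j * k)" for j
    proof -
      have "zeta (p * M) ^ (j * (k + M * s)) = (zeta (p * M) ^ M) ^ (j * s) * zeta (p * M) ^ (j * k)"
        by (simp add: algebra_simps flip: power_mult power_add)
      thus ?thesis by (simp only: zM)
    qed
    moreover have "zeta M ^ (k + M * s) = zeta M ^ k"
      by (rule zeta_power_cong) (simp add: cong_def)
    ultimately show "(cmod (ipoly f (zeta (p * M) ^ (k + M * s))))\<^sup>2 =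
        (cmod (\<Sum>j<p. zeta p ^ (j * s) * (zeta (p * M) ^ (j * k) * ipoly (g j) (zeta M ^ k))))\<^sup>2"
      by (simp only: g mult.assoc)
  qed
  also have "\<dots> = (\<Sum>k\<in>units_below M. real p * (\<Sum>j<p. (cmod (ipoly (g j) (zeta M ^ k)))\<^sup>2))"
    by (simp add: parseval_zeta[OF p0] norm_mult norm_power)
  also have "\<dots> = real p * (\<Sum>j<p. conj_sq_sum M (g j))"
    unfolding conj_sq_sum_def by (subst sum.swap) (simp add: sum_distrib_left)
  finally show ?thesis using that g by blast
qed

lemma sum_pair_differences:
  fixes c :: "nat \<Rightarrow> complex"
  shows "(\<Sum>i<p. \<Sum>j<p. (cmod (c i - c j))\<^sup>2) = 2 * (real p * (\<Sum>j<p. (cmod (c j))\<^sup>2) - (cmod (\<Sum>j<p. c j))\<^sup>2)"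
proof -
  have "complex_of_real (\<Sum>i<p. \<Sum>j<p. (cmod (c i - c j))\<^sup>2) =
    (\<Sum>i<p. \<Sum>j<p. c i * cnj (c i) + c j * cnj (c j) - c i * cnj (c j) - c j * cnj (c i))"
    unfolding of_real_sum complex_norm_square by (intro sum.cong refl) (simp add: algebra_simps)
  also have "\<dots> = of_nat p * (\<Sum>i<p. c i * cnj (c i)) + of_nat p * (\<Sum>j<p. c j * cnj (c j))
       - (\<Sum>i<p. c i) * cnj (\<Sum>j<p. c j) - (\<Sum>i<p. \<Sum>j<p. c j * cnj (c i))"
    by (simp add: sum.distrib sum_subtractf sum_product flip: sum_distrib_left)
  also have "(\<Sum>i<p. \<Sum>j<p. c j * cnj (c i)) = (\<Sum>j<p. c j) * cnj (\<Sum>i<p. c i)"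
    by (simp add: sum_product) (rule sum.swap)
  also have "of_nat p * (\<Sum>i<p. c i * cnj (c i)) + of_nat p * (\<Sum>j<p. c j * cnj (c j))
       - (\<Sum>i<p. c i) * cnj (\<Sum>j<p. c j) - (\<Sum>j<p. c j) * cnj (\<Sum>i<p. c i) =
      complex_of_real (2 * (real p * (\<Sum>j<p. (cmod (c j))\<^sup>2) - (cmod (\<Sum>j<p. c j))\<^sup>2))"
    unfolding of_real_mult of_real_diff of_real_sum complex_norm_square by (simp add: algebra_simps)
  finally show ?thesis by (simp only: of_real_eq_iff)
qed

text \<open>Only the p - 1 nonzero residues modulo p occur, so Parseval is short of the term at 0,
  and p \<Sum>|c_j|^2 - |\<Sum>c_j|^2 remains. Its form as a sum over pairs is invariant under a
  common shift of the \<open>g j\<close>, as it must be: the p-th roots of unity sum to 0, so the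
  coefficients are determined only up to such a shift.\<close>

lemma tame_decomposition:
  assumes "M > 0" "prime p" "\<not> p dvd M"
  obtains g where "\<And>k. ipoly f (zeta (p * M) ^ k) = (\<Sum>j<p. zeta p ^ (j * k) * ipoly (g j) (zeta M ^ k))"
    "2 * conj_sq_sum (p * M) f = (\<Sum>i<p. \<Sum>j<p. conj_sq_sum M (g i - g j))"
proof -
  have p0: "p > 0" using assms(2) by (simp add: prime_gt_0_nat)
  have cop: "coprime p M" using assms by (simp add: prime_imp_coprime)
  \<comment> \<open>\<open>w\<close> and \<open>v\<close> are the idempotents of the Chinese
    remainder theorem; they factor \<open>zeta (p * M)\<close> into a power of \<open>zeta p\<close>
    and a power of \<open>zeta M\<close>.\<close>
  obtain w where w: "[w = 1] (mod p)" "[w = 0] (mod M)" using binary_chinese_remainder_nat[OF cop] by blast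
  obtain v where v: "[v = 0] (mod p)" "[v = 1] (mod M)" using binary_chinese_remainder_nat[OF cop] by blast
  obtain w' v' where w': "w = M * w'" and v': "v = p * v'" using w(2) v(1) by (auto simp: cong_0_iff elim!: dvdE)
  have "[w + v = 1 + 0] (mod p)" "[w + v = 0 + 1] (mod M)" using w v by (blast intro: cong_add)+
  hence wv: "[w + v = 1] (mod p * M)" using cop by (intro coprime_cong_mult_nat) auto
  have zM: "zeta (p * M) ^ M = zeta p" using zeta_mult_power[OF assms(1), of p] by (simp add: mult.commute)
  have zp: "zeta (p * M) ^ p = zeta M" using zeta_mult_power[OF p0] .
  have eq: "zeta (p * M) ^ i = zeta p ^ ((w' * i) mod p) * zeta M ^ (v' * i)" for i
  proof -
    have "zeta (p * M) ^ i = (zeta (p * M) ^ (w + v)) ^ i" using zeta_power_cong[OF wv] by simp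
    also have "\<dots> = (zeta (p * M) ^ M) ^ (w' * i) * (zeta (p * M) ^ p) ^ (v' * i)"
      by (simp add: w' v' algebra_simps flip: power_mult power_add)
    finally show ?thesis by (simp only: zM zp zeta_power_mod)
  qed
  obtain g where g: "\<And>k. ipoly f (zeta (p * M) ^ k) = (\<Sum>j<p. zeta p ^ (j * k) * ipoly (g j) (zeta M ^ k))"
    using ipoly_decompose[of "p * M" "zeta p" "\<lambda>i. (w' * i) mod p" M "\<lambda>i. v' * i" p f, OF eq] p0 by auto
  define F where "F = (\<lambda>(r, k). (cmod (\<Sum>j<p. zeta p ^ (j * r) * ipoly (g j) (zeta M ^ k)))\<^sup>2)"
  have "(cmod (ipoly f (zeta (p * M) ^ k)))\<^sup>2 = F (k mod p, k mod M)" for k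
  proof -
    have "zeta p ^ (j * k) = zeta p ^ (j * (k mod p))" for j
      by (rule zeta_power_cong) (simp add: cong_def mod_mult_right_eq)
    thus ?thesis by (simp add: g F_def zeta_power_mod)
  qed
  hence "conj_sq_sum (p * M) f = (\<Sum>k\<in>units_below (p * M). F (k mod p, k mod M))"
    by (simp add: conj_sq_sum_def)
  also have "\<dots> = (\<Sum>x\<in>{1..<p} \<times> units_below M. F x)"
    by (rule sum.reindex_bij_betw[OF bij_betw_units_below_tame[OF assms]])
  also have "\<dots> = (\<Sum>k\<in>units_below M. \<Sum>r\<in>{1..<p}. F (r, k))"
    by (subst sum.swap) (simp add: sum.cartesian_product)
  also have "\<dots> = (\<Sum>k\<in>units_below M. real p * (\<Sum>j<p. (cmod (ipoly (g j) (zeta M ^ k)))\<^sup>2) -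
      (cmod (\<Sum>j<p. ipoly (g j) (zeta M ^ k)))\<^sup>2)"
  proof (rule sum.cong[OF refl])
    fix k
    have "{..<p} = insert 0 {1..<p}" using p0 by auto
    hence "(\<Sum>r<p. F (r, k)) = F (0, k) + (\<Sum>r\<in>{1..<p}. F (r, k))" by simp
    moreover have "(\<Sum>r<p. F (r, k)) = real p * (\<Sum>j<p. (cmod (ipoly (g j) (zeta M ^ k)))\<^sup>2)"
      unfolding F_def prod.case by (rule parseval_zeta[OF p0])
    ultimately show "(\<Sum>r\<in>{1..<p}. F (r, k)) = real p * (\<Sum>j<p. (cmod (ipoly (g j) (zeta M ^ k)))\<^sup>2) -
      (cmod (\<Sum>j<p. ipoly (g j) (zeta M ^ k)))\<^sup>2" by (simp add: F_def)
  qed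
  finally have "2 * conj_sq_sum (p * M) f = (\<Sum>k\<in>units_below M. 
      2 * (real p * (\<Sum>j<p. (cmod (ipoly (g j) (zeta M ^ k)))\<^sup>2) - (cmod (\<Sum>j<p. ipoly (g j) (zeta M ^ k)))\<^sup>2))"
    by (simp add: sum_distrib_left)
  also have "\<dots> = (\<Sum>k\<in>units_below M. \<Sum>i<p. \<Sum>j<p. (cmod (ipoly (g i - g j) (zeta M ^ k)))\<^sup>2)"
    by (simp add: sum_pair_differences)
  also have "\<dots> = (\<Sum>i<p. \<Sum>j<p. conj_sq_sum M (g i - g j))"
    unfolding conj_sq_sum_def by (subst sum.swap, rule sum.cong[OF refl], subst sum.swap, rule refl)
  finally show ?thesis using that g by blast
qed

section \<open>The mean of a nonzero cyclotomic integer\<close>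

definition vanishing :: "nat \<Rightarrow> int poly \<Rightarrow> bool" where
  "vanishing N f \<longleftrightarrow> (\<forall>k\<in>units_below N. ipoly f (zeta N ^ k) = 0)"

lemma vanishingD:
  assumes "vanishing N f" "N > 0" "coprime k N"
  shows "ipoly f (zeta N ^ k) = 0"
  using assms mod_in_units_below[of N k] unfolding vanishing_def by (metis zeta_power_mod)

text \<open>For \<open>N > 0\<close> the converse is \<open>ipoly_zeta_conj\<close>, so
  \<open>vanishing\<close> just means that the encoded number is 0.\<close>

lemma vanishingD_zeta:
  assumes "vanishing N f" "N > 0"
  shows "ipoly f (zeta N) = 0"
  using vanishingD[OF assms, of 1] by simp

lemma conj_sq_sum_vanishing: "vanishing N f \<Longrightarrow> conj_sq_sum N f = 0"
  by (simp add: vanishing_def conj_sq_sum_def)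

lemma vanishing_diff_sym: "vanishing N (f - g) \<Longrightarrow> vanishing N (g - f)"
  unfolding vanishing_def ipoly_diff right_minus_eq by metis

lemma vanishing_diff_trans: "vanishing N (f - g) \<Longrightarrow> vanishing N (f - h) \<Longrightarrow> vanishing N (g - h)"
  unfolding vanishing_def ipoly_diff right_minus_eq by metis

lemma tame_coprime_sum_zero:
  assumes "prime p" "coprime k (p * M)"
  shows "(\<Sum>j<p. zeta p ^ (j * k)) = 0"
proof -
  have "\<not> p dvd k" using assms by (meson coprime_common_divisor coprime_mult_right_iff dvd_refl not_prime_unit)
  thus ?thesis using geometric_sum_zeta[of p k] prime_gt_0_nat[OF assms(1)] by (simp add: mult.commute)
qed

text \<open>In place of the norm and the inequality of means, a prime is split off. In the ramified
  case one nonzero coefficient is enough. In the tame case the coefficients are not all equal: if a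
  of them agree with \<open>g 0\<close> and b do not, then a + b = p with a, b \<ge> 1, so at least
  a b \<ge> p - 1 unordered pairs have nonzero difference, each counted twice.\<close>

theorem conj_sq_sum_ge:
  assumes "N > 0" "\<not> vanishing N f"
  shows "conj_sq_sum N f \<ge> card (units_below N)"
  using assms
proof (induction N arbitrary: f rule: less_induct)
  case (less N)
  show ?case
  proof (cases "N = 1")
    case True
    have "ipoly f 1 \<noteq> 0" using less.prems True by (simp add: vanishing_def)
    moreover have "ipoly f 1 = of_int (poly f 1)" by (induction f) auto
    ultimately have "\<bar>poly f 1\<bar> \<ge> 1" "cmod (ipoly f 1) = real_of_int \<bar>poly f 1\<bar>" by auto
    hence "cmod (ipoly f 1) \<ge> 1" by linarith
    thus ?thesis using True by (simp add: conj_sq_sum_def)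
  next
    case False
    then obtain p where p: "prime p" "p dvd N" using prime_factor_nat by blast
    then obtain M where N: "N = p * M" by (elim dvdE)
    have M: "M > 0" "M < N" using N less.prems prime_gt_1_nat[OF p(1)] by (auto intro: Nat.gr0I)
    show ?thesis
    proof (cases "p dvd M")
      case True
      obtain g where g: "\<And>k. ipoly f (zeta (p * M) ^ k) = (\<Sum>j<p. zeta (p * M) ^ (j * k) * ipoly (g j) (zeta M ^ k))"
        "conj_sq_sum (p * M) f = real p * (\<Sum>j<p. conj_sq_sum M (g j))"
        using ramified_decomposition[OF M(1) p(1) True] by blast
      have "\<exists>j<p. \<not> vanishing M (g j)"
      proof (rule ccontr)
        assume *: "\<not> ?thesis"
        have "vanishing N f" unfolding vanishing_def
        proof
          fix k assume "k \<in> units_below N"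
          hence "coprime k M" by (simp add: units_below_def N)
          hence "ipoly (g j) (zeta M ^ k) = 0" if "j < p" for j
            using * that M(1) vanishingD by blast
          thus "ipoly f (zeta N ^ k) = 0" by (simp add: N g(1))
        qed
        thus False using less.prems by blast
      qed
      then obtain j where j: "j < p" "\<not> vanishing M (g j)" by blast
      have "card (units_below M) \<le> conj_sq_sum M (g j)" using less.IH[OF M(2,1) j(2)] .
      also have "\<dots> \<le> (\<Sum>j<p. conj_sq_sum M (g j))"
        by (rule member_le_sum) (use j conj_sq_sum_nonneg in auto)
      finally have "real p * card (units_below M) \<le> real p * (\<Sum>j<p. conj_sq_sum M (g j))"
        by (intro mult_left_mono) auto
      thus ?thesis using g(2) card_units_below_ramified[OF M(1) p(1) True] by (simp add: N)
    next
      case False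
      obtain g where g: "\<And>k. ipoly f (zeta (p * M) ^ k) = (\<Sum>j<p. zeta p ^ (j * k) * ipoly (g j) (zeta M ^ k))"
        "2 * conj_sq_sum (p * M) f = (\<Sum>i<p. \<Sum>j<p. conj_sq_sum M (g i - g j))"
        using tame_decomposition[OF M(1) p(1) False] by blast
      define t where "t = real (card (units_below M))"
      define A where "A = {j. j < p \<and> vanishing M (g j - g 0)}"
      have A1: "A \<subseteq> {..<p}" "0 \<in> A" using prime_gt_0_nat[OF p(1)]
        by (auto simp: A_def vanishing_def)
      have A: "A \<subseteq> {..<p}" "finite A" "0 \<in> A"
        using A1 finite_subset[OF A1(1)] by simp_all
      have "A \<noteq> {..<p}"
      proof
        assume A_eq: "A = {..<p}"
        have *: "vanishing M (g j - g 0)" if "j < p" for j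
        proof -
          have "j \<in> A" unfolding A_eq using that by simp
          thus ?thesis by (simp add: A_def)
        qed
        have "vanishing N f" unfolding vanishing_def
        proof
          fix k assume k: "k \<in> units_below N"
          hence k': "coprime k M" by (simp add: units_below_def N)
          have eq0: "ipoly (g j) (zeta M ^ k) = ipoly (g 0) (zeta M ^ k)" if "j < p" for j
            using vanishingD[OF *[OF that] M(1) k'] by simp
          have "(\<Sum>j<p. zeta p ^ (j * k) * ipoly (g j) (zeta M ^ k)) =
              (\<Sum>j<p. zeta p ^ (j * k) * ipoly (g 0) (zeta M ^ k))"
            by (intro sum.cong refl arg_cong2[of _ _ _ _ "(*)"] eq0) simp
          hence "ipoly f (zeta N ^ k) = (\<Sum>j<p. zeta p ^ (j * k)) * ipoly (g 0) (zeta M ^ k)"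
            by (simp only: N g(1) sum_distrib_right)
          also have "(\<Sum>j<p. zeta p ^ (j * k)) = 0"
            by (rule tame_coprime_sum_zero[OF p(1)]) (use k in \<open>auto simp: N units_below_def\<close>)
          finally show "ipoly f (zeta N ^ k) = 0" by simp
        qed
        thus False using less.prems by blast
      qed
      define B where "B = {..<p} - A"
      have B: "finite B" "A \<inter> B = {}" "A \<union> B = {..<p}" using A by (auto simp: B_def)
      have ge: "conj_sq_sum M (g i - g j) \<ge> t" if "i \<in> A \<and> j \<in> B \<or> i \<in> B \<and> j \<in> A" for i j
      proof -
        have "\<not> vanishing M (g i - g j)"
          using that vanishing_diff_trans[of M "g i" "g j" "g 0"] vanishing_diff_trans[of M "g j" "g i" "g 0"]
            vanishing_diff_sym[of M "g i" "g j"]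
          by (auto simp: A_def B_def)
        thus ?thesis using less.IH[OF M(2,1)] by (simp add: t_def)
      qed
      have cardAB: "card A + card B = p"
        using card_Un_disjoint[OF A(2) B(1,2)] B(3) by simp
      have "card A \<ge> 1" using A by (simp add: Suc_le_eq card_gt_0_iff) blast
      moreover have "card B \<ge> 1"
      proof -
        have "B \<noteq> {}" using A(1) \<open>A \<noteq> {..<p}\<close> by (auto simp: B_def)
        thus ?thesis using B(1) by (simp add: Suc_le_eq card_gt_0_iff)
      qed
      ultimately have "card A * card B \<ge> p - 1"
      proof -
        obtain a b where "card A = Suc a" "card B = Suc b"
          using \<open>card A \<ge> 1\<close> \<open>card B \<ge> 1\<close> by (cases "card A"; cases "card B") auto
        thus ?thesis using cardAB by simp
      qed
      hence "2 * real (p - 1) * t \<le> 2 * real (card A * card B) * t"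
        by (intro mult_right_mono mult_left_mono) (auto simp: t_def simp flip: of_nat_mult)
      also have "\<dots> = (\<Sum>i\<in>A. \<Sum>j\<in>B. t) + (\<Sum>i\<in>B. \<Sum>j\<in>A. t)" by (simp add: mult_ac)
      also have "\<dots> \<le> (\<Sum>i\<in>A. \<Sum>j\<in>B. conj_sq_sum M (g i - g j)) + (\<Sum>i\<in>B. \<Sum>j\<in>A. conj_sq_sum M (g i - g j))"
        by (intro add_mono sum_mono ge) auto
      also have "\<dots> \<le> (\<Sum>i\<in>A. \<Sum>j<p. conj_sq_sum M (g i - g j)) + (\<Sum>i\<in>B. \<Sum>j<p. conj_sq_sum M (g i - g j))"
        by (intro add_mono sum_mono sum_mono2) (use A B conj_sq_sum_nonneg in auto)
      also have "\<dots> = (\<Sum>i<p. \<Sum>j<p. conj_sq_sum M (g i - g j))"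
        unfolding B(3)[symmetric] using A(2) B(1,2) by (simp add: sum.union_disjoint)
      finally show ?thesis using g(2) card_units_below_tame[OF M(1) p(1) False] by (simp add: N t_def)
    qed
  qed
qed

subsection \<open>Sums of boundedly many roots of unity\<close>

definition root_sums :: "nat \<Rightarrow> complex set" where
  "root_sums L = {sum_list xs | xs. set xs \<subseteq> roots_of_unity \<and> length xs \<le> L}"

lemma root_sums_mono: "L \<le> L' \<Longrightarrow> root_sums L \<subseteq> root_sums L'"
  by (auto simp: root_sums_def)

lemma zero_in_root_sums [simp]: "0 \<in> root_sums L"
  by (auto simp: root_sums_def intro!: exI[of _ "[]"])

lemma root_sums_add:
  assumes "x \<in> root_sums L" "y \<in> root_sums L'"
  shows "x + y \<in> root_sums (L + L')"
proof -
  obtain xs ys where "set xs \<subseteq> roots_of_unity" "length xs \<le> L" "x = sum_list xs"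
    "set ys \<subseteq> roots_of_unity" "length ys \<le> L'" "y = sum_list ys"
    using assms by (auto simp: root_sums_def)
  thus ?thesis unfolding root_sums_def by (auto intro!: exI[of _ "xs @ ys"])
qed

lemma roots_of_unity_mult: "x \<in> roots_of_unity \<Longrightarrow> y \<in> roots_of_unity \<Longrightarrow> x * y \<in> roots_of_unity"
proof -
  assume "x \<in> roots_of_unity" "y \<in> roots_of_unity"
  then obtain m n where "m > 0" "n > 0" "x ^ m = 1" "y ^ n = 1" by (auto simp: roots_of_unity_def)
  hence "(x * y) ^ (m * n) = 1"
    by (metis mult.commute mult_1 power_mult power_mult_distrib power_one)
  thus ?thesis using \<open>m > 0\<close> \<open>n > 0\<close> by (auto simp: roots_of_unity_def intro!: exI[of _ "m * n"])
qed

lemma zeta_power_in_roots_of_unity: "N > 0 \<Longrightarrow> zeta N ^ k \<in> roots_of_unity"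
  unfolding roots_of_unity_def
  by (intro CollectI exI[of _ N]) (metis mult.commute power_mult power_one zeta_power_N)

lemma root_sums_mult:
  assumes "w \<in> roots_of_unity" "x \<in> root_sums L"
  shows "w * x \<in> root_sums L"
proof -
  obtain xs where "set xs \<subseteq> roots_of_unity" "length xs \<le> L" "x = sum_list xs"
    using assms by (auto simp: root_sums_def)
  thus ?thesis unfolding root_sums_def
    using assms(1) by (auto intro!: exI[of _ "map ((*) w) xs"] roots_of_unity_mult simp: sum_list_const_mult)
qed

lemma root_sums_sum:
  assumes "finite A" "\<And>j. j \<in> A \<Longrightarrow> f j \<in> root_sums L"
  shows "sum f A \<in> root_sums (card A * L)"
  using assms by (induction A rule: finite_induct) (auto simp: root_sums_add)

lemma of_int_in_root_sums: "of_int c \<in> root_sums (nat \<bar>c\<bar>)"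
proof -
  have "(- 1 :: complex) \<in> roots_of_unity" "(1 :: complex) \<in> roots_of_unity"
    by (auto simp: roots_of_unity_def intro!: exI[of _ 2])
  hence "of_int c = sum_list (replicate (nat \<bar>c\<bar>) (of_int (sgn c) :: complex)) \<and> 
      set (replicate (nat \<bar>c\<bar>) (of_int (sgn c) :: complex)) \<subseteq> roots_of_unity"
    by (cases c "0 :: int" rule: linorder_cases) (auto simp: sum_list_replicate)
  thus ?thesis unfolding root_sums_def by force
qed

text \<open>The bound \<open>L\<close> depends on \<open>N\<close>, which is harmless for the
  finitely many conductors left over by the descent. All \<open>p\<close> coefficients may be used,
  so no gain in the mean is required.\<close>

lemma root_sums_fixed_conductor:
  assumes "N > 0"
  shows "\<exists>L. \<forall>f. conj_sq_sum N f \<le> C \<longrightarrow> ipoly f (zeta N) \<in> root_sums L"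
  using assms
proof (induction N arbitrary: C rule: less_induct)
  case (less N)
  show ?case
  proof (cases "N = 1")
    case True
    have "ipoly f (zeta N) \<in> root_sums (nat \<lceil>C\<rceil>)" if "conj_sq_sum N f \<le> C" for f
    proof -
      have eq: "ipoly f 1 = of_int (poly f 1)" by (induction f) auto
      have "real_of_int \<bar>poly f 1\<bar> \<le> (real_of_int (poly f 1))\<^sup>2"
      proof -
        have "\<bar>poly f 1\<bar> \<le> (poly f 1)\<^sup>2" by (metis abs_ge_zero abs_le_square_iff abs_abs int_one_le_iff_zero_less 
            power2_abs power2_eq_square mult_right_mono mult_1 zero_less_abs_iff abs_zero le_less mult_zero_left)
        thus ?thesis by (metis of_int_le_iff of_int_power)
      qed
      also have "\<dots> \<le> C" using that by (simp add: conj_sq_sum_def True eq)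
      finally have "nat \<bar>poly f 1\<bar> \<le> nat \<lceil>C\<rceil>" by linarith
      thus ?thesis using of_int_in_root_sums[of "poly f 1"] root_sums_mono by (auto simp: True eq)
    qed
    thus ?thesis by blast
  next
    case False
    then obtain p where p: "prime p" "p dvd N" using prime_factor_nat by blast
    then obtain M where N: "N = p * M" by (elim dvdE)
    have p0: "p > 0" using p by (simp add: prime_gt_0_nat)
    have M: "M > 0" "M < N" using N less.prems prime_gt_1_nat[OF p(1)] by (auto intro: Nat.gr0I)
    \<comment> \<open>The factor 2 is that of the tame decomposition, where a single difference is
      bounded only by twice the whole sum.\<close>
    obtain L where L: "\<And>f. conj_sq_sum M f \<le> 2 * C \<Longrightarrow> ipoly f (zeta M) \<in> root_sums L"
      using less.IH[OF M(2,1), of "2 * C"] by blast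
    have "ipoly f (zeta N) \<in> root_sums (p * L)" if C: "conj_sq_sum N f \<le> C" for f
    proof (cases "p dvd M")
      case True
      obtain g where g: "\<And>k. ipoly f (zeta (p * M) ^ k) = (\<Sum>j<p. zeta (p * M) ^ (j * k) * ipoly (g j) (zeta M ^ k))"
        "conj_sq_sum (p * M) f = real p * (\<Sum>j<p. conj_sq_sum M (g j))"
        using ramified_decomposition[OF M(1) p(1) True] by blast
      have gL: "ipoly (g j) (zeta M) \<in> root_sums L" if "j < p" for j
      proof (rule L)
        have "conj_sq_sum M (g j) \<le> (\<Sum>j<p. conj_sq_sum M (g j))"
          by (rule member_le_sum) (use that conj_sq_sum_nonneg in auto)
        also have "\<dots> \<le> real p * (\<Sum>j<p. conj_sq_sum M (g j))"
          using mult_right_mono[of 1 "real p" "\<Sum>j<p. conj_sq_sum M (g j)"] p0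
          by (simp add: sum_nonneg conj_sq_sum_nonneg)
        also have "\<dots> \<le> C" using C g(2) by (simp add: N)
        finally show "conj_sq_sum M (g j) \<le> 2 * C" using conj_sq_sum_nonneg[of M "g j"] by linarith
      qed
      have "(\<Sum>j<p. zeta (p * M) ^ j * ipoly (g j) (zeta M)) \<in> root_sums (card {..<p} * L)"
        using p0 M by (intro root_sums_sum root_sums_mult zeta_power_in_roots_of_unity gL) auto
      thus ?thesis using g(1)[of 1] by (simp add: N)
    next
      case False
      obtain g where g: "\<And>k. ipoly f (zeta (p * M) ^ k) = (\<Sum>j<p. zeta p ^ (j * k) * ipoly (g j) (zeta M ^ k))"
        "2 * conj_sq_sum (p * M) f = (\<Sum>i<p. \<Sum>j<p. conj_sq_sum M (g i - g j))"
        using tame_decomposition[OF M(1) p(1) False] by blast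
      have gL: "ipoly (g j - g 0) (zeta M) \<in> root_sums L" if "j < p" for j
      proof (rule L)
        have "conj_sq_sum M (g j - g 0) \<le> (\<Sum>i<p. conj_sq_sum M (g j - g i))"
          by (rule member_le_sum) (use p0 conj_sq_sum_nonneg in auto)
        also have "\<dots> \<le> (\<Sum>j<p. \<Sum>i<p. conj_sq_sum M (g j - g i))"
          by (rule member_le_sum) (use that conj_sq_sum_nonneg in \<open>auto intro: sum_nonneg\<close>)
        also have "\<dots> \<le> 2 * C" using C g(2) by (simp add: N)
        finally show "conj_sq_sum M (g j - g 0) \<le> 2 * C" .
      qed
      have "(\<Sum>j<p. zeta p ^ j) = 0"
        using tame_coprime_sum_zero[OF p(1), of 1 M] by simp
      hence "(\<Sum>j<p. zeta p ^ j * ipoly (g j) (zeta M)) = (\<Sum>j<p. zeta p ^ j * ipoly (g j - g 0) (zeta M))"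
        by (simp add: right_diff_distrib sum_subtractf flip: sum_distrib_right)
      also have "\<dots> \<in> root_sums (card {..<p} * L)"
        using p0 by (intro root_sums_sum root_sums_mult zeta_power_in_roots_of_unity gL) auto
      finally show ?thesis using g(1)[of 1] by (simp add: N)
    qed
    thus ?thesis by blast
  qed
qed

text \<open>Here \<open>m\<close> bounds twice the mean. Since the p-th roots of unity sum to 0, one
  coefficient may be subtracted from all; a well chosen one leaves at most \<open>m\<close> nonzero.
  When several remain, each of the others uses up at least 1 of the mean, and
  \<open>p > 2 * m\<close> keeps the loss from the tame relation below this gain.\<close>

lemma large_tame_prime_step:
  assumes M: "M > 0" and p: "prime p" "\<not> p dvd M" "p > 2 * m" and "m > 0"
    and le: "conj_sq_sum (p * M) f \<le> real m / 2 * card (units_below (p * M))"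
  shows "\<exists>J c. J \<subseteq> {..<p} \<and> card J \<le> m \<and>
    ipoly f (zeta (p * M)) = (\<Sum>j\<in>J. zeta p ^ j * ipoly (c j) (zeta M)) \<and>
    (\<forall>j\<in>J. card J \<ge> 2 \<longrightarrow> conj_sq_sum M (c j) \<le> (real m - 1) / 2 * card (units_below M)) \<and>
    (\<forall>j\<in>J. card J = 1 \<longrightarrow> conj_sq_sum M (c j) \<le> real m / 2 * card (units_below M))"
proof -
  have p0: "p > 0" using p by (simp add: prime_gt_0_nat)
  define t where "t = real (card (units_below M))"
  have t0: "t > 0" using card_units_below_pos[OF M] by (simp add: t_def)
  obtain g where g: "\<And>k. ipoly f (zeta (p * M) ^ k) = (\<Sum>j<p. zeta p ^ (j * k) * ipoly (g j) (zeta M ^ k))"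
    "2 * conj_sq_sum (p * M) f = (\<Sum>i<p. \<Sum>j<p. conj_sq_sum M (g i - g j))"
    using tame_decomposition[OF M p(1,2)] by blast
  have le': "2 * conj_sq_sum (p * M) f \<le> real m * real (p - 1) * t"
    using le card_units_below_tame[OF M p(1,2)] by (simp add: t_def)
  define V where "V i = {j. j < p \<and> \<not> vanishing M (g j - g i)}" for i
  have Vp: "V i \<subseteq> {..<p}" for i by (auto simp: V_def)
  have V: "finite (V i)" "V i \<subseteq> {..<p}" for i
    using Vp[of i] finite_subset[OF Vp] by simp_all
  have cardV: "t * card (V i) \<le> (\<Sum>j<p. conj_sq_sum M (g i - g j))" for i
  proof -
    have "t * card (V i) = (\<Sum>j\<in>V i. t)" by simp
    also have "\<dots> \<le> (\<Sum>j\<in>V i. conj_sq_sum M (g i - g j))"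
    proof (rule sum_mono)
      fix j assume "j \<in> V i"
      hence "\<not> vanishing M (g i - g j)" using vanishing_diff_sym by (auto simp: V_def)
      thus "t \<le> conj_sq_sum M (g i - g j)" using conj_sq_sum_ge[OF M] by (simp add: t_def)
    qed
    also have "\<dots> \<le> (\<Sum>j<p. conj_sq_sum M (g i - g j))"
      by (rule sum_mono2) (use V conj_sq_sum_nonneg in auto)
    finally show ?thesis .
  qed
  \<comment> \<open>By averaging: the numbers of coefficients differing from \<open>g i\<close> add
    up to at most m (p - 1) < m p over all \<open>i\<close>.\<close>
  have "\<exists>i<p. card (V i) \<le> m"
  proof (rule ccontr)
    assume *: "\<not> ?thesis"
    have "real m * real p * t \<le> (\<Sum>i<p. t * card (V i))"
    proof -
      have "real m * real p * t = (\<Sum>i<p. t * m)" by simp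
      also have "\<dots> \<le> (\<Sum>i<p. t * card (V i))"
        by (intro sum_mono mult_left_mono) (use * t0 in \<open>auto simp: not_le less_imp_le\<close>)
      finally show ?thesis .
    qed
    also have "\<dots> \<le> 2 * conj_sq_sum (p * M) f" unfolding g(2) by (intro sum_mono cardV)
    also note le'
    finally have "real m * t * real p \<le> real m * t * real (p - 1)" by (simp add: mult_ac)
    hence "real p \<le> real (p - 1)" using \<open>m > 0\<close> t0 by simp
    thus False using p0 by simp
  qed
  then obtain i where i: "i < p" "card (V i) \<le> m" by blast
  define J where "J = V i"
  define c where "c j = g j - g i" for j
  define x where "x = real (card J)"
  have J: "finite J" "J \<subseteq> {..<p}" "card J \<le> m" using V i by (auto simp: J_def)
  have van: "vanishing M (c j)" if "j < p" "j \<notin> J" for j using that by (auto simp: J_def V_def c_def)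
  have nvan: "\<not> vanishing M (c j)" if "j \<in> J" for j using that by (auto simp: J_def V_def c_def)
  have val: "ipoly f (zeta (p * M)) = (\<Sum>j\<in>J. zeta p ^ j * ipoly (c j) (zeta M))"
  proof -
    have "(\<Sum>j<p. zeta p ^ j) = 0"
      using tame_coprime_sum_zero[OF p(1), of 1 M] by simp
    hence "(\<Sum>j<p. zeta p ^ j * ipoly (g j) (zeta M)) = (\<Sum>j<p. zeta p ^ j * ipoly (c j) (zeta M))"
      by (simp add: c_def right_diff_distrib sum_subtractf flip: sum_distrib_right)
    also have "\<dots> = (\<Sum>j\<in>J. zeta p ^ j * ipoly (c j) (zeta M))"
      by (rule sum.mono_neutral_right) (use J van vanishingD_zeta M in auto)
    finally show ?thesis using g(1)[of 1] by simp
  qed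
  define S where "S = (\<Sum>j\<in>J. conj_sq_sum M (c j))"
  define B where "B = {..<p} - J"
  have B: "finite B" "J \<inter> B = {}" "J \<union> B = {..<p}" using J by (auto simp: B_def)
  have cardB: "real (card B) = real p - x"
    using card_Un_disjoint[OF J(1) B(1,2)] B(3) by (simp add: x_def)
  have diff_c: "c j - c b = g j - g b" for j b by (simp add: c_def)
  have cross: "conj_sq_sum M (g j - g b) = conj_sq_sum M (c j)" "conj_sq_sum M (g b - g j) = conj_sq_sum M (c j)"
    if "b \<in> B" for j b
  proof -
    have *: "vanishing M (c b)" using van that by (auto simp: B_def)
    show "conj_sq_sum M (g j - g b) = conj_sq_sum M (c j)" "conj_sq_sum M (g b - g j) = conj_sq_sum M (c j)"
      using * unfolding diff_c[symmetric] by (auto simp: vanishing_def conj_sq_sum_def intro!: sum.cong)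
  qed
  \<comment> \<open>Only pairs with exactly one index in \<open>J\<close> are kept, in both orders;
    there the difference is \<open>c j\<close>, as the other coefficient vanishes.\<close>
  have "2 * ((real p - x) * S) = (\<Sum>j\<in>J. \<Sum>b\<in>B. conj_sq_sum M (c j)) + (\<Sum>b\<in>B. \<Sum>j\<in>J. conj_sq_sum M (c j))"
    by (simp add: cardB S_def sum_distrib_left)
  also have "\<dots> = (\<Sum>j\<in>J. \<Sum>b\<in>B. conj_sq_sum M (g j - g b)) + (\<Sum>b\<in>B. \<Sum>j\<in>J. conj_sq_sum M (g b - g j))"
    by (simp add: cross)
  also have "\<dots> \<le> (\<Sum>j\<in>J. \<Sum>b<p. conj_sq_sum M (g j - g b)) + (\<Sum>b\<in>B. \<Sum>j<p. conj_sq_sum M (g b - g j))"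
    by (intro add_mono sum_mono sum_mono2) (use J B conj_sq_sum_nonneg in auto)
  also have "\<dots> = (\<Sum>i<p. \<Sum>j<p. conj_sq_sum M (g i - g j))"
    unfolding B(3)[symmetric] using J(1) B(1,2) by (simp add: sum.union_disjoint)
  also have "\<dots> \<le> real m * real (p - 1) * t" using le' g(2) by simp
  finally have main: "2 * ((real p - x) * S) \<le> real m * (real p - 1) * t" using p0 by (simp add: of_nat_diff)
  have px: "real p - x \<ge> m" "real p - x > 0" using J(3) p(3) by (auto simp: x_def)
  show ?thesis
  proof (intro exI[of _ J] exI[of _ c] conjI ballI impI)
    show "J \<subseteq> {..<p}" "card J \<le> m"
      "ipoly f (zeta (p * M)) = (\<Sum>j\<in>J. zeta p ^ j * ipoly (c j) (zeta M))"
      by fact+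
  next
    fix j assume j: "j \<in> J" and J2: "card J \<ge> 2"
    have x2: "x \<ge> 2" using J2 by (simp add: x_def)
    have "S = conj_sq_sum M (c j) + (\<Sum>i\<in>J - {j}. conj_sq_sum M (c i))"
      unfolding S_def using J(1) j by (rule sum.remove)
    moreover have "(\<Sum>i\<in>J - {j}. t) \<le> (\<Sum>i\<in>J - {j}. conj_sq_sum M (c i))"
      using conj_sq_sum_ge[OF M nvan] by (intro sum_mono) (auto simp: t_def)
    moreover have "(\<Sum>i\<in>J - {j}. t) = (x - 1) * t" using j J(1) J2 by (simp add: x_def of_nat_diff)
    ultimately have S: "conj_sq_sum M (c j) \<le> S - (x - 1) * t" by linarith
    \<comment> \<open>From m (p - 1) = (p - x) m + m (x - 1) and m \<le> p - x follows 2 S \<le> (m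
      + x - 1) t. The other x - 1 coefficients take at least (x - 1) t out of S, so twice the
      remaining one is at most (m - (x - 1)) t, and x \<ge> 2.\<close>
    have "real m * (real p - 1) * t = (real p - x) * (real m * t) + real m * ((x - 1) * t)" by (simp add: algebra_simps)
    also have "\<dots> \<le> (real p - x) * (real m * t) + (real p - x) * ((x - 1) * t)"
      using px x2 t0 by (intro add_left_mono mult_right_mono) auto
    finally have "(real p - x) * (2 * S) \<le> (real p - x) * (real m * t + (x - 1) * t)"
      using main by (simp add: algebra_simps)
    hence "2 * S \<le> real m * t + (x - 1) * t" using px(2) by simp
    hence "2 * conj_sq_sum M (c j) \<le> real m * t - (x - 1) * t" using S by linarith
    also have "\<dots> \<le> real m * t - 1 * t" using x2 t0 by (intro diff_left_mono mult_right_mono) auto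
    finally show "conj_sq_sum M (c j) \<le> (real m - 1) / 2 * card (units_below M)"
      by (simp add: t_def algebra_simps)
  next
    fix j assume j: "j \<in> J" and J1: "card J = 1"
    have "J = {j}" using j J1 by (metis card_1_singletonE singletonD)
    hence "x = 1" "S = conj_sq_sum M (c j)" by (auto simp: x_def S_def)
    hence "(real p - 1) * (2 * conj_sq_sum M (c j)) \<le> (real p - 1) * (real m * t)" using main by (simp add: mult_ac)
    hence "2 * conj_sq_sum M (c j) \<le> real m * t" using px(2) \<open>x = 1\<close> by simp
    thus "conj_sq_sum M (c j) \<le> real m / 2 * card (units_below M)" by (simp add: t_def)
  qed
qed

text \<open>By Parseval the means of the coefficients add up to at most m / 2, and each nonzero one
  takes at least 1. This is stronger than what is claimed; the conclusion has the shape of the tame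
  one so that both enter the descent in the same way.\<close>

lemma ramified_prime_step:
  assumes M: "M > 0" and p: "prime p" "p dvd M" and "m > 0"
    and le: "conj_sq_sum (p * M) f \<le> real m / 2 * card (units_below (p * M))"
  shows "\<exists>J c. J \<subseteq> {..<p} \<and> card J \<le> m \<and>
    ipoly f (zeta (p * M)) = (\<Sum>j\<in>J. zeta (p * M) ^ j * ipoly (c j) (zeta M)) \<and>
    (\<forall>j\<in>J. card J \<ge> 2 \<longrightarrow> conj_sq_sum M (c j) \<le> (real m - 1) / 2 * card (units_below M)) \<and>
    (\<forall>j\<in>J. card J = 1 \<longrightarrow> conj_sq_sum M (c j) \<le> real m / 2 * card (units_below M))"
proof -
  have p0: "p > 0" using p by (simp add: prime_gt_0_nat)
  define t where "t = real (card (units_below M))"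
  have t0: "t > 0" using card_units_below_pos[OF M] by (simp add: t_def)
  obtain g where g: "\<And>k. ipoly f (zeta (p * M) ^ k) = (\<Sum>j<p. zeta (p * M) ^ (j * k) * ipoly (g j) (zeta M ^ k))"
    "conj_sq_sum (p * M) f = real p * (\<Sum>j<p. conj_sq_sum M (g j))"
    using ramified_decomposition[OF M p(1,2)] by blast
  define J where "J = {j. j < p \<and> \<not> vanishing M (g j)}"
  have Jp: "J \<subseteq> {..<p}" by (auto simp: J_def)
  have J: "finite J" "J \<subseteq> {..<p}" using Jp finite_subset[OF Jp] by simp_all
  have nvan: "\<not> vanishing M (g j)" if "j \<in> J" for j using that by (auto simp: J_def)
  have val: "ipoly f (zeta (p * M)) = (\<Sum>j\<in>J. zeta (p * M) ^ j * ipoly (g j) (zeta M))"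
  proof -
    have "(\<Sum>j<p. zeta (p * M) ^ j * ipoly (g j) (zeta M)) = (\<Sum>j\<in>J. zeta (p * M) ^ j * ipoly (g j) (zeta M))"
      by (rule sum.mono_neutral_right) (use J vanishingD_zeta M in \<open>auto simp: J_def\<close>)
    thus ?thesis using g(1)[of 1] by simp
  qed
  define S where "S = (\<Sum>j\<in>J. conj_sq_sum M (g j))"
  have "S = (\<Sum>j<p. conj_sq_sum M (g j))" unfolding S_def
    by (rule sum.mono_neutral_left) (use J conj_sq_sum_vanishing in \<open>auto simp: J_def\<close>)
  hence "real p * S \<le> real p * (real m / 2 * t)"
    using le g(2) card_units_below_ramified[OF M p(1,2)] by (simp add: t_def mult_ac)
  hence S: "S \<le> real m / 2 * t" using p0 by simp
  have ge: "conj_sq_sum M (g j) \<ge> t" if "j \<in> J" for j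
    using conj_sq_sum_ge[OF M nvan[OF that]] by (simp add: t_def)
  have mt: "real m / 2 * t \<le> real m * t" using t0 by (intro mult_right_mono) auto
  have "real (card J) * t = (\<Sum>j\<in>J. t)" by simp
  also have "\<dots> \<le> S" unfolding S_def by (intro sum_mono ge)
  also have "\<dots> \<le> real m * t" using S mt by linarith
  finally have cardJ: "card J \<le> m" using t0 by simp
  have rem: "S = conj_sq_sum M (g j) + (\<Sum>i\<in>J - {j}. conj_sq_sum M (g i))" if "j \<in> J" for j
    unfolding S_def using J(1) that by (rule sum.remove)
  show ?thesis
  proof (intro exI[of _ J] exI[of _ g] conjI ballI impI)
    show "J \<subseteq> {..<p}" "card J \<le> m"
      "ipoly f (zeta (p * M)) = (\<Sum>j\<in>J. zeta (p * M) ^ j * ipoly (g j) (zeta M))"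
      by fact+
  next
    fix j assume j: "j \<in> J" and J2: "card J \<ge> 2"
    have "t \<le> (real (card J) - 1) * t" using J2 t0 by simp
    also have "\<dots> = (\<Sum>i\<in>J - {j}. t)" using j J(1) J2 by (simp add: of_nat_diff)
    also have "\<dots> \<le> (\<Sum>i\<in>J - {j}. conj_sq_sum M (g i))" by (intro sum_mono ge) auto
    finally have "conj_sq_sum M (g j) \<le> real m / 2 * t - t" using rem[OF j] S by linarith
    also have "\<dots> \<le> (real m - 1) / 2 * t" using t0 by (simp add: field_simps)
    finally show "conj_sq_sum M (g j) \<le> (real m - 1) / 2 * card (units_below M)" by (simp add: t_def)
  next
    fix j assume j: "j \<in> J" and J1: "card J = 1"
    have "(\<Sum>i\<in>J - {j}. conj_sq_sum M (g i)) \<ge> 0" by (intro sum_nonneg conj_sq_sum_nonneg)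
    hence "conj_sq_sum M (g j) \<le> real m / 2 * t" using rem[OF j] S by linarith
    thus "conj_sq_sum M (g j) \<le> real m / 2 * card (units_below M)" by (simp add: t_def)
  qed
qed

text \<open>Bounds the conductors from which no prime can be split off with profit.\<close>

lemma squarefree_dvd_fact:
  assumes "N > 0" "\<And>p M. prime p \<Longrightarrow> N = p * M \<Longrightarrow> \<not> p dvd M \<and> p \<le> n"
  shows "N dvd fact n"
proof (rule multiplicity_le_imp_dvd)
  fix p :: nat assume p: "prime p"
  show "multiplicity p N \<le> multiplicity p (fact n)"
  proof (cases "p dvd N")
    case True
    then obtain M where M: "N = p * M" by (elim dvdE)
    from assms(2)[OF p M] have *: "\<not> p dvd M" "p \<le> n" by auto
    have "multiplicity p N = Suc (multiplicity p M)"
      unfolding M using p assms(1) M by (intro multiplicity_times_same) (auto simp: prime_nat_iff)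
    also have "multiplicity p M = 0" using *(1) by (rule not_dvd_imp_multiplicity_0)
    also have "Suc 0 \<le> multiplicity p (fact n)"
      using p *(2) by (intro multiplicity_geI) (auto simp: dvd_fact prime_gt_0_nat Suc_le_eq)
    finally show ?thesis .
  qed (simp add: not_dvd_imp_multiplicity_0)
qed (use assms in auto)

text \<open>The induction variable \<open>m\<close> bounds twice the mean value of the squared conjugates. Splitting off
  a prime either removes it from the conductor or decreases this mean by at least one half, except
  for finitely many conductors.\<close>

theorem root_sums_bounded_mean:
  "\<exists>L. \<forall>N>0. \<forall>f. conj_sq_sum N f \<le> real m / 2 * card (units_below N) \<longrightarrow> ipoly f (zeta N) \<in> root_sums L"
proof (induction m)
  case 0
  have "ipoly f (zeta N) \<in> root_sums 0" if "N > 0" "conj_sq_sum N f \<le> 0" for N f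
  proof -
    have "vanishing N f"
    proof (rule ccontr)
      assume "\<not> vanishing N f"
      thus False using conj_sq_sum_ge[OF that(1)] card_units_below_pos[OF that(1)] that(2) by fastforce
    qed
    thus ?thesis using vanishingD_zeta that(1) by simp
  qed
  thus ?case by auto
next
  case (Suc m)
  then obtain L1 where L1: "\<And>N f. N > 0 \<Longrightarrow> conj_sq_sum N f \<le> real m / 2 * card (units_below N) \<Longrightarrow>
    ipoly f (zeta N) \<in> root_sums L1" by blast
  define K where "K = (fact (2 * Suc m) :: nat)"
  have "\<forall>N. \<exists>L. N > 0 \<longrightarrow> (\<forall>f. conj_sq_sum N f \<le> real (Suc m) / 2 * card (units_below N) \<longrightarrow> ipoly f (zeta N) \<in> root_sums L)"
    using root_sums_fixed_conductor by blast
  then obtain L2 where L2: "\<And>N f. N > 0 \<Longrightarrow> conj_sq_sum N f \<le> real (Suc m) / 2 * card (units_below N) \<Longrightarrow>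
      ipoly f (zeta N) \<in> root_sums (L2 N)" by metis
  \<comment> \<open>The sum covers the exceptional conductors, all divisors of \<open>K\<close>;
    \<open>Suc m * L1\<close> covers at most \<open>Suc m\<close> coefficients of smaller mean. A
    single coefficient costs nothing: multiplication by a root of unity keeps the length, so the
    inner induction retains the same \<open>L\<close>.\<close>
  define L where "L = (\<Sum>N\<in>{1..K}. L2 N) + Suc m * L1"
  have "ipoly f (zeta N) \<in> root_sums L"
    if "N > 0" "conj_sq_sum N f \<le> real (Suc m) / 2 * card (units_below N)" for N f
    using that
  proof (induction N arbitrary: f rule: less_induct)
    case (less N)
    have step: "ipoly f (zeta N) \<in> root_sums L"
      if "M < N" "M > 0" and J: "finite J" "card J \<le> Suc m" and r: "\<And>j. r j \<in> roots_of_unity"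
        and val: "ipoly f (zeta N) = (\<Sum>j\<in>J. r j * ipoly (c j) (zeta M))"
        and c2: "\<And>j. card J \<ge> 2 \<Longrightarrow> j \<in> J \<Longrightarrow> conj_sq_sum M (c j) \<le> (real (Suc m) - 1) / 2 * card (units_below M)"
        and c1: "\<And>j. card J = 1 \<Longrightarrow> j \<in> J \<Longrightarrow> conj_sq_sum M (c j) \<le> real (Suc m) / 2 * card (units_below M)"
      for M J c and r :: "nat \<Rightarrow> complex"
    proof -
      consider "card J = 0" | "card J = 1" | "card J \<ge> 2" by linarith
      thus ?thesis
      proof cases
        case 1
        thus ?thesis using J(1) val by simp
      next
        case 2
        then obtain j where j: "J = {j}" by (elim card_1_singletonE)
        have "ipoly (c j) (zeta M) \<in> root_sums L"
          using less.IH[OF \<open>M < N\<close> \<open>M > 0\<close>] c1[OF 2, of j] j by simp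
        thus ?thesis using val root_sums_mult[OF r] by (simp add: j)
      next
        case 3
        have "ipoly (c j) (zeta M) \<in> root_sums L1" if "j \<in> J" for j
          using L1[OF \<open>M > 0\<close>] c2[OF 3 that] by simp
        hence "ipoly f (zeta N) \<in> root_sums (card J * L1)"
          unfolding val using J(1) r by (intro root_sums_sum root_sums_mult) auto
        moreover have "card J * L1 \<le> L" using J(2) by (simp add: L_def trans_le_add2 mult_le_mono1 del: mult_Suc)
        ultimately show ?thesis using root_sums_mono by blast
      qed
    qed
    show ?case
    proof (cases "\<exists>p M. prime p \<and> N = p * M \<and> (p dvd M \<or> p > 2 * Suc m)")
      case True
      then obtain p M where p: "prime p" "N = p * M" "p dvd M \<or> p > 2 * Suc m" by blast
      have p0: "p > 0" using p by (simp add: prime_gt_0_nat)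
      have M: "M > 0" "M < N" using p(2) less.prems prime_gt_1_nat[OF p(1)] by (auto intro: Nat.gr0I)
      show ?thesis
      proof (cases "p dvd M")
        case True
        obtain J c where Jc: "J \<subseteq> {..<p}" "card J \<le> Suc m"
          "ipoly f (zeta (p * M)) = (\<Sum>j\<in>J. zeta (p * M) ^ j * ipoly (c j) (zeta M))"
          "\<forall>j\<in>J. card J \<ge> 2 \<longrightarrow> conj_sq_sum M (c j) \<le> (real (Suc m) - 1) / 2 * card (units_below M)"
          "\<forall>j\<in>J. card J = 1 \<longrightarrow> conj_sq_sum M (c j) \<le> real (Suc m) / 2 * card (units_below M)"
          using ramified_prime_step[OF M(1) p(1) True zero_less_Suc less.prems(2)[unfolded p(2)]] by blast
        show ?thesis
          by (rule step[OF M(2,1) finite_subset[OF Jc(1) finite_lessThan] Jc(2) _ Jc(3)[folded p(2)]])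
             (use zeta_power_in_roots_of_unity less.prems Jc(4,5) in auto)
      next
        case False
        hence "p > 2 * Suc m" using p(3) by blast
        obtain J c where Jc: "J \<subseteq> {..<p}" "card J \<le> Suc m"
          "ipoly f (zeta (p * M)) = (\<Sum>j\<in>J. zeta p ^ j * ipoly (c j) (zeta M))"
          "\<forall>j\<in>J. card J \<ge> 2 \<longrightarrow> conj_sq_sum M (c j) \<le> (real (Suc m) - 1) / 2 * card (units_below M)"
          "\<forall>j\<in>J. card J = 1 \<longrightarrow> conj_sq_sum M (c j) \<le> real (Suc m) / 2 * card (units_below M)"
          using large_tame_prime_step[OF M(1) p(1) False \<open>p > 2 * Suc m\<close> zero_less_Suc less.prems(2)[unfolded p(2)]] by blast
        show ?thesis
          by (rule step[OF M(2,1) finite_subset[OF Jc(1) finite_lessThan] Jc(2) _ Jc(3)[folded p(2)]])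
             (use zeta_power_in_roots_of_unity p0 Jc(4,5) in auto)
      qed
    next
      case False
      hence "N dvd K" unfolding K_def using less.prems(1) by (intro squarefree_dvd_fact) (auto simp: not_less)
      hence "N \<in> {1..K}" using less.prems(1) by (auto simp: K_def dvd_imp_le)
      hence "L2 N \<le> (\<Sum>N\<in>{1..K}. L2 N)" by (intro member_le_sum) auto
      hence "L2 N \<le> L" by (simp add: L_def)
      thus ?thesis using L2[OF less.prems] root_sums_mono by blast
    qed
  qed
  thus ?case by blast
qed

subsection \<open>Sums of roots of unity over units in a residue class\<close>

lemma root_of_unity_order:
  fixes \<xi> :: complex
  assumes "N > 0" "\<xi> ^ N = 1"
  obtains d where "d > 0" "\<And>a. \<xi> ^ a = 1 \<longleftrightarrow> d dvd a"
proof -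
  define d where "d = (LEAST d. d > 0 \<and> \<xi> ^ d = 1)"
  have d: "d > 0 \<and> \<xi> ^ d = 1" unfolding d_def by (rule LeastI[of _ N]) (use assms in auto)
  have "\<xi> ^ a = 1 \<longleftrightarrow> d dvd a" for a
  proof
    assume a: "\<xi> ^ a = 1"
    have "\<xi> ^ a = \<xi> ^ (d * (a div d) + a mod d)" by simp
    also have "\<dots> = \<xi> ^ (a mod d)" using d by (simp only: power_add power_mult power_one mult_1)
    finally have "\<xi> ^ (a mod d) = 1" using a by simp
    moreover have "a mod d < d" using d by simp
    ultimately have "\<not> a mod d > 0" using not_less_Least[of "a mod d" "\<lambda>d. d > 0 \<and> \<xi> ^ d = 1", folded d_def] by simp
    thus "d dvd a" by (simp add: dvd_eq_mod_eq_0)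
  next
    assume "d dvd a" thus "\<xi> ^ a = 1" using d by (auto simp: power_mult)
  qed
  thus ?thesis using that d by blast
qed

text \<open>Translation by \<open>w\<close> permutes \<open>K\<close> and multiplies the sum by
  \<open>\<xi> ^ w\<close>.\<close>

lemma sum_powers_shift_invariant:
  fixes \<xi> :: complex
  assumes "K \<subseteq> {..<N}" "\<And>k. k \<in> K \<Longrightarrow> (k + w) mod N \<in> K" "\<xi> ^ N = 1" "\<xi> ^ w \<noteq> 1"
  shows "(\<Sum>k\<in>K. \<xi> ^ k) = 0"
proof -
  have fin: "finite K" using assms(1) finite_subset by blast
  have "inj_on (\<lambda>k. (k + w) mod N) K"
  proof (rule inj_onI)
    fix x y assume *: "x \<in> K" "y \<in> K" "(x + w) mod N = (y + w) mod N"
    hence "[x + w = y + w] (mod N)" by (simp add: cong_def)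
    hence "[x = y] (mod N)" by (simp add: cong_add_rcancel_nat)
    thus "x = y" using * assms(1) by (auto simp: cong_def subset_iff)
  qed
  moreover from this have "(\<lambda>k. (k + w) mod N) ` K = K"
    using fin assms(2) by (intro endo_inj_surj) auto
  ultimately have "bij_betw (\<lambda>k. (k + w) mod N) K K" by (simp add: bij_betw_def)
  from sum.reindex_bij_betw[OF this, of "\<lambda>k. \<xi> ^ k"]
  have "(\<Sum>k\<in>K. \<xi> ^ k) = (\<Sum>k\<in>K. \<xi> ^ ((k + w) mod N))" by simp
  also have "\<dots> = (\<Sum>k\<in>K. \<xi> ^ w * \<xi> ^ k)"
  proof (rule sum.cong[OF refl])
    fix k
    have "\<xi> ^ (k + w) = \<xi> ^ (N * ((k + w) div N) + (k + w) mod N)" by simp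
    also have "\<dots> = \<xi> ^ ((k + w) mod N)" by (simp only: power_add power_mult assms(3) power_one mult_1)
    finally show "\<xi> ^ ((k + w) mod N) = \<xi> ^ w * \<xi> ^ k" by (simp add: power_add mult.commute)
  qed
  finally have "(\<Sum>k\<in>K. \<xi> ^ k) = \<xi> ^ w * (\<Sum>k\<in>K. \<xi> ^ k)" by (simp only: sum_distrib_left[symmetric])
  thus ?thesis using assms(4) by simp
qed

text \<open>For \<open>Q\<close> dividing \<open>N\<close>, the automorphisms of Q(zeta_N) with
  prescribed action on Q(zeta_Q).\<close>

definition units_in_class :: "nat \<Rightarrow> nat \<Rightarrow> nat \<Rightarrow> nat set" where
  "units_in_class N Q u = {k. k < N \<and> coprime k N \<and> [k = u] (mod Q)}"

lemma coprime_iff_no_prime_dvd: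
  fixes k N :: nat
  shows "coprime k N \<longleftrightarrow> (\<forall>p. prime p \<longrightarrow> p dvd N \<longrightarrow> \<not> p dvd k)"
proof
  assume "coprime k N" thus "\<forall>p. prime p \<longrightarrow> p dvd N \<longrightarrow> \<not> p dvd k"
    by (meson coprime_common_divisor not_prime_unit)
next
  assume *: "\<forall>p. prime p \<longrightarrow> p dvd N \<longrightarrow> \<not> p dvd k"
  show "coprime k N"
  proof (rule ccontr)
    assume "\<not> coprime k N"
    hence "gcd k N \<noteq> 1" by (rule contrapos_nn) (rule coprime_iff_gcd_eq_1[THEN iffD2])
    then obtain p where "prime p" "p dvd gcd k N" using prime_factor_nat by blast
    hence "prime p" "p dvd k" "p dvd N" by simp_all
    thus False using * by blast
  qed
qed

text \<open>With \<open>R\<close> the primes of \<open>N\<close> dividing neither \<open>u\<close>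
  nor \<open>Q\<close>, each prime of \<open>N\<close> divides exactly one of the two summands of
  \<open>u + Q * \<Prod>R\<close>.\<close>

lemma units_in_class_nonempty:
  assumes "N > 0" "Q dvd N" "coprime u Q"
  shows "units_in_class N Q u \<noteq> {}"
proof -
  define R where "R = {p. prime p \<and> p dvd N \<and> \<not> p dvd u \<and> \<not> p dvd Q}"
  have finR: "finite R" using assms(1) by (rule finite_subset[rotated, OF finite_divisors_nat]) (auto simp: R_def)
  define k where "k = u + Q * \<Prod>R"
  have R: "p dvd \<Prod>R \<longleftrightarrow> p \<in> R" if p: "prime p" for p
  proof
    assume "p dvd \<Prod>R"
    then obtain q where "q \<in> R" "p dvd q" using p finR by (auto simp: prime_dvd_prod_iff)
    thus "p \<in> R" using p primes_dvd_imp_eq[of p q] by (auto simp: R_def)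
  qed (rule dvd_prodI[OF finR])
  have "coprime k N" unfolding coprime_iff_no_prime_dvd
  proof (intro allI impI)
    fix p assume p: "prime p" "p dvd N"
    show "\<not> p dvd k"
    proof (cases "p dvd u")
      case True
      hence "\<not> p dvd Q" using assms(3) p(1) by (auto simp: coprime_iff_no_prime_dvd)
      moreover have "\<not> p dvd \<Prod>R" using R[OF p(1)] True by (simp add: R_def)
      ultimately have "\<not> p dvd Q * \<Prod>R" using p(1) by (simp add: prime_dvd_mult_iff)
      thus ?thesis using True by (simp add: k_def dvd_add_right_iff)
    next
      case False
      have "p dvd Q \<or> p \<in> R" using False p by (auto simp: R_def)
      hence "p dvd Q * \<Prod>R" using R[OF p(1)] by (auto simp: dvd_mult dvd_mult2)
      thus ?thesis using False by (simp add: k_def dvd_add_left_iff)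
    qed
  qed
  hence "k mod N \<in> units_in_class N Q u"
    using assms(1,2) by (auto simp: units_in_class_def coprime_mod_left_iff cong_def mod_mod_cancel k_def)
  thus ?thesis by blast
qed

text \<open>A Ramanujan sum. Let \<open>w\<close> be \<open>Q\<close> times the primes of
  \<open>N\<close> prime to \<open>Q\<close>. Translation by \<open>w\<close> preserves the units in
  the class, so the sum vanishes unless \<open>\<xi> ^ w = 1\<close>. In that case the order of
  \<xi> contains a simple prime p > P, and sieving by p alone gives a saving of p - 1.\<close>

lemma sum_powers_units_in_class_bound:
  fixes \<xi> :: complex
  assumes "N > 0" "Q dvd N" "\<xi> ^ N = 1" "\<xi> ^ (Q * fact P) \<noteq> 1"
  shows "real P * cmod (\<Sum>k\<in>units_in_class N Q u. \<xi> ^ k) \<le> real (card (units_in_class N Q u))"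
proof -
  define K where "K = units_in_class N Q u"
  have Q0: "Q > 0" using assms(1,2) by (auto intro: Nat.gr0I)
  define R where "R = {p. prime p \<and> p dvd N \<and> \<not> p dvd Q}"
  have finR: "finite R" using assms(1) by (rule finite_subset[rotated, OF finite_divisors_nat]) (auto simp: R_def)
  have dvd_R: "p dvd \<Prod>R' \<longleftrightarrow> p \<in> R'" if p: "prime p" "R' \<subseteq> R" for p R'
  proof
    have fin: "finite R'" using p(2) finR finite_subset by blast
    assume "p dvd \<Prod>R'"
    then obtain q where "q \<in> R'" "p dvd q" using p(1) fin by (auto simp: prime_dvd_prod_iff)
    thus "p \<in> R'" using p primes_dvd_imp_eq[of p q] by (auto simp: R_def)
  next
    have fin: "finite R'" using p(2) finR finite_subset by blast
    assume "p \<in> R'" thus "p dvd \<Prod>R'" by (rule dvd_prodI[OF fin])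
  qed
  define w where "w = Q * \<Prod>R"
  have dvd_w: "p dvd w" if "prime p" "p dvd N" for p
  proof -
    have "p dvd Q \<or> p \<in> R" using that by (auto simp: R_def)
    thus ?thesis using dvd_R[OF that(1) subset_refl] by (auto simp: w_def)
  qed
  have class_shift: "[(k + Q * i) mod N = u] (mod Q)" if "[k = u] (mod Q)" for k i
    using that assms(2) by (simp add: cong_def mod_mod_cancel)
  have dvd_shift: "q dvd (k + j) mod N \<longleftrightarrow> q dvd k + j" if "q dvd N" for q k j
    using that by (simp add: dvd_mod_iff)
  show ?thesis
  proof (cases "\<xi> ^ w = 1")
    case False
    have "(\<Sum>k\<in>K. \<xi> ^ k) = 0"
    proof (rule sum_powers_shift_invariant[OF _ _ assms(3) False])
      show "K \<subseteq> {..<N}" by (auto simp: K_def units_in_class_def)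
      fix k assume k: "k \<in> K"
      have "coprime ((k + w) mod N) N" unfolding coprime_iff_no_prime_dvd
      proof (intro allI impI)
        fix p assume p: "prime p" "p dvd N"
        have "\<not> p dvd k" using k p by (auto simp: K_def units_in_class_def coprime_iff_no_prime_dvd)
        thus "\<not> p dvd (k + w) mod N" using dvd_w[OF p] dvd_shift[OF p(2)] by (simp add: dvd_add_left_iff)
      qed
      thus "(k + w) mod N \<in> K" using k assms(1) class_shift[of k "\<Prod>R"]
        by (simp add: K_def units_in_class_def w_def)
    qed
    thus ?thesis by (simp add: K_def)
  next
    case True
    obtain d where d: "d > 0" "\<And>a. \<xi> ^ a = 1 \<longleftrightarrow> d dvd a" using root_of_unity_order[OF assms(1,3)] by blast
    have dw: "d dvd w" using d(2) True by blast
    have "\<not> d dvd Q * fact P" using d(2) assms(4) by blast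
    \<comment> \<open>The order \<open>d\<close> divides \<open>w\<close> but not
      \<open>Q * fact P\<close>, so some prime occurs in it more often than in
      \<open>Q * fact P\<close>. The part of \<open>w\<close> beyond \<open>Q\<close> is squarefree
      and prime to \<open>Q\<close>; hence p is prime to \<open>Q\<close>, divides \<open>w\<close>
      exactly once, and exceeds \<open>P\<close>.\<close>
    then obtain p where p: "prime p" "multiplicity p (Q * fact P) < multiplicity p d"
      using multiplicity_le_imp_dvd[of d "Q * fact P"] d(1) by (metis not_le neq0_conv)
    have w0: "w \<noteq> 0" using Q0 finR by (auto simp: w_def R_def)
    have R0: "\<Prod>R \<noteq> 0" using finR by (auto simp: R_def)
    have mw: "multiplicity p d \<le> multiplicity p w" using dw w0 by (rule dvd_imp_multiplicity_le)
    have pe: "prime_elem p" using p(1) by simp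
    have mult_w: "multiplicity p w = multiplicity p Q + multiplicity p (\<Prod>R)"
      unfolding w_def using pe Q0 R0 by (intro prime_elem_multiplicity_mult_distrib) auto
    have mult_QP: "multiplicity p (Q * fact P) = multiplicity p Q + multiplicity p (fact P)"
      using pe Q0 by (intro prime_elem_multiplicity_mult_distrib) auto
    have "multiplicity p (\<Prod>R) > 0" using mw p(2) mult_w mult_QP by linarith
    hence "p dvd \<Prod>R" using not_dvd_imp_multiplicity_0 by fastforce
    hence pR: "p \<in> R" using dvd_R[OF p(1) subset_refl] by blast
    hence pQ: "\<not> p dvd Q" "p dvd N" by (auto simp: R_def)
    define w' where "w' = Q * \<Prod>(R - {p})"
    have ww: "w = p * w'" using prod.remove[OF finR pR, of "\<lambda>x. x"] by (simp add: w_def w'_def)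
    have "\<not> p dvd \<Prod>(R - {p})" using dvd_R[OF p(1), of "R - {p}"] by blast
    hence pw': "\<not> p dvd w'" using pQ(1) p(1) by (simp add: w'_def prime_dvd_mult_iff)
    have "multiplicity p w = Suc (multiplicity p w')"
      unfolding ww using p(1) w0 ww by (intro multiplicity_times_same) (auto simp: prime_nat_iff)
    hence "multiplicity p w = 1" using not_dvd_imp_multiplicity_0[OF pw'] by simp
    hence "multiplicity p (fact P) = 0" "multiplicity p d > 0" using p(2) mw mult_QP by linarith+
    have pP: "p > P"
    proof (rule ccontr)
      assume "\<not> p > P"
      hence "p dvd fact P" using prime_gt_0_nat[OF p(1)] by (intro dvd_fact) auto
      hence "p ^ 1 dvd fact P" by simp
      hence "1 \<le> multiplicity p (fact P)" using prime_gt_1_nat[OF p(1)] by (intro multiplicity_geI) auto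
      thus False using \<open>multiplicity p (fact P) = 0\<close> by simp
    qed
    have "p dvd d" using \<open>multiplicity p d > 0\<close> not_dvd_imp_multiplicity_0 by fastforce
    hence "\<not> d dvd w'" using pw' dvd_trans by blast
    hence \<xi>w': "\<xi> ^ w' \<noteq> 1" using d(2) by blast
    \<comment> \<open>Coprimality to p is dropped, so that translation by \<open>w' = w / p\<close>
      preserves the set, while \<open>\<xi> ^ w'\<close> differs from 1. The sum over
      \<open>K'\<close> vanishes, and the one over \<open>K\<close> is minus the sum over the
      multiples of p.\<close>
    define K' where "K' = {k. k < N \<and> [k = u] (mod Q) \<and> (\<forall>q. prime q \<longrightarrow> q dvd N \<longrightarrow> q \<noteq> p \<longrightarrow> \<not> q dvd k)}"
    have finK': "finite K'" by (rule finite_subset[of _ "{..<N}"]) (auto simp: K'_def)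
    have shift: "(k + w' * i) mod N \<in> K'" if k: "k \<in> K'" for k i
    proof -
      have "\<not> q dvd (k + w' * i) mod N" if q: "prime q" "q dvd N" "q \<noteq> p" for q
      proof -
        have "q dvd Q \<or> q \<in> R - {p}" using q by (auto simp: R_def)
        hence "q dvd w'" using dvd_R[OF q(1), of "R - {p}"] by (auto simp: w'_def)
        moreover have "\<not> q dvd k" using k q by (auto simp: K'_def)
        ultimately show ?thesis using dvd_shift[OF q(2)] by (simp add: dvd_add_left_iff)
      qed
      moreover have "[(k + w' * i) mod N = u] (mod Q)"
        using class_shift[of k "\<Prod>(R - {p}) * i"] k by (simp add: K'_def w'_def mult.assoc)
      ultimately show ?thesis using assms(1) by (simp add: K'_def)
    qed
    have zero: "(\<Sum>k\<in>K'. \<xi> ^ k) = 0"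
    proof (rule sum_powers_shift_invariant[OF _ _ assms(3) \<xi>w'])
      show "K' \<subseteq> {..<N}" by (auto simp: K'_def)
      show "(k + w') mod N \<in> K'" if "k \<in> K'" for k using shift[OF that, of 1] by simp
    qed
    have K: "K = {k \<in> K'. \<not> p dvd k}"
      unfolding K_def units_in_class_def K'_def coprime_iff_no_prime_dvd using p(1) pQ(2) by blast
    define E where "E = {k \<in> K'. p dvd k}"
    have finE: "finite E" and finK: "finite K" using finK' by (auto simp: E_def K)
    have KE: "K' = K \<union> E" "K \<inter> E = {}" by (auto simp: K E_def)
    have "(\<Sum>k\<in>K. \<xi> ^ k) = - (\<Sum>k\<in>E. \<xi> ^ k)"
      using zero unfolding KE(1) by (simp add: sum.union_disjoint[OF finK finE KE(2)] eq_neg_iff_add_eq_0)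
    moreover have "cmod \<xi> = 1" using assms(1,3) by (metis norm_one norm_power power_eq_1_iff less_irrefl norm_ge_zero)
    hence "cmod (\<Sum>k\<in>E. \<xi> ^ k) \<le> card E"
      by (intro order.trans[OF norm_sum]) (simp add: norm_power)
    ultimately have le: "cmod (\<Sum>k\<in>K. \<xi> ^ k) \<le> card E" by simp
    \<comment> \<open>Moved by \<open>w' * s\<close> with 0 < s < p, a multiple of p stays in
      \<open>K'\<close> but is no longer divisible by p; so each element of \<open>E\<close>
      accounts for p - 1 \<ge> P elements of \<open>K\<close>.\<close>
    have "card (E \<times> {1..<p}) \<le> card K"
    proof (rule card_inj_on_le)
      show "inj_on (\<lambda>(k, s). (k + w' * s) mod N) (E \<times> {1..<p})"
      proof (rule inj_onI, clarify)
        fix k s k2 s2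
        assume *: "k \<in> E" "s \<in> {1..<p}" "k2 \<in> E" "s2 \<in> {1..<p}" "(k + w' * s) mod N = (k2 + w' * s2) mod N"
        hence cN: "[k + w' * s = k2 + w' * s2] (mod N)" by (simp add: cong_def)
        hence "[k + w' * s = k2 + w' * s2] (mod p)" using pQ(2) cong_dvd_modulus_nat by blast
        moreover have "[k = 0] (mod p)" "[k2 = 0] (mod p)" using * by (auto simp: E_def cong_0_iff)
        hence "[k + w' * s = 0 + w' * s] (mod p)" "[k2 + w' * s2 = 0 + w' * s2] (mod p)"
          by (blast intro: cong_add cong_refl)+
        ultimately have "[w' * s = w' * s2] (mod p)" by (metis add_0 cong_sym cong_trans)
        moreover have "coprime w' p" using pw' p(1) by (metis coprime_commute prime_imp_coprime)
        ultimately have "[s = s2] (mod p)" by (simp add: cong_mult_lcancel_nat)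
        hence s: "s = s2" using * by (simp add: cong_def)
        hence "[k = k2] (mod N)" using cN by (simp add: cong_add_rcancel_nat)
        hence "k = k2" using * by (auto simp: E_def K'_def cong_def)
        thus "k = k2 \<and> s = s2" using s by simp
      qed
      show "(\<lambda>(k, s). (k + w' * s) mod N) ` (E \<times> {1..<p}) \<subseteq> K"
      proof clarify
        fix k s assume ks: "k \<in> E" "s \<in> {1..<p}"
        have "\<not> p dvd s" using ks(2) by (auto dest: dvd_imp_le)
        hence "\<not> p dvd w' * s" using pw' p(1) by (simp add: prime_dvd_mult_iff)
        hence "\<not> p dvd (k + w' * s) mod N" using ks(1) dvd_shift[OF pQ(2)] by (simp add: E_def dvd_add_right_iff)
        moreover have "(k + w' * s) mod N \<in> K'" using shift ks(1) by (simp add: E_def)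
        ultimately show "(k + w' * s) mod N \<in> K" by (simp add: K)
      qed
    qed (rule finK)
    hence "card E * (p - 1) \<le> card K" by (simp add: card_cartesian_product)
    moreover have "P \<le> p - 1" using pP by simp
    hence "card E * P \<le> card E * (p - 1)" by simp
    ultimately have "card E * P \<le> card K" by linarith
    hence "real P * real (card E) \<le> real (card K)" by (metis mult.commute of_nat_le_iff of_nat_mult)
    moreover have "real P * cmod (\<Sum>k\<in>K. \<xi> ^ k) \<le> real P * real (card E)"
      using le by (intro mult_left_mono) auto
    ultimately show ?thesis unfolding K_def by linarith
  qed
qed

subsection \<open>Torsion points and Galois orbits\<close>

text \<open>Torsion points are written additively: characters become integer linear forms, and
  extracting roots becomes division in \<rat>.\<close>

definition qexp :: "rat \<Rightarrow> complex" where
  "qexp x = cis (2 * pi * of_rat x)"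

lemma qexp_0 [simp]: "qexp 0 = 1"
  by (simp add: qexp_def)

lemma qexp_add: "qexp (x + y) = qexp x * qexp y"
  by (simp add: qexp_def of_rat_add distrib_left cis_mult)

lemma qexp_minus: "qexp (- x) = inverse (qexp x)"
  by (simp add: qexp_def of_rat_minus cis_inverse)

lemma qexp_sum: "qexp (\<Sum>i\<in>A. f i) = (\<Prod>i\<in>A. qexp (f i))"
  by (induction A rule: infinite_finite_induct) (auto simp: qexp_add)

lemma qexp_nz [simp]: "qexp x \<noteq> 0"
  by (simp add: qexp_def)

lemma norm_qexp [simp]: "cmod (qexp x) = 1"
  by (simp add: qexp_def)

lemma qexp_power: "qexp x ^ k = qexp (of_nat k * x)"
  by (simp add: qexp_def DeMoivre of_rat_mult mult_ac)

lemma qexp_powi: "qexp x powi k = qexp (of_int k * x)"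
  by (cases k rule: int_cases2) (auto simp: qexp_power qexp_minus power_int_minus power_inverse)

lemma qexp_eq_1_iff: "qexp x = 1 \<longleftrightarrow> x \<in> \<int>"
proof
  assume "qexp x = 1"
  hence "cos (2 * pi * of_rat x) = 1" by (simp add: qexp_def complex_eq_iff)
  then obtain z :: int where "2 * pi * of_rat x = of_int z * 2 * pi" by (auto simp: cos_one_2pi_int)
  hence "(of_rat x :: real) = of_rat (of_int z)" by simp
  hence "x = of_int z" by (simp only: of_rat_eq_iff)
  thus "x \<in> \<int>" by simp
next
  assume "x \<in> \<int>"
  then obtain z where "x = of_int z" by (elim Ints_cases)
  thus "qexp x = 1" by (simp add: qexp_def cis_multiple_2pi)
qed

lemma qexp_fraction: "qexp (of_nat a / of_nat N) = zeta N ^ a"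
  by (simp add: qexp_def zeta_power of_rat_divide)

lemma roots_of_unity_eq_range_qexp: "roots_of_unity = range qexp"
proof (intro equalityI subsetI)
  fix z assume "z \<in> roots_of_unity"
  then obtain n where n: "n > 0" "z ^ n = 1" by (auto simp: roots_of_unity_def)
  then obtain k where "z = cis (2 * pi * real k / real n)"
    using bij_betw_roots_unity[OF n(1)] by (auto simp: bij_betw_def)
  hence "z = qexp (of_nat k / of_nat n)" by (simp add: qexp_fraction zeta_power)
  thus "z \<in> range qexp" by blast
next
  fix z assume "z \<in> range qexp"
  then obtain x where x: "z = qexp x" by blast
  obtain a b where ab: "x = of_int a / of_int b" "b > 0" by (metis Fract_of_int_quotient quotient_of_div surj_pair quotient_of_denom_pos)
  hence "of_nat (nat b) * x = of_int a" by simp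
  hence "z ^ nat b = 1" by (simp add: x qexp_power qexp_eq_1_iff)
  thus "z \<in> roots_of_unity" using ab(2) by (auto simp: roots_of_unity_def intro!: exI[of _ "nat b"])
qed

lemma common_denominator:
  fixes x :: "'a \<Rightarrow> rat"
  assumes "finite J"
  obtains N where "N > 0" "\<And>j. j \<in> J \<Longrightarrow> of_nat N * x j \<in> \<int>"
proof -
  have "\<exists>N>0. \<forall>j\<in>J. of_nat N * x j \<in> \<int>"
    using assms
  proof induction
    case empty show ?case by (intro exI[of _ 1]) auto
  next
    case (insert i J)
    then obtain N where N: "N > 0" "\<forall>j\<in>J. of_nat N * x j \<in> \<int>" by blast
    obtain a b where ab: "x i = of_int a / of_int b" "b > 0"
      by (metis quotient_of_div surj_pair quotient_of_denom_pos)
    hence bi: "of_nat (nat b) * x i = of_int a" by simp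
    have "of_nat (N * nat b) * x j \<in> \<int>" if "j \<in> insert i J" for j
    proof (cases "j = i")
      case True
      have "of_nat (N * nat b) * x i = of_nat N * (of_nat (nat b) * x i)" by simp
      also have "\<dots> \<in> \<int>" unfolding bi by (intro Ints_mult) auto
      finally show ?thesis using True by simp
    next
      case False
      have "of_nat (N * nat b) * x j = of_nat (nat b) * (of_nat N * x j)" by (simp add: mult_ac)
      also have "of_nat N * x j \<in> \<int>" using N(2) that False by simp
      hence "of_nat (nat b) * (of_nat N * x j) \<in> \<int>" by (rule Ints_mult[OF Ints_of_nat])
      finally show ?thesis .
    qed
    thus ?case using N(1) ab(2) by (intro exI[of _ "N * nat b"]) auto
  qed
  thus ?thesis using that by blast
qed

text \<open>Supplies the exponent of the kernel: the constant term of a product of \<open>n\<close>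
  kernels decays only polynomially in \<open>r\<close>, while its value away from the peak is at
  most \<open>q ^ r\<close>.\<close>

lemma exists_power_less_central_binomial:
  fixes q :: real
  assumes "0 \<le> q" "q < 1"
  shows "\<exists>r. 2 * q ^ r < (real ((2 * r) choose r) / 4 ^ r) ^ n"
proof -
  \<comment> \<open>With this root, \<open>(2 * r) ^ Suc n * q ^ r\<close> is the power
    \<open>(2 * r * \<rho> ^ r) ^ Suc n\<close> of a null sequence.\<close>
  define \<rho> where "\<rho> = root (Suc n) q"
  have \<rho>: "0 \<le> \<rho>" "\<rho> < 1" "\<rho> ^ Suc n = q" 
    using assms by (auto simp: \<rho>_def simp del: power_Suc)
  have "(\<lambda>r. of_nat r * \<rho> ^ r) \<longlonglongrightarrow> 0" by (rule powser_times_n_limit_0) (use \<rho> in auto)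
  hence "eventually (\<lambda>r. of_nat r * \<rho> ^ r < 1 / 4) sequentially" by (rule order_tendstoD) auto
  moreover have "eventually (\<lambda>r. r > 0) sequentially" by (rule eventually_gt_at_top)
  ultimately have "eventually (\<lambda>r. of_nat r * \<rho> ^ r < 1 / 4 \<and> r > 0) sequentially" by (rule eventually_conj)
  then obtain r where r: "real r * \<rho> ^ r < 1 / 4" "r > 0" by (auto simp: eventually_sequentially)
  have "q ^ r = (\<rho> ^ r) ^ Suc n" by (simp only: \<rho>(3)[symmetric] mult.commute flip: power_mult)
  have "(2 * real r) ^ Suc n * q ^ r = (2 * (real r * \<rho> ^ r)) ^ Suc n"
    unfolding \<open>q ^ r = _\<close> by (simp only: power_mult_distrib mult_ac)
  also have "\<dots> \<le> (1 / 2) ^ Suc n" using r(1) \<rho>(1) by (intro power_mono) auto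
  also have "\<dots> \<le> 1 / 2" using power_le_one[of "1/2 :: real" n] by simp
  finally have 1: "2 * ((2 * real r) ^ Suc n * q ^ r) \<le> 1" by simp
  have "2 * q ^ r < (1 / (2 * real r)) ^ n"
  proof -
    have "2 * ((2 * real r) ^ n * q ^ r) * (2 * real r) \<le> 1" using 1 by (simp add: mult_ac)
    hence "2 * ((2 * real r) ^ n * q ^ r) \<le> 1 / (2 * real r)" using r(2) by (simp add: field_simps)
    also have "\<dots> < 1" using r(2) by simp
    finally have "2 * q ^ r * (2 * real r) ^ n < 1" by (simp add: mult_ac)
    thus ?thesis using r(2) by (simp add: power_one_over field_simps)
  qed
  also have "\<dots> \<le> (real ((2 * r) choose r) / 4 ^ r) ^ n"
  proof (rule power_mono)
    have "4 ^ r / (2 * real r) \<le> real ((2 * r) choose r)" using r(2) by (rule central_binomial_lower_bound)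
    thus "1 / (2 * real r) \<le> real ((2 * r) choose r) / 4 ^ r" using r(2) by (simp add: field_simps)
  qed auto
  finally show ?thesis by blast
qed

text \<open>On the unit circle \<open>cnj z\<close> is 1 / z, so |1 + z|^2 = (1 + z)^2 / z, and the
  kernel is a Laurent polynomial with frequencies from -r to r.\<close>

lemma power_norm_one_plus:
  assumes "cmod z = 1"
  shows "complex_of_real (((cmod (1 + z))\<^sup>2 / 4) ^ r) =
    (\<Sum>a\<le>2 * r. of_real (real ((2 * r) choose a) / 4 ^ r) * (z ^ a / z ^ r))"
proof -
  have z: "z \<noteq> 0" using assms by auto
  have zc: "z * cnj z = 1" using complex_norm_square[of z] assms by simp
  have "complex_of_real ((cmod (1 + z))\<^sup>2) * z = (1 + z)\<^sup>2"
  proof -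
    have "complex_of_real ((cmod (1 + z))\<^sup>2) * z = (1 + z) * (z + z * cnj z)"
      unfolding complex_norm_square by (simp add: algebra_simps)
    thus ?thesis by (simp add: zc power2_eq_square add.commute)
  qed
  hence "complex_of_real ((cmod (1 + z))\<^sup>2) = (1 + z)\<^sup>2 / z" using z by (simp add: field_simps)
  hence "complex_of_real (((cmod (1 + z))\<^sup>2 / 4) ^ r) = ((1 + z)\<^sup>2 / z / 4) ^ r" by simp
  also have "\<dots> = (z + 1) ^ (2 * r) / (z ^ r * 4 ^ r)" by (simp add: power_divide power_mult add.commute)
  also have "(z + 1) ^ (2 * r) = (\<Sum>a\<le>2 * r. of_nat ((2 * r) choose a) * z ^ a)"
    using binomial_ring[of z 1 "2 * r"] by simp
  finally show ?thesis by (simp add: sum_divide_distrib mult_ac)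
qed

text \<open>Equidistribution of the Galois conjugates, made effective by summing the product of the
  kernels \<open>(\<bar>1 + z\<bar>\<^sup>2 / 4) ^ r\<close> over the orbit: the kernel concentrates at \<open>1\<close>, and only the
  characters occurring in its expansion matter.\<close>

lemma torsion_point_conjugate_dense:
  fixes s :: "nat \<Rightarrow> complex"
  assumes "finite J" "\<delta> > 0" "Q > 0" and s: "\<And>j. j \<in> J \<Longrightarrow> cmod (s j) = 1"
  shows "\<exists>r D. D > 0 \<and> (\<forall>(x :: nat \<Rightarrow> rat) N u. N > 0 \<longrightarrow> Q dvd N \<longrightarrow> coprime u Q \<longrightarrow> (\<forall>j\<in>J. of_nat N * x j \<in> \<int>) \<longrightarrow>
      (\<exists>f \<in> J \<rightarrow>\<^sub>E {..2 * r}. (\<exists>j\<in>J. f j \<noteq> r) \<and> of_nat D * (\<Sum>j\<in>J. (of_nat (f j) - of_nat r) * x j) \<in> \<int>) \<or>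
      (\<exists>k. coprime k N \<and> [k = u] (mod Q) \<and> (\<forall>j\<in>J. cmod (qexp (x j) ^ k - s j) < \<delta>)))"
proof -
  \<comment> \<open>For |w| = 1 the identity |1 + w|^2 + |1 - w|^2 = 4 bounds |1 + w|^2 / 4 by 1 -
    \<delta>^2 / 4 when w has distance at least \<delta> from 1; \<open>max 0\<close> covers
    \<delta> > 2.\<close>
  define q where "q = max 0 (1 - \<delta>\<^sup>2 / 4)"
  have q: "0 \<le> q" "q < 1" using assms(2) by (auto simp: q_def)
  define n where "n = card J"
  obtain r where r: "2 * q ^ r < (real ((2 * r) choose r) / 4 ^ r) ^ n"
    using exists_power_less_central_binomial[OF q] by blast
  define b where "b a = real ((2 * r) choose a) / 4 ^ r" for a
  have b0: "b a \<ge> 0" for a by (simp add: b_def)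
  have "b r ^ n > 0" using r q(1) by (smt (verit) b_def zero_le_power)
  obtain P where P: "real P > 2 / b r ^ n" using reals_Archimedean2 by blast
  have P0: "real P > 0" using P \<open>b r ^ n > 0\<close> by (meson divide_pos_pos less_trans zero_less_numeral)
  \<comment> \<open>The contradiction will come from \<open>b r ^ n \<le> q ^ r + 1 / P\<close>: the
    choices of \<open>r\<close> and of \<open>P\<close> make each term on the right smaller than
    half of the left side.\<close>
  have bP: "1 / real P < b r ^ n / 2" using P P0 \<open>b r ^ n > 0\<close> by (simp add: field_simps)
  define F where "F = (J \<rightarrow>\<^sub>E {..2 * r})"
  define f0 where "f0 = restrict (\<lambda>_. r) J"
  have finF: "finite F" using assms(1) by (simp add: F_def finite_PiE)
  have f0F: "f0 \<in> F" by (auto simp: f0_def F_def)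
  show ?thesis
  proof (rule exI[of _ r], rule exI[of _ "Q * fact P"], intro conjI allI impI)
    show "Q * fact P > 0" using assms(3) by simp
    fix x :: "nat \<Rightarrow> rat" and N u
    assume N: "N > 0" "Q dvd N" and u: "coprime u Q" and Nx': "\<forall>j\<in>J. of_nat N * x j \<in> \<int>"
    have Nx: "of_nat N * x j \<in> \<int>" if "j \<in> J" for j using Nx' that by blast
    show "(\<exists>f \<in> J \<rightarrow>\<^sub>E {..2 * r}. (\<exists>j\<in>J. f j \<noteq> r) \<and> of_nat (Q * fact P) * (\<Sum>j\<in>J. (of_nat (f j) - of_nat r) * x j) \<in> \<int>) \<or>
      (\<exists>k. coprime k N \<and> [k = u] (mod Q) \<and> (\<forall>j\<in>J. cmod (qexp (x j) ^ k - s j) < \<delta>))"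
    proof (rule ccontr)
      assume contra: "\<not> ?thesis"
      have nocong: "of_nat (Q * fact P) * (\<Sum>j\<in>J. (of_nat (f j) - of_nat r) * x j) \<notin> \<int>" if "f \<in> F - {f0}" for f
      proof -
        have "\<exists>j\<in>J. f j \<noteq> r"
        proof (rule ccontr)
          assume "\<not> ?thesis"
          hence "f = f0" using that by (auto simp: F_def f0_def PiE_def extensional_def restrict_def)
          thus False using that by simp
        qed
        thus ?thesis using contra that unfolding F_def by blast
      qed
      define K where "K = units_in_class N Q u"
      have finK: "finite K" by (rule finite_subset[of _ "{..<N}"]) (auto simp: K_def units_in_class_def)
      have K0: "card K > 0" using units_in_class_nonempty[OF N u] finK by (simp add: K_def card_gt_0_iff)
      define z where "z j k = cnj (s j) * qexp (x j) ^ k" for j k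
      have normz: "cmod (z j k) = 1" if "j \<in> J" for j k using s[OF that] by (simp add: z_def norm_mult norm_power)
      \<comment> \<open>The product kernel centred at \<open>s\<close>. If no conjugate in the class
        is close to \<open>s\<close>, each \<open>W k\<close> is at most \<open>q ^ r\<close>; but
        the mean of \<open>W\<close> is within 1 / P of its constant term \<open>b r ^ n\<close>,
        since every nontrivial character has a small sum.\<close>
      define W where "W k = (\<Prod>j\<in>J. ((cmod (1 + z j k))\<^sup>2 / 4) ^ r)" for k
      have W_le: "W k \<le> q ^ r" if k: "k \<in> K" for k
      proof -
        have "coprime k N \<and> [k = u] (mod Q)" using k by (simp add: K_def units_in_class_def)
        then obtain i where i: "i \<in> J" "cmod (qexp (x i) ^ k - s i) \<ge> \<delta>" using contra by (auto simp: not_less)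
        have par: "(cmod (1 + w))\<^sup>2 + (cmod (1 - w))\<^sup>2 = 4" if "cmod w = 1" for w
        proof -
          have "(Re w)\<^sup>2 + (Im w)\<^sup>2 = 1" using that cmod_power2[of w] by simp
          thus ?thesis unfolding cmod_power2 by (simp add: power2_eq_square algebra_simps)
        qed
        have le1: "((cmod (1 + z j k))\<^sup>2 / 4) ^ r \<le> 1" if "j \<in> J" for j
        proof (rule power_le_one)
          show "(cmod (1 + z j k))\<^sup>2 / 4 \<le> 1"
            using par[OF normz[OF that, of k]] zero_le_power2[of "cmod (1 - z j k)"] by linarith
        qed simp
        have "W k = ((cmod (1 + z i k))\<^sup>2 / 4) ^ r * (\<Prod>j\<in>J - {i}. ((cmod (1 + z j k))\<^sup>2 / 4) ^ r)"
          unfolding W_def using assms(1) i(1) by (rule prod.remove)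
        also have "\<dots> \<le> ((cmod (1 + z i k))\<^sup>2 / 4) ^ r * 1"
          by (intro mult_left_mono prod_le_1) (use le1 in auto)
        also have "\<dots> \<le> q ^ r * 1"
        proof (intro mult_right_mono power_mono)
          have "s i * cnj (s i) = 1" using s[OF i(1)] complex_norm_square[of "s i"] by simp
          hence "qexp (x i) ^ k - s i = - (s i * (1 - z i k))" by (simp add: z_def algebra_simps flip: mult.assoc)
          hence "cmod (1 - z i k) \<ge> \<delta>" using i s[OF i(1)] by (simp add: norm_mult)
          hence "\<delta>\<^sup>2 \<le> (cmod (1 - z i k))\<^sup>2" using assms(2) by (intro power_mono) auto
          hence "(cmod (1 + z i k))\<^sup>2 / 4 \<le> 1 - \<delta>\<^sup>2 / 4" using par[OF normz[OF i(1), of k]] by linarith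
          also have "\<dots> \<le> q" unfolding q_def by (rule max.cobounded2)
          finally show "(cmod (1 + z i k))\<^sup>2 / 4 \<le> q" .
        qed auto
        finally show ?thesis by simp
      qed
      define cf where "cf f = (\<Prod>j\<in>J. of_real (b (f j)) * (cnj (s j) ^ f j / cnj (s j) ^ r))" for f
      define \<xi> where "\<xi> f = qexp (\<Sum>j\<in>J. (of_nat (f j) - of_nat r) * x j)" for f
      have Wexp: "complex_of_real (W k) = (\<Sum>f\<in>F. cf f * \<xi> f ^ k)" for k
      proof -
        have "complex_of_real (W k) = (\<Prod>j\<in>J. \<Sum>a\<in>{..2 * r}. of_real (b a) * (z j k ^ a / z j k ^ r))"
          unfolding W_def of_real_prod using power_norm_one_plus[OF normz] by (intro prod.cong) (auto simp: b_def)
        also have "\<dots> = (\<Sum>f\<in>F. \<Prod>j\<in>J. of_real (b (f j)) * (z j k ^ f j / z j k ^ r))"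
          unfolding F_def using assms(1) by (subst prod_sum_PiE) auto
        also have "\<dots> = (\<Sum>f\<in>F. cf f * \<xi> f ^ k)"
        proof (rule sum.cong[OF refl])
          fix f assume "f \<in> F"
          have \<xi>k: "\<xi> f ^ k = (\<Prod>j\<in>J. qexp (x j) ^ (k * f j) / qexp (x j) ^ (k * r))"
          proof -
            have "\<xi> f ^ k = (\<Prod>j\<in>J. qexp (of_nat k * ((of_nat (f j) - of_nat r) * x j)))"
              by (simp add: \<xi>_def qexp_sum prod_power_distrib flip: qexp_power)
            also have "\<dots> = (\<Prod>j\<in>J. qexp (x j) ^ (k * f j) / qexp (x j) ^ (k * r))"
            proof (rule prod.cong[OF refl])
              fix j
              have "of_nat k * ((of_nat (f j) - of_nat r) * x j) = of_nat (k * f j) * x j + - (of_nat (k * r) * x j)"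
                by (simp add: algebra_simps)
              thus "qexp (of_nat k * ((of_nat (f j) - of_nat r) * x j)) = qexp (x j) ^ (k * f j) / qexp (x j) ^ (k * r)"
                by (simp only: qexp_add qexp_minus qexp_power divide_inverse)
            qed
            finally show ?thesis .
          qed
          have "cf f * \<xi> f ^ k = (\<Prod>j\<in>J. (of_real (b (f j)) * (cnj (s j) ^ f j / cnj (s j) ^ r)) * 
              (qexp (x j) ^ (k * f j) / qexp (x j) ^ (k * r)))" by (simp only: cf_def \<xi>k prod.distrib)
          also have "\<dots> = (\<Prod>j\<in>J. of_real (b (f j)) * (z j k ^ f j / z j k ^ r))"
            by (intro prod.cong refl) (simp add: z_def power_mult_distrib power_mult)
          finally show "(\<Prod>j\<in>J. of_real (b (f j)) * (z j k ^ f j / z j k ^ r)) = cf f * \<xi> f ^ k" by simp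
        qed
        finally show ?thesis .
      qed
      have norm_cf: "cmod (cf f) = (\<Prod>j\<in>J. b (f j))" for f
        unfolding cf_def prod_norm[symmetric]
        by (intro prod.cong refl) (use s b0 in \<open>simp add: norm_mult norm_divide norm_power\<close>)
      have sum_b: "(\<Sum>a\<le>2 * r. b a) = 1"
      proof -
        have "(\<Sum>a\<le>2 * r. real ((2 * r) choose a)) = 4 ^ r"
          using choose_row_sum[of "2 * r"] by (metis of_nat_sum of_nat_numeral of_nat_power power2_eq_square power_mult 
              numeral_Bit0 mult_2 numeral_times_numeral semiring_norm(11,12) num_double power_even_eq)
        thus ?thesis by (simp add: b_def flip: sum_divide_distrib)
      qed
      have sum_cf: "(\<Sum>f\<in>F. cmod (cf f)) = 1"
      proof -
        have "(\<Sum>f\<in>F. cmod (cf f)) = (\<Prod>j\<in>J. \<Sum>a\<in>{..2 * r}. b a)"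
          unfolding norm_cf F_def using assms(1) by (subst prod_sum_PiE) auto
        thus ?thesis by (simp add: sum_b)
      qed
      have cf0: "cf f0 = of_real (b r ^ n)"
      proof -
        have "cf f0 = (\<Prod>j\<in>J. of_real (b r))" unfolding cf_def f0_def
          by (rule prod.cong[OF refl]) (use s in fastforce)
        thus ?thesis by (simp add: n_def)
      qed
      have \<xi>0: "\<xi> f0 = 1" by (simp add: \<xi>_def f0_def)
      have bound: "cmod (\<Sum>k\<in>K. \<xi> f ^ k) \<le> card K / real P" if f: "f \<in> F - {f0}" for f
      proof -
        have "of_nat N * (\<Sum>j\<in>J. (of_nat (f j) - of_nat r) * x j) = (\<Sum>j\<in>J. (of_nat (f j) - of_nat r) * (of_nat N * x j))"
          by (simp add: sum_distrib_left mult_ac)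
        also have "\<dots> \<in> \<int>" by (intro Ints_sum Ints_mult Ints_diff Nx) auto
        finally have "\<xi> f ^ N = 1" by (simp add: \<xi>_def qexp_power qexp_eq_1_iff)
        moreover have "\<xi> f ^ (Q * fact P) \<noteq> 1" 
          unfolding \<xi>_def qexp_power qexp_eq_1_iff by (rule nocong[OF f])
        ultimately have "real P * cmod (\<Sum>k\<in>K. \<xi> f ^ k) \<le> card K"
          unfolding K_def by (intro sum_powers_units_in_class_bound N)
        thus ?thesis using P0 by (simp add: field_simps)
      qed
      define T where "T = (\<Sum>f\<in>F - {f0}. cf f * (\<Sum>k\<in>K. \<xi> f ^ k))"
      have "complex_of_real (\<Sum>k\<in>K. W k) = (\<Sum>f\<in>F. cf f * (\<Sum>k\<in>K. \<xi> f ^ k))"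
        unfolding of_real_sum Wexp by (subst sum.swap) (simp add: sum_distrib_left)
      also have "\<dots> = cf f0 * (\<Sum>k\<in>K. \<xi> f0 ^ k) + T"
        unfolding T_def using finF f0F by (rule sum.remove)
      also have "cf f0 * (\<Sum>k\<in>K. \<xi> f0 ^ k) = of_real (b r ^ n * card K)" by (simp add: cf0 \<xi>0)
      finally have eq: "T = complex_of_real ((\<Sum>k\<in>K. W k) - b r ^ n * card K)" by simp
      have "cmod T \<le> (\<Sum>f\<in>F - {f0}. cmod (cf f) * (card K / real P))"
        unfolding T_def
      proof (rule sum_norm_le)
        fix f assume f: "f \<in> F - {f0}"
        show "cmod (cf f * (\<Sum>k\<in>K. \<xi> f ^ k)) \<le> cmod (cf f) * (card K / real P)"
          unfolding norm_mult by (rule mult_left_mono[OF bound[OF f]]) simp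
      qed
      also have "\<dots> \<le> (\<Sum>f\<in>F. cmod (cf f) * (card K / real P))"
        by (rule sum_mono2) (use finF in auto)
      also have "\<dots> = card K / real P" by (simp only: sum_cf mult_1 flip: sum_distrib_right)
      finally have "\<bar>(\<Sum>k\<in>K. W k) - b r ^ n * card K\<bar> \<le> card K / real P" by (simp only: eq norm_of_real)
      hence "b r ^ n * card K \<le> (\<Sum>k\<in>K. W k) + card K / real P" by linarith
      also have "(\<Sum>k\<in>K. W k) \<le> (\<Sum>k\<in>K. q ^ r)" by (intro sum_mono W_le)
      finally have "real (card K) * b r ^ n \<le> real (card K) * (q ^ r + 1 / real P)" by (simp add: algebra_simps)
      hence "b r ^ n \<le> q ^ r + 1 / real P" using K0 by simp
      thus False using r bP by (simp add: b_def)
    qed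
  qed
qed

subsection \<open>Families of torsion points\<close>

text \<open>Exponents of a torsion coset: coordinate \<open>l\<close> is the monomial with
  coefficient \<open>qexp (c l)\<close> and exponents \<open>A l j\<close> in the parameters
  \<open>qexp (x j)\<close>. The later induction is on the number of parameters.\<close>

definition affine_point :: "(nat \<Rightarrow> rat) \<Rightarrow> (nat \<Rightarrow> nat \<Rightarrow> int) \<Rightarrow> nat set \<Rightarrow> (nat \<Rightarrow> rat) \<Rightarrow> nat \<Rightarrow> rat" where
  "affine_point c A J x l = c l + (\<Sum>j\<in>J. of_int (A l j) * x j)"

definition torsion_sum :: "nat \<Rightarrow> (nat \<Rightarrow> rat) \<Rightarrow> complex" where
  "torsion_sum L y = (\<Sum>l<L. qexp (y l))"

definition torsion_family :: "nat \<Rightarrow> (nat \<Rightarrow> rat) \<times> (nat \<Rightarrow> nat \<Rightarrow> int) \<times> nat set \<Rightarrow> complex set" where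
  "torsion_family L = (\<lambda>(c, A, J). range (\<lambda>x. torsion_sum L (affine_point c A J x)))"

definition torsion_union :: "nat \<Rightarrow> complex set \<Rightarrow> bool" where
  "torsion_union L V \<longleftrightarrow> (\<exists>S. finite S \<and> (\<forall>(c, A, J)\<in>S. finite J) \<and> V = (\<Union>F\<in>S. torsion_family L F))"

lemma torsion_union_family: "finite J \<Longrightarrow> torsion_union L (torsion_family L (c, A, J))"
  unfolding torsion_union_def by (intro exI[of _ "{(c, A, J)}"]) auto

lemma torsion_union_UN:
  assumes "finite K" "\<And>k. k \<in> K \<Longrightarrow> torsion_union L (Y k)"
  shows "torsion_union L (\<Union>k\<in>K. Y k)"
  using assms
proof (induction K rule: finite_induct)
  case empty
  show ?case unfolding torsion_union_def by (intro exI[of _ "{}"]) auto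
next
  case (insert k K)
  have "torsion_union L (\<Union>k\<in>K. Y k)" using insert by blast
  then obtain S where S: "finite S" "\<forall>(c, A, J)\<in>S. finite J" "(\<Union>k\<in>K. Y k) = (\<Union>F\<in>S. torsion_family L F)"
    unfolding torsion_union_def by blast
  have "torsion_union L (Y k)" using insert by blast
  then obtain S' where S': "finite S'" "\<forall>(c, A, J)\<in>S'. finite J" "Y k = (\<Union>F\<in>S'. torsion_family L F)"
    unfolding torsion_union_def by blast
  have "(\<Union>k\<in>insert k K. Y k) = (\<Union>F\<in>S' \<union> S. torsion_family L F)"
    unfolding UN_insert UN_Un S(3)[symmetric] S'(3)[symmetric] by (rule refl)
  thus ?case unfolding torsion_union_def
    using S(1,2) S'(1,2) by (intro exI[of _ "S' \<union> S"]) auto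
qed

lemma norm_powi_diff:
  fixes z w :: complex
  assumes "cmod z = 1" "cmod w = 1"
  shows "cmod (z powi a - w powi a) \<le> real_of_int \<bar>a\<bar> * cmod (z - w)"
proof -
  have nat: "cmod (z ^ n - w ^ n) \<le> real n * cmod (z - w)" if "cmod z = 1" "cmod w = 1" for n and z w :: complex
    using norm_power_diff[of z w n] that by simp
  show ?thesis
  proof (cases "a \<ge> 0")
    case True
    thus ?thesis using nat[OF assms, of "nat a"] by (simp add: power_int_def)
  next
    case False
    have nz: "z \<noteq> 0" "w \<noteq> 0" using assms by auto
    have "inverse z - inverse w = - (inverse z * (z - w) * inverse w)"
      using nz by (simp add: field_simps)
    hence "cmod (inverse z - inverse w) = cmod (z - w)" using assms by (simp add: norm_mult norm_inverse)
    thus ?thesis using nat[of "inverse z" "inverse w" "nat (- a)"] assms False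
      by (simp add: power_int_def norm_inverse)
  qed
qed

lemma qexp_affine_point_power:
  "qexp (affine_point c A J x l) ^ k = qexp (c l) ^ k * (\<Prod>j\<in>J. (qexp (x j) ^ k) powi A l j)"
proof -
  have "of_nat k * affine_point c A J x l = of_nat k * c l + (\<Sum>j\<in>J. of_int (A l j) * (of_nat k * x j))"
    by (simp add: affine_point_def distrib_left sum_distrib_left mult_ac)
  thus ?thesis by (simp add: qexp_power qexp_add qexp_sum qexp_powi)
qed

lemma monomial_sum_near:
  fixes s :: "nat \<Rightarrow> complex" and a :: "nat \<Rightarrow> complex" and A :: "nat \<Rightarrow> nat \<Rightarrow> int"
  assumes "finite J" and s: "\<And>j. j \<in> J \<Longrightarrow> cmod (s j) = 1" and a: "\<And>l. l < L \<Longrightarrow> cmod (a l) = 1"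
    and gt: "(cmod (\<Sum>l<L. a l * (\<Prod>j\<in>J. s j powi A l j)))\<^sup>2 > C"
  obtains \<delta> where "\<delta> > 0" "\<And>z. (\<And>j. j \<in> J \<Longrightarrow> cmod (z j) = 1 \<and> cmod (z j - s j) < \<delta>) \<Longrightarrow>
    (cmod (\<Sum>l<L. a l * (\<Prod>j\<in>J. z j powi A l j)))\<^sup>2 > C"
proof -
  define G where "G z = (\<Sum>l<L. a l * (\<Prod>j\<in>J. z j powi A l j))" for z
  define B where "B = (\<Sum>l<L. \<Sum>j\<in>J. real_of_int \<bar>A l j\<bar>)"
  have B0: "B \<ge> 0" unfolding B_def by (intro sum_nonneg) auto
  have lip: "cmod (G z - G s) \<le> B * \<delta>"
    if z: "\<And>j. j \<in> J \<Longrightarrow> cmod (z j) = 1 \<and> cmod (z j - s j) < \<delta>" for z \<delta>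
  proof -
    have "G z - G s = (\<Sum>l<L. a l * ((\<Prod>j\<in>J. z j powi A l j) - (\<Prod>j\<in>J. s j powi A l j)))"
      by (simp add: G_def right_diff_distrib sum_subtractf)
    also have "cmod \<dots> \<le> (\<Sum>l<L. (\<Sum>j\<in>J. real_of_int \<bar>A l j\<bar>) * \<delta>)"
    proof (rule sum_norm_le)
      fix l assume l: "l \<in> {..<L}"
      have "cmod ((\<Prod>j\<in>J. z j powi A l j) - (\<Prod>j\<in>J. s j powi A l j)) \<le> (\<Sum>j\<in>J. cmod (z j powi A l j - s j powi A l j))"
        by (rule norm_prod_diff) (use z s in \<open>auto simp: norm_power_int\<close>)
      also have "\<dots> \<le> (\<Sum>j\<in>J. real_of_int \<bar>A l j\<bar> * \<delta>)"
      proof (rule sum_mono)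
        fix j assume j: "j \<in> J"
        have "cmod (z j powi A l j - s j powi A l j) \<le> real_of_int \<bar>A l j\<bar> * cmod (z j - s j)"
          by (rule norm_powi_diff) (use z s j in auto)
        also have "\<dots> \<le> real_of_int \<bar>A l j\<bar> * \<delta>" using z[OF j] by (intro mult_left_mono) auto
        finally show "cmod (z j powi A l j - s j powi A l j) \<le> real_of_int \<bar>A l j\<bar> * \<delta>" .
      qed
      finally show "cmod (a l * ((\<Prod>j\<in>J. z j powi A l j) - (\<Prod>j\<in>J. s j powi A l j))) \<le> (\<Sum>j\<in>J. real_of_int \<bar>A l j\<bar>) * \<delta>"
        using a l by (simp add: norm_mult sum_distrib_right)
    qed
    finally show ?thesis by (simp add: B_def sum_distrib_right)
  qed
  define R where "R = sqrt (max 0 C)"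
  have gap: "cmod (G s) > R" if "C \<ge> 0"
  proof -
    have "sqrt C < sqrt ((cmod (G s))\<^sup>2)" using gt by (subst real_sqrt_less_iff) (simp add: G_def)
    thus ?thesis using that by (simp add: R_def max_def)
  qed
  \<comment> \<open>\<open>B + 1\<close> instead of \<open>B\<close> keeps the quotient meaningful
    when all exponents are 0. For negative \<open>C\<close> every point exceeds the bound, and any
    positive \<delta> will do.\<close>
  define \<delta> where "\<delta> = (if C \<ge> 0 then (cmod (G s) - R) / (B + 1) else 1)"
  show ?thesis
  proof (rule that[of \<delta>])
    show "\<delta> > 0" using gap B0 by (auto simp: \<delta>_def)
    fix z assume z: "\<And>j. j \<in> J \<Longrightarrow> cmod (z j) = 1 \<and> cmod (z j - s j) < \<delta>"
    have "(cmod (G z))\<^sup>2 > C"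
    proof (cases "C \<ge> 0")
      case True
      have "B * \<delta> < (B + 1) * \<delta>" using \<open>\<delta> > 0\<close> by (intro mult_strict_right_mono) auto
      also have "\<dots> = cmod (G s) - R" using B0 True by (simp add: \<delta>_def)
      finally have "cmod (G z - G s) < cmod (G s) - R" using lip[OF z] by simp
      hence "R < cmod (G z)" using norm_triangle_ineq3[of "G z" "G s"] by linarith
      hence "R\<^sup>2 < (cmod (G z))\<^sup>2" by (intro power_strict_mono) (auto simp: R_def)
      thus ?thesis using True by (simp add: R_def)
    next
      case False
      have "0 \<le> (cmod (G z))\<^sup>2" by simp
      thus ?thesis using False by linarith
    qed
    thus "(cmod (\<Sum>l<L. a l * (\<Prod>j\<in>J. z j powi A l j)))\<^sup>2 > C" by (simp add: G_def)
  qed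
qed

text \<open>Divisibility of \<open>\<rat>\<close> allows one to solve the character equation without passing to a
  primitive vector.\<close>

lemma torsion_family_hyperplane:
  fixes m :: "nat \<Rightarrow> int"
  assumes "finite J" "i \<in> J" "m i \<noteq> 0"
  shows "\<exists>S. finite S \<and> (\<forall>(c', A', J')\<in>S. J' = J - {i}) \<and>
    {torsion_sum L (affine_point c A J x) | x. (\<Sum>j\<in>J. of_int (m j) * x j) \<in> \<int>} = (\<Union>F\<in>S. torsion_family L F)"
proof -
  \<comment> \<open>The equation \<Sum> m_j x_j = v is solved by x_j = m_i y_j for j \<noteq> i and
    x_i = v / m_i - \<Sum> m_j y_j; substituting this gives \<open>A'\<close> and \<open>c'\<close>,
    with integral exponents again.\<close>
  define A' where "A' l j = A l j * m i - A l i * m j" for l j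
  define c' where "c' v l = c l + of_int (A l i) * (of_int v / of_int (m i))" for v :: int and l
  define T where "T = (\<lambda>v. (c' v, A', J - {i})) ` {0..<\<bar>m i\<bar>}"
  define ext where "ext v y j = (if j = i then of_int v / of_int (m i) - (\<Sum>j\<in>J - {i}. of_int (m j) * y j)
      else of_int (m i) * y j)" for v :: int and y :: "nat \<Rightarrow> rat" and j
  have split: "(\<Sum>j\<in>J. f j) = f i + (\<Sum>j\<in>J - {i}. f j)" for f :: "nat \<Rightarrow> rat"
    using assms(1,2) by (rule sum.remove)
  have rest: "(\<Sum>j\<in>J - {i}. f j * ext v y j) = (\<Sum>j\<in>J - {i}. f j * (of_int (m i) * y j))" for f v y
    by (intro sum.cong refl) (auto simp: ext_def)
  have ext_eq: "affine_point c A J (ext v y) = affine_point (c' v) A' (J - {i}) y" for v y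
  proof
    fix l
    have "affine_point c A J (ext v y) l = c l + (of_int (A l i) * ext v y i + 
        (\<Sum>j\<in>J - {i}. of_int (A l j) * (of_int (m i) * y j)))"
      unfolding affine_point_def by (subst split, subst rest) (rule refl)
    also have "ext v y i = of_int v / of_int (m i) - (\<Sum>j\<in>J - {i}. of_int (m j) * y j)" by (simp add: ext_def)
    also have "c l + (of_int (A l i) * (of_int v / of_int (m i) - (\<Sum>j\<in>J - {i}. of_int (m j) * y j)) + 
        (\<Sum>j\<in>J - {i}. of_int (A l j) * (of_int (m i) * y j))) = affine_point (c' v) A' (J - {i}) y l"
      by (simp add: affine_point_def c'_def A'_def right_diff_distrib left_diff_distrib sum_subtractf sum_distrib_left mult_ac)
    finally show "affine_point c A J (ext v y) l = affine_point (c' v) A' (J - {i}) y l" .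
  qed
  have ext_int: "(\<Sum>j\<in>J. of_int (m j) * ext v y j) = of_int v" for v y
  proof -
    have "(\<Sum>j\<in>J. of_int (m j) * ext v y j) = of_int (m i) * ext v y i + (\<Sum>j\<in>J - {i}. of_int (m j) * (of_int (m i) * y j))"
      by (subst split, subst rest) (rule refl)
    thus ?thesis using assms(3) by (simp add: ext_def right_diff_distrib sum_distrib_left mult_ac)
  qed
  show ?thesis
  proof (intro exI[of _ T] conjI)
    show "finite T" by (simp add: T_def)
    show "\<forall>(c', A', J')\<in>T. J' = J - {i}" by (auto simp: T_def)
    show "{torsion_sum L (affine_point c A J x) | x. (\<Sum>j\<in>J. of_int (m j) * x j) \<in> \<int>} = (\<Union>F\<in>T. torsion_family L F)"
    proof (intro equalityI subsetI)
      fix \<alpha> assume "\<alpha> \<in> {torsion_sum L (affine_point c A J x) | x. (\<Sum>j\<in>J. of_int (m j) * x j) \<in> \<int>}"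
      then obtain x v where x: "\<alpha> = torsion_sum L (affine_point c A J x)" "(\<Sum>j\<in>J. of_int (m j) * x j) = of_int v"
        by (auto elim!: Ints_cases)
      \<comment> \<open>Only \<open>v\<close> modulo \<open>m i\<close> matters: adding a multiple
        of \<open>m i\<close> to \<open>v\<close> shifts \<open>x i\<close> by an integer, which
        \<open>qexp\<close> does not see. So finitely many families suffice.\<close>
      define v0 where "v0 = v mod \<bar>m i\<bar>"
      define w where "w = sgn (m i) * (v div \<bar>m i\<bar>)"
      have v: "v = v0 + m i * w"
      proof -
        have "v = \<bar>m i\<bar> * (v div \<bar>m i\<bar>) + v0" by (simp add: v0_def)
        also have "\<bar>m i\<bar> * (v div \<bar>m i\<bar>) = m i * w"
          unfolding w_def mult.assoc[symmetric] by (simp only: abs_sgn[symmetric])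
        finally show ?thesis by simp
      qed
      have v0: "v0 \<in> {0..<\<bar>m i\<bar>}" using assms(3) by (simp add: v0_def)
      define y where "y j = x j / of_int (m i)" for j
      have xj: "x j = ext v0 y j + (if j = i then of_int w else 0)" if "j \<in> J" for j
      proof (cases "j = i")
        case True
        have "of_int (m i) * x i + (\<Sum>j\<in>J - {i}. of_int (m j) * x j) = of_int v"
          using x(2) split[of "\<lambda>j. of_int (m j) * x j"] by simp
        moreover have "(\<Sum>j\<in>J - {i}. of_int (m j) * x j) = of_int (m i) * (\<Sum>j\<in>J - {i}. of_int (m j) * y j)"
          using assms(3) by (simp add: y_def sum_distrib_left)
        ultimately have key: "of_int (m i) * (x i + (\<Sum>j\<in>J - {i}. of_int (m j) * y j)) = of_int v0 + of_int (m i) * of_int w"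
          unfolding v by (simp add: distrib_left)
        have solve: "b = v / a + d" if "a * b = v + a * d" "a \<noteq> 0" for a b v d :: rat
        proof -
          have "b = (v + a * d) / a" using that by (metis nonzero_mult_div_cancel_left)
          thus ?thesis using that(2) by (simp add: add_divide_distrib)
        qed
        have "x i + (\<Sum>j\<in>J - {i}. of_int (m j) * y j) = of_int v0 / of_int (m i) + of_int w"
          by (rule solve[OF key]) (use assms(3) in simp)
        thus ?thesis using True by (simp add: ext_def)
      next
        case False
        thus ?thesis using assms(3) by (simp add: ext_def y_def)
      qed
      have "qexp (affine_point c A J x l) = qexp (affine_point (c' v0) A' (J - {i}) y l)" for l
      proof -
        have "affine_point c A J x l = affine_point c A J (ext v0 y) l + of_int (A l i * w)"
        proof -
          have "(\<Sum>j\<in>J. of_int (A l j) * x j) = (\<Sum>j\<in>J. of_int (A l j) * ext v0 y j + (if j = i then of_int (A l i * w) else 0))"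
            by (intro sum.cong refl) (auto simp: xj distrib_left)
          thus ?thesis using assms(1,2) by (simp add: affine_point_def sum.distrib)
        qed
        moreover have "qexp (of_int (A l i * w)) = 1" by (subst qexp_eq_1_iff) (rule Ints_of_int)
        ultimately show ?thesis by (simp only: qexp_add ext_eq mult_1_right)
      qed
      hence "\<alpha> = torsion_sum L (affine_point (c' v0) A' (J - {i}) y)" by (simp add: x(1) torsion_sum_def)
      thus "\<alpha> \<in> (\<Union>F\<in>T. torsion_family L F)" using v0 by (force simp: T_def torsion_family_def)
    next
      fix \<alpha> assume "\<alpha> \<in> (\<Union>F\<in>T. torsion_family L F)"
      then obtain v y where "\<alpha> = torsion_sum L (affine_point (c' v) A' (J - {i}) y)"
        by (auto simp: T_def torsion_family_def)
      hence "\<alpha> = torsion_sum L (affine_point c A J (ext v y))" by (simp only: ext_eq)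
      thus "\<alpha> \<in> {torsion_sum L (affine_point c A J x) | x. (\<Sum>j\<in>J. of_int (m j) * x j) \<in> \<int>}"
        using ext_int[of v y] by fastforce
    qed
  qed
qed

text \<open>\<open>P\<close> stands for the bound on the castle; all that matters is its description
  by powers \<open>qexp (y l) ^ k\<close> for any common denominator \<open>N\<close>. There is no
  separate base case: with \<open>J\<close> empty no nontrivial character exists, so a family with
  one bad point contributes nothing.\<close>

theorem torsion_family_bounded_conjugates:
  fixes P :: "complex \<Rightarrow> bool"
  assumes P: "\<And>y N. N > 0 \<Longrightarrow> (\<And>l. l < L \<Longrightarrow> of_nat N * y l \<in> \<int>) \<Longrightarrow>
      P (torsion_sum L y) \<longleftrightarrow> (\<forall>k. coprime k N \<longrightarrow> (cmod (\<Sum>l<L. qexp (y l) ^ k))\<^sup>2 \<le> C)"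
    and "finite J"
  shows "torsion_union L {\<alpha> \<in> torsion_family L (c, A, J). P \<alpha>}"
  using assms(2)
proof (induction "card J" arbitrary: c A J rule: less_induct)
  case less
  show ?case
  proof (cases "\<forall>\<alpha>\<in>torsion_family L (c, A, J). P \<alpha>")
    case True
    hence "{\<alpha> \<in> torsion_family L (c, A, J). P \<alpha>} = torsion_family L (c, A, J)" by blast
    thus ?thesis using torsion_union_family[OF less.prems] by simp
  next
    case False
    then obtain x0 where x0: "\<not> P (torsion_sum L (affine_point c A J x0))" by (auto simp: torsion_family_def)
    obtain Q1 where Q1: "Q1 > 0" "\<And>l. l \<in> {..<L} \<Longrightarrow> of_nat Q1 * c l \<in> \<int>"
      using common_denominator[of "{..<L}" c] by blast
    obtain Q2 where Q2: "Q2 > 0" "\<And>j. j \<in> J \<Longrightarrow> of_nat Q2 * x0 j \<in> \<int>"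
      using common_denominator[OF less.prems, of x0] by blast
    have affine_int: "of_nat N * affine_point c A J x l \<in> \<int>"
      if "Q1 dvd N" "\<And>j. j \<in> J \<Longrightarrow> of_nat N * x j \<in> \<int>" "l < L" for N x l
    proof -
      have "of_nat N * affine_point c A J x l = of_nat N * c l + (\<Sum>j\<in>J. of_int (A l j) * (of_nat N * x j))"
        by (simp add: affine_point_def distrib_left sum_distrib_left mult_ac)
      moreover obtain N' where "N = Q1 * N'" using \<open>Q1 dvd N\<close> by (elim dvdE)
      hence N': "of_nat N * c l = of_nat N' * (of_nat Q1 * c l)" by simp
      have "of_nat N * c l \<in> \<int>" unfolding N' by (rule Ints_mult[OF Ints_of_nat Q1(2)]) (use that(3) in simp)
      moreover have "(\<Sum>j\<in>J. of_int (A l j) * (of_nat N * x j)) \<in> \<int>"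
        by (intro Ints_sum Ints_mult[OF Ints_of_int] that(2))
      ultimately show ?thesis by simp
    qed
    \<comment> \<open>\<open>Q1\<close> makes the powers of the constants \<open>qexp (c l)\<close>
      depend only on the exponent modulo \<open>Q\<close>; \<open>Q2\<close> makes the bad point
      \<open>x0\<close> visible at level \<open>Q\<close>, so that the violating exponent
      \<open>u\<close> is a unit modulo \<open>Q\<close>.\<close>
    define Q where "Q = Q1 * Q2"
    have Q: "Q > 0" "Q1 dvd Q" using Q1 Q2 by (auto simp: Q_def)
    have Qx0: "of_nat Q * x0 j \<in> \<int>" if "j \<in> J" for j
      using Ints_mult[OF Ints_of_nat[of Q1] Q2(2)[OF that]] by (simp add: Q_def mult.assoc)
    from x0 P[of Q "affine_point c A J x0"] Q affine_int[OF Q(2) Qx0]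
    obtain u where u: "coprime u Q" "(cmod (\<Sum>l<L. qexp (affine_point c A J x0 l) ^ u))\<^sup>2 > C"
      by (auto simp: not_le)
    define s where "s j = qexp (x0 j) ^ u" for j
    have "(cmod (\<Sum>l<L. qexp (c l) ^ u * (\<Prod>j\<in>J. s j powi A l j)))\<^sup>2 > C"
      using u(2) by (simp add: qexp_affine_point_power s_def)
    from monomial_sum_near[OF less.prems _ _ this] obtain \<delta> where \<delta>: "\<delta> > 0"
      "\<And>z. (\<And>j. j \<in> J \<Longrightarrow> cmod (z j) = 1 \<and> cmod (z j - s j) < \<delta>) \<Longrightarrow>
       (cmod (\<Sum>l<L. qexp (c l) ^ u * (\<Prod>j\<in>J. z j powi A l j)))\<^sup>2 > C"
      by (auto simp: s_def norm_power)
    have norm_s: "cmod (s j) = 1" for j by (simp add: s_def norm_power)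
    obtain r D :: nat where D: "D > 0"
      and dense: "\<forall>(x :: nat \<Rightarrow> rat) N u. N > 0 \<longrightarrow> Q dvd N \<longrightarrow> coprime u Q \<longrightarrow> (\<forall>j\<in>J. of_nat N * x j \<in> \<int>) \<longrightarrow>
      (\<exists>f \<in> J \<rightarrow>\<^sub>E {..2 * r}. (\<exists>j\<in>J. f j \<noteq> r) \<and> of_nat D * (\<Sum>j\<in>J. (of_nat (f j) - of_nat r) * x j) \<in> \<int>) \<or>
      (\<exists>k. coprime k N \<and> [k = u] (mod Q) \<and> (\<forall>j\<in>J. cmod (qexp (x j) ^ k - s j) < \<delta>))"
      using torsion_point_conjugate_dense[OF less.prems \<delta>(1) Q(1), of s, OF norm_s]
      by (elim exE conjE) (rule that)
    define F where "F = {f \<in> J \<rightarrow>\<^sub>E {..2 * r}. \<exists>j\<in>J. f j \<noteq> r}"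
    have "finite (J \<rightarrow>\<^sub>E {..2 * r})" using less.prems by (intro finite_PiE) auto
    hence finF: "finite F" by (rule rev_finite_subset) (auto simp: F_def)
    define m where "m f j = int D * (int (f j) - int r)" for f :: "nat \<Rightarrow> nat" and j
    define H where "H f = {torsion_sum L (affine_point c A J x) | x. (\<Sum>j\<in>J. of_int (m f j) * x j) \<in> \<int>}" for f
    have H: "H f \<subseteq> torsion_family L (c, A, J)" for f by (auto simp: H_def torsion_family_def)
    have cover: "\<exists>f\<in>F. \<alpha> \<in> H f" if \<alpha>: "\<alpha> \<in> torsion_family L (c, A, J)" "P \<alpha>" for \<alpha>
    proof -
      obtain x where x: "\<alpha> = torsion_sum L (affine_point c A J x)" using \<alpha>(1) by (auto simp: torsion_family_def)
      obtain N0 where N0: "N0 > 0" "\<And>j. j \<in> J \<Longrightarrow> of_nat N0 * x j \<in> \<int>"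
        using common_denominator[OF less.prems, of x] by blast
      define N where "N = Q * N0"
      have N: "N > 0" "Q dvd N" "Q1 dvd N" using Q N0 by (auto simp: N_def)
      have Nx: "of_nat N * x j \<in> \<int>" if "j \<in> J" for j
        using Ints_mult[OF Ints_of_nat[of Q] N0(2)[OF that]] by (simp add: N_def mult.assoc)
      have conj_le: "(cmod (\<Sum>l<L. qexp (affine_point c A J x l) ^ k))\<^sup>2 \<le> C" if "coprime k N" for k
        using P[OF N(1), of "affine_point c A J x"] affine_int[OF N(3) Nx] \<alpha>(2) that x by simp
      have "\<not> (\<exists>k. coprime k N \<and> [k = u] (mod Q) \<and> (\<forall>j\<in>J. cmod (qexp (x j) ^ k - s j) < \<delta>))"
      proof
        assume "\<exists>k. coprime k N \<and> [k = u] (mod Q) \<and> (\<forall>j\<in>J. cmod (qexp (x j) ^ k - s j) < \<delta>)"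
        then obtain k where k: "coprime k N" "[k = u] (mod Q)" "\<And>j. j \<in> J \<Longrightarrow> cmod (qexp (x j) ^ k - s j) < \<delta>" by blast
        have "(cmod (\<Sum>l<L. qexp (c l) ^ u * (\<Prod>j\<in>J. (qexp (x j) ^ k) powi A l j)))\<^sup>2 > C"
          by (rule \<delta>(2)) (use k(3) in \<open>auto simp: norm_power\<close>)
        moreover have "qexp (c l) ^ u = qexp (c l) ^ k" if "l < L" for l
        proof -
          have "of_nat Q * c l \<in> \<int>"
            using Ints_mult[OF Ints_of_nat[of Q2] Q1(2)[of l]] that by (simp add: Q_def mult_ac)
          hence one: "qexp (c l) ^ Q = 1" by (simp add: qexp_power qexp_eq_1_iff)
          have "qexp (c l) ^ i = qexp (c l) ^ (i mod Q)" for i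
          proof -
            have "qexp (c l) ^ i = qexp (c l) ^ (Q * (i div Q) + i mod Q)" by simp
            also have "\<dots> = qexp (c l) ^ (i mod Q)" by (simp only: power_add power_mult one power_one mult_1)
            finally show ?thesis .
          qed
          thus ?thesis using k(2) unfolding cong_def by metis
        qed
        ultimately have "(cmod (\<Sum>l<L. qexp (affine_point c A J x l) ^ k))\<^sup>2 > C"
          by (simp add: qexp_affine_point_power)
        thus False using conj_le[OF k(1)] by simp
      qed
      moreover have "\<forall>j\<in>J. of_nat N * x j \<in> \<int>" using Nx by blast
      note dense[THEN spec[of _ x], THEN spec[of _ N], THEN spec[of _ u], THEN mp, THEN mp, THEN mp, THEN mp, OF N(1,2) u(1) this]
      ultimately obtain f where f: "f \<in> J \<rightarrow>\<^sub>E {..2 * r}" "\<exists>j\<in>J. f j \<noteq> r"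
        "of_nat D * (\<Sum>j\<in>J. (of_nat (f j) - of_nat r) * x j) \<in> \<int>" by blast
      have "of_nat D * (\<Sum>j\<in>J. (of_nat (f j) - of_nat r) * x j) = (\<Sum>j\<in>J. of_int (m f j) * x j)"
        by (simp add: m_def sum_distrib_left mult_ac)
      hence "\<alpha> \<in> H f" using f(3) x unfolding H_def by auto
      thus ?thesis using f(1,2) by (auto simp: F_def)
    qed
    have "torsion_union L {\<alpha> \<in> H f. P \<alpha>}" if f: "f \<in> F" for f
    proof -
      obtain i where i: "i \<in> J" "f i \<noteq> r" using f by (auto simp: F_def)
      hence mi: "m f i \<noteq> 0" using D by (simp add: m_def)
      obtain S where S: "finite S" "\<forall>(c', A', J')\<in>S. J' = J - {i}" "H f = (\<Union>F\<in>S. torsion_family L F)"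
        using torsion_family_hyperplane[where m = "m f" and i = i and J = J and L = L and c = c and A = A,
            OF less.prems i(1) mi, folded H_def] by (elim exE conjE) (rule that)
      have cd: "card (J - {i}) < card J" using less.prems i(1) by (rule card_Diff1_less)
      have "torsion_union L {\<alpha> \<in> torsion_family L F. P \<alpha>}" if F: "F \<in> S" for F
      proof -
        obtain c' A' J' where F_eq: "F = (c', A', J')" by (cases F)
        hence "J' = J - {i}" using S(2) F by blast
        thus ?thesis using less.hyps[of J' c' A'] cd less.prems F_eq by simp
      qed
      hence "torsion_union L (\<Union>F\<in>S. {\<alpha> \<in> torsion_family L F. P \<alpha>})" by (rule torsion_union_UN[OF S(1)])
      also have "(\<Union>F\<in>S. {\<alpha> \<in> torsion_family L F. P \<alpha>}) = {\<alpha> \<in> H f. P \<alpha>}" unfolding S(3) by blast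
      finally show ?thesis .
    qed
    hence "torsion_union L (\<Union>f\<in>F. {\<alpha> \<in> H f. P \<alpha>})" by (rule torsion_union_UN[OF finF])
    also have "(\<Union>f\<in>F. {\<alpha> \<in> H f. P \<alpha>}) = {\<alpha> \<in> torsion_family L (c, A, J). P \<alpha>}" using cover H by blast
    finally show ?thesis .
  qed
qed

subsection \<open>The house of a sum of roots of unity\<close>

lemma torsion_sum_as_ipoly:
  assumes "N > 0" "\<And>l. l < L \<Longrightarrow> of_nat N * y l \<in> \<int>"
  shows "\<exists>f. torsion_sum L y = ipoly f (zeta N) \<and> (\<forall>k. ipoly f (zeta N ^ k) = (\<Sum>l<L. qexp (y l) ^ k))"
proof -
  have "\<exists>a. qexp (y l) = zeta N ^ a" if "l < L" for l
  proof -
    have "qexp (y l) ^ N = 1" using assms(2)[OF that] by (simp add: qexp_power qexp_eq_1_iff)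
    thus ?thesis using root_of_unity_eq_zeta_power[OF assms(1)] by metis
  qed
  then obtain a where a: "\<And>l. l < L \<Longrightarrow> qexp (y l) = zeta N ^ a l" by metis
  define f :: "int poly" where "f = (\<Sum>l<L. monom 1 (a l))"
  have f: "ipoly f (zeta N ^ k) = (\<Sum>l<L. qexp (y l) ^ k)" for k
    unfolding f_def ipoly_sum by (intro sum.cong refl) (simp add: a mult.commute flip: power_mult)
  moreover have "torsion_sum L y = ipoly f (zeta N)" using f[of 1] by (simp add: torsion_sum_def)
  ultimately show ?thesis by (intro exI[of _ f] conjI allI)
qed

lemma house_torsion_sum_le_iff:
  assumes "N > 0" "\<And>l. l < L \<Longrightarrow> of_nat N * y l \<in> \<int>"
  shows "(house (torsion_sum L y))\<^sup>2 \<le> C \<longleftrightarrow> (\<forall>k. coprime k N \<longrightarrow> (cmod (\<Sum>l<L. qexp (y l) ^ k))\<^sup>2 \<le> C)"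
proof -
  have "\<exists>f. torsion_sum L y = ipoly f (zeta N) \<and> (\<forall>k. ipoly f (zeta N ^ k) = (\<Sum>l<L. qexp (y l) ^ k))"
    using assms by (rule torsion_sum_as_ipoly)
  then obtain f where f: "torsion_sum L y = ipoly f (zeta N)" "\<forall>k. ipoly f (zeta N ^ k) = (\<Sum>l<L. qexp (y l) ^ k)"
    by (elim exE conjE) (rule that)
  have "(\<forall>k\<in>units_below N. (cmod (ipoly f (zeta N ^ k)))\<^sup>2 \<le> C) \<longleftrightarrow>
      (\<forall>k. coprime k N \<longrightarrow> (cmod (ipoly f (zeta N ^ k)))\<^sup>2 \<le> C)"
  proof (intro iffI allI impI ballI)
    fix k assume *: "\<forall>k\<in>units_below N. (cmod (ipoly f (zeta N ^ k)))\<^sup>2 \<le> C" "coprime k N"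
    hence "(cmod (ipoly f (zeta N ^ (k mod N))))\<^sup>2 \<le> C" using mod_in_units_below[OF assms(1)] by blast
    thus "(cmod (ipoly f (zeta N ^ k)))\<^sup>2 \<le> C" by (simp only: zeta_power_mod)
  qed (auto simp: units_below_def)
  thus ?thesis using house_ipoly_zeta_le_iff[OF assms(1), of f C] by (simp only: f(1) f(2)[rule_format])
qed

lemma torsion_sum_in_cyclotomic_integers: "torsion_sum L y \<in> cyclotomic_integers"
proof -
  obtain N where N: "N > 0" "\<And>l. l \<in> {..<L} \<Longrightarrow> of_nat N * y l \<in> \<int>"
    using common_denominator[of "{..<L}" y] by blast
  obtain f where "torsion_sum L y = ipoly f (zeta N)"
    using torsion_sum_as_ipoly[OF N(1), of L y] N(2) by blast
  thus ?thesis using zeta_ring_subset_cyclotomic_integers[OF N(1)] zeta_ringI by metis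
qed

lemma cyclotomic_integers_add:
  assumes "x \<in> cyclotomic_integers" "y \<in> cyclotomic_integers"
  shows "x + y \<in> cyclotomic_integers"
proof -
  obtain M where M: "M > 0" "x \<in> zeta_ring M" using cyclotomic_integers_cases[OF assms(1)] .
  obtain N where N: "N > 0" "y \<in> zeta_ring N" using cyclotomic_integers_cases[OF assms(2)] .
  have "x \<in> zeta_ring (N * M)" using zeta_ring_mono[OF N(1) M(2)] .
  moreover have "y \<in> zeta_ring (N * M)" using zeta_ring_mono[OF M(1) N(2)] by (simp add: mult.commute)
  ultimately show ?thesis using zeta_ring_subset_cyclotomic_integers[of "N * M"] M(1) N(1) by auto
qed

lemma qexp_in_cyclotomic_integers: "qexp x \<in> cyclotomic_integers"
  using torsion_sum_in_cyclotomic_integers[of 1 "\<lambda>_. x"] by (simp add: torsion_sum_def)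

lemma cyclotomic_integers_0: "0 \<in> cyclotomic_integers"
  using torsion_sum_in_cyclotomic_integers[of 0 "\<lambda>_. 0"] by (simp add: torsion_sum_def)

lemma cyclotomic_integers_sum: "(\<And>i. i \<in> A \<Longrightarrow> f i \<in> cyclotomic_integers) \<Longrightarrow> sum f A \<in> cyclotomic_integers"
  by (induction A rule: infinite_finite_induct) (auto simp: cyclotomic_integers_0 cyclotomic_integers_add)

text \<open>Each conjugate is only multiplied by a root of unity. This freedom is what makes
  nonnegative exponents possible in the final polynomials.\<close>

lemma house_torsion_sum_rotate:
  assumes "(house (torsion_sum L y))\<^sup>2 \<le> C"
  shows "(house (qexp t * torsion_sum L y))\<^sup>2 \<le> C"
proof -
  obtain N1 where N1: "N1 > 0" "\<And>l. l \<in> {..<L} \<Longrightarrow> of_nat N1 * y l \<in> \<int>"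
    using common_denominator[of "{..<L}" y] by blast
  obtain N2 where N2: "N2 > 0" "of_nat N2 * t \<in> \<int>"
    using common_denominator[of "{0 :: nat}" "\<lambda>_. t"] by blast
  define N where "N = N1 * N2"
  have N: "N > 0" using N1 N2 by (simp add: N_def)
  have Ny: "of_nat N * y l \<in> \<int>" if "l < L" for l
    using Ints_mult[OF Ints_of_nat[of N2] N1(2)[of l]] that by (simp add: N_def mult_ac)
  have Nt: "of_nat N * t \<in> \<int>" using Ints_mult[OF Ints_of_nat[of N1] N2(2)] by (simp add: N_def mult_ac)
  have "(\<Sum>l<L. qexp (t + y l) ^ k) = qexp t ^ k * (\<Sum>l<L. qexp (y l) ^ k)" for k
    by (simp add: qexp_add power_mult_distrib sum_distrib_left)
  hence norm_eq: "cmod (\<Sum>l<L. qexp (t + y l) ^ k) = cmod (\<Sum>l<L. qexp (y l) ^ k)" for k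
    by (simp add: norm_mult norm_power)
  have eq: "qexp t * torsion_sum L y = torsion_sum L (\<lambda>l. t + y l)"
    by (simp add: torsion_sum_def qexp_add sum_distrib_left)
  have "of_nat N * (t + y l) \<in> \<int>" if "l < L" for l
    using Ints_add[OF Nt Ny[OF that]] by (simp add: distrib_left)
  hence "(house (torsion_sum L (\<lambda>l. t + y l)))\<^sup>2 \<le> C \<longleftrightarrow> (house (torsion_sum L y))\<^sup>2 \<le> C"
    using house_torsion_sum_le_iff[OF N, of L y C] house_torsion_sum_le_iff[OF N, of L "\<lambda>l. t + y l" C] Ny
    by (simp add: norm_eq)
  thus ?thesis using assms by (simp add: eq)
qed

lemma small_castle_root_sum:
  obtains L where "\<And>\<alpha>. \<alpha> \<in> cyclotomic_integers \<Longrightarrow> (house \<alpha>)\<^sup>2 \<le> C \<Longrightarrow> \<alpha> \<in> root_sums L"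
proof -
  \<comment> \<open>A castle of at most \<open>C\<close> bounds the mean by \<open>C\<close>, and
    the descent counts twice the mean.\<close>
  define m where "m = nat \<lceil>2 * C\<rceil>"
  have m: "C \<le> real m / 2" unfolding m_def by linarith
  obtain L where L: "\<And>N f. N > 0 \<Longrightarrow> conj_sq_sum N f \<le> real m / 2 * card (units_below N) \<Longrightarrow> ipoly f (zeta N) \<in> root_sums L"
    using root_sums_bounded_mean[of m] by blast
  show ?thesis
  proof (rule that[of L])
    fix \<alpha> assume \<alpha>: "\<alpha> \<in> cyclotomic_integers" "(house \<alpha>)\<^sup>2 \<le> C"
    obtain N where N: "N > 0" "\<alpha> \<in> zeta_ring N" using cyclotomic_integers_cases[OF \<alpha>(1)] .
    then obtain f where f: "\<alpha> = ipoly f (zeta N)" by (elim zeta_ringE)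
    have "conj_sq_sum N f \<le> (\<Sum>k\<in>units_below N. real m / 2)"
      unfolding conj_sq_sum_def using \<alpha>(2) m
      by (intro sum_mono) (force simp: f house_ipoly_zeta_le_iff[OF N(1)])
    thus "\<alpha> \<in> root_sums L" using L[OF N(1), of f] by (simp add: f mult.commute)
  qed
qed

lemma small_castle_torsion_families:
  "\<exists>T. finite T \<and> (\<forall>(l, c, A, J)\<in>T. finite J) \<and>
    {\<alpha> \<in> cyclotomic_integers. (house \<alpha>)\<^sup>2 \<le> C} = (\<Union>(l, F)\<in>T. torsion_family l F)"
proof -
  obtain L where L: "\<And>\<alpha>. \<alpha> \<in> cyclotomic_integers \<Longrightarrow> (house \<alpha>)\<^sup>2 \<le> C \<Longrightarrow> \<alpha> \<in> root_sums L"
    using small_castle_root_sum by blast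
  \<comment> \<open>With the identity matrix and no constants, \<open>V l\<close> consists of all
    sums of \<open>l\<close> roots of unity.\<close>
  define A where "A i j = (if i = j then 1 else 0 :: int)" for i j :: nat
  define V where "V l = torsion_family l ((\<lambda>_. 0), A, {..<l})" for l
  have V: "torsion_sum l y \<in> V l" for l y
  proof -
    have "affine_point (\<lambda>_. 0) A {..<l} y i = y i" if "i < l" for i
    proof -
      have "(\<Sum>j<l. of_int (A i j) * y j) = (\<Sum>j<l. if i = j then y j else 0)"
        by (intro sum.cong refl) (auto simp: A_def)
      thus ?thesis using that by (simp add: affine_point_def)
    qed
    hence "torsion_sum l y = torsion_sum l (affine_point (\<lambda>_. 0) A {..<l} y)" by (simp add: torsion_sum_def)
    thus ?thesis by (auto simp: V_def torsion_family_def)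
  qed
  have "torsion_union l {\<alpha> \<in> V l. (house \<alpha>)\<^sup>2 \<le> C}" for l
    unfolding V_def
  proof (rule torsion_family_bounded_conjugates[where P = "\<lambda>\<alpha>. (house \<alpha>)\<^sup>2 \<le> C" and C = C])
    show "(house (torsion_sum l y))\<^sup>2 \<le> C \<longleftrightarrow> (\<forall>k. coprime k N \<longrightarrow> (cmod (\<Sum>i<l. qexp (y i) ^ k))\<^sup>2 \<le> C)"
      if "N > 0" "\<And>i. i < l \<Longrightarrow> of_nat N * y i \<in> \<int>" for y N
      using that by (rule house_torsion_sum_le_iff)
  qed simp
  hence "\<forall>l. \<exists>S. finite S \<and> (\<forall>(c, A, J)\<in>S. finite J) \<and> {\<alpha> \<in> V l. (house \<alpha>)\<^sup>2 \<le> C} = (\<Union>F\<in>S. torsion_family l F)"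
    unfolding torsion_union_def by (rule allI)
  from choice[OF this] obtain S where S': "\<forall>l. finite (S l) \<and> (\<forall>(c, A, J)\<in>S l. finite J) \<and>
      {\<alpha> \<in> V l. (house \<alpha>)\<^sup>2 \<le> C} = (\<Union>F\<in>S l. torsion_family l F)" by (elim exE) (rule that)
  note S = spec[OF S', THEN conjunct1] spec[OF S', THEN conjunct2, THEN conjunct1]
    spec[OF S', THEN conjunct2, THEN conjunct2]
  define T where "T = (SIGMA l:{..L}. S l)"
  show ?thesis
  proof (intro exI[of _ T] conjI)
    show "finite T" unfolding T_def by (intro finite_SigmaI S(1)) simp
    show "\<forall>(l, c, A, J)\<in>T. finite J"
    proof clarify
      fix l c A J assume "(l, c, A, J) \<in> T"
      hence "(c, A, J) \<in> S l" by (simp add: T_def)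
      thus "finite J" using S(2)[of l] by blast
    qed
    have "{\<alpha> \<in> cyclotomic_integers. (house \<alpha>)\<^sup>2 \<le> C} = (\<Union>l\<in>{..L}. {\<alpha> \<in> V l. (house \<alpha>)\<^sup>2 \<le> C})"
    proof (intro equalityI subsetI)
      fix \<alpha> assume \<alpha>: "\<alpha> \<in> {\<alpha> \<in> cyclotomic_integers. (house \<alpha>)\<^sup>2 \<le> C}"
      then obtain xs where xs: "\<alpha> = sum_list xs" "set xs \<subseteq> roots_of_unity" "length xs \<le> L"
        using L by (auto simp: root_sums_def)
      have "\<exists>y. xs ! i = qexp y" if "i < length xs" for i
        using xs(2) that nth_mem[OF that] unfolding roots_of_unity_eq_range_qexp by blast
      then obtain y where y: "\<And>i. i < length xs \<Longrightarrow> xs ! i = qexp (y i)" by metis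
      have "\<alpha> = torsion_sum (length xs) y"
        by (simp add: xs(1) torsion_sum_def sum_list_sum_nth y atLeast0LessThan)
      thus "\<alpha> \<in> (\<Union>l\<in>{..L}. {\<alpha> \<in> V l. (house \<alpha>)\<^sup>2 \<le> C})" using \<alpha> xs(3) V by blast
    next
      fix \<alpha> assume "\<alpha> \<in> (\<Union>l\<in>{..L}. {\<alpha> \<in> V l. (house \<alpha>)\<^sup>2 \<le> C})"
      thus "\<alpha> \<in> {\<alpha> \<in> cyclotomic_integers. (house \<alpha>)\<^sup>2 \<le> C}"
        using torsion_sum_in_cyclotomic_integers by (auto simp: V_def torsion_family_def)
    qed
    also have "\<dots> = (\<Union>l\<in>{..L}. \<Union>F\<in>S l. torsion_family l F)" by (simp only: S(3))
    also have "\<dots> = (\<Union>(l, F)\<in>T. torsion_family l F)" by (auto simp: T_def)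
    finally show "{\<alpha> \<in> cyclotomic_integers. (house \<alpha>)\<^sup>2 \<le> C} = (\<Union>(l, F)\<in>T. torsion_family l F)" .
  qed
qed

subsection \<open>Polynomials parametrising the families\<close>

lemma eval_multi_poly_superset:
  assumes "finite M" "Poly_Mapping.keys P \<subseteq> M" "\<And>m. m \<in> M \<Longrightarrow> Poly_Mapping.keys m \<subseteq> V" "finite V"
  shows "eval_multi_poly P z = (\<Sum>m\<in>M. Poly_Mapping.lookup P m * (\<Prod>j\<in>V. z j ^ Poly_Mapping.lookup m j))"
proof -
  have "(\<Prod>j\<in>Poly_Mapping.keys m. z j ^ Poly_Mapping.lookup m j) = (\<Prod>j\<in>V. z j ^ Poly_Mapping.lookup m j)"
    if "m \<in> M" for m
    by (rule prod.mono_neutral_left) (use assms(3)[OF that] assms(4) in \<open>auto simp: in_keys_iff\<close>)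
  hence "eval_multi_poly P z = (\<Sum>m\<in>Poly_Mapping.keys P. Poly_Mapping.lookup P m * (\<Prod>j\<in>V. z j ^ Poly_Mapping.lookup m j))"
    unfolding eval_multi_poly_def using assms(2) by (intro sum.cong refl) auto
  also have "\<dots> = (\<Sum>m\<in>M. Poly_Mapping.lookup P m * (\<Prod>j\<in>V. z j ^ Poly_Mapping.lookup m j))"
    by (rule sum.mono_neutral_left) (use assms(1,2) in \<open>auto simp: in_keys_iff\<close>)
  finally show ?thesis .
qed

text \<open>The extra variable \<open>z\<^sub>0\<close> rotates the sum; substituting monomials for it makes all exponents
  of the other variables nonnegative.\<close>

lemma torsion_family_polynomial:
  assumes "finite J"
  shows "\<exists>n P. P \<in> multi_polys_over cyclotomic_integers n \<and>
    {eval_multi_poly P \<zeta> | \<zeta>. \<forall>j<n. \<zeta> j \<in> roots_of_unity} = {qexp t * \<alpha> | t \<alpha>. \<alpha> \<in> torsion_family l (c, A, J)}"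
proof -
  \<comment> \<open>\<open>B\<close> dominates every exponent in absolute value and does not depend
    on \<open>i\<close>. Raising all exponents by \<open>B\<close> therefore multiplies the whole
    sum by one root of unity, which the variable z_0 compensates.\<close>
  define B where "B = (\<Sum>i<l. \<Sum>j\<in>J. \<bar>A i j\<bar>)"
  have B: "A i j + B \<ge> 0" if "i < l" "j \<in> J" for i j
  proof -
    have "\<bar>A i j\<bar> \<le> (\<Sum>j\<in>J. \<bar>A i j\<bar>)" by (rule member_le_sum) (use that assms in auto)
    also have "\<dots> \<le> B" unfolding B_def by (rule member_le_sum) (use that in \<open>auto intro: sum_nonneg\<close>)
    finally show ?thesis by linarith
  qed
  define V where "V = insert 0 (Suc ` J)"
  have V: "finite V" using assms by (simp add: V_def)
  define n where "n = Suc (Max V)"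
  have n: "j < n" if "j \<in> V" for j using Max_ge[OF V that] by (simp add: n_def)
  define mon :: "nat \<Rightarrow> (nat \<Rightarrow>\<^sub>0 nat)" where
    "mon i = Poly_Mapping.single 0 1 + (\<Sum>j\<in>J. Poly_Mapping.single (Suc j) (nat (A i j + B)))" for i
  have lookup0: "Poly_Mapping.lookup (mon i) 0 = 1" for i
    by (simp add: mon_def lookup_add lookup_sum lookup_single when_def)
  have lookupS: "Poly_Mapping.lookup (mon i) (Suc j) = (if j \<in> J then nat (A i j + B) else 0)" for i j
  proof -
    have "Poly_Mapping.lookup (mon i) (Suc j) = (\<Sum>j'\<in>J. if j' = j then nat (A i j' + B) else 0)"
      by (simp add: mon_def lookup_add lookup_sum lookup_single when_def)
    thus ?thesis using assms by simp
  qed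
  have keys_mon: "Poly_Mapping.keys (mon i) \<subseteq> V" for i
  proof
    fix k assume "k \<in> Poly_Mapping.keys (mon i)"
    hence "Poly_Mapping.lookup (mon i) k \<noteq> 0" by (simp add: in_keys_iff)
    thus "k \<in> V" by (cases k) (auto simp: V_def lookupS split: if_splits)
  qed
  \<comment> \<open>Different \<open>i\<close> may share a monomial, so the coefficients are sums of
    \<open>qexp (c i)\<close> and may even cancel. Evaluation is therefore carried out over all
    monomials \<open>mon i\<close>, not over the keys.\<close>
  define P :: multi_poly where "P = (\<Sum>i<l. Poly_Mapping.single (mon i) (qexp (c i)))"
  have lookupP: "Poly_Mapping.lookup P m = (\<Sum>i<l. if mon i = m then qexp (c i) else 0)" for m
    by (simp add: P_def lookup_sum lookup_single when_def)
  have keysP: "Poly_Mapping.keys P \<subseteq> mon ` {..<l}"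
  proof
    fix m assume "m \<in> Poly_Mapping.keys P"
    hence "(\<Sum>i<l. if mon i = m then qexp (c i) else 0) \<noteq> 0" by (simp add: in_keys_iff lookupP)
    then obtain i where "i \<in> {..<l}" "(if mon i = m then qexp (c i) else 0) \<noteq> 0" by (rule sum.not_neutral_contains_not_neutral)
    thus "m \<in> mon ` {..<l}" by (auto split: if_splits)
  qed
  have eval: "eval_multi_poly P z = (\<Sum>i<l. qexp (c i) * (z 0 * (\<Prod>j\<in>J. z (Suc j) ^ nat (A i j + B))))" for z
  proof -
    have "eval_multi_poly P z = (\<Sum>m\<in>mon ` {..<l}. Poly_Mapping.lookup P m * (\<Prod>j\<in>V. z j ^ Poly_Mapping.lookup m j))"
      by (rule eval_multi_poly_superset) (use keysP keys_mon V in auto)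
    also have "\<dots> = (\<Sum>m\<in>mon ` {..<l}. \<Sum>i<l. if mon i = m then qexp (c i) * (\<Prod>j\<in>V. z j ^ Poly_Mapping.lookup m j) else 0)"
      unfolding lookupP sum_distrib_right by (intro sum.cong refl) auto
    also have "\<dots> = (\<Sum>i<l. \<Sum>m\<in>mon ` {..<l}. if mon i = m then qexp (c i) * (\<Prod>j\<in>V. z j ^ Poly_Mapping.lookup m j) else 0)"
      by (rule sum.swap)
    also have "\<dots> = (\<Sum>i<l. qexp (c i) * (\<Prod>j\<in>V. z j ^ Poly_Mapping.lookup (mon i) j))"
      by (intro sum.cong refl) simp
    finally have 1: "eval_multi_poly P z = (\<Sum>i<l. qexp (c i) * (\<Prod>j\<in>V. z j ^ Poly_Mapping.lookup (mon i) j))" .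
    have 2: "(\<Prod>j\<in>V. z j ^ Poly_Mapping.lookup (mon i) j) = z 0 * (\<Prod>j\<in>J. z (Suc j) ^ nat (A i j + B))" for i
    proof -
      have "(\<Prod>j\<in>V. z j ^ Poly_Mapping.lookup (mon i) j) = z 0 * (\<Prod>j\<in>Suc ` J. z j ^ Poly_Mapping.lookup (mon i) j)"
        unfolding V_def using assms by (subst prod.insert) (auto simp: lookup0)
      also have "(\<Prod>j\<in>Suc ` J. z j ^ Poly_Mapping.lookup (mon i) j) = (\<Prod>j\<in>J. z (Suc j) ^ nat (A i j + B))"
        by (subst prod.reindex) (auto simp: lookupS intro!: prod.cong)
      finally show ?thesis .
    qed
    show ?thesis by (simp only: 1 2)
  qed
  have eval_qexp: "eval_multi_poly P z = qexp (w + (\<Sum>j\<in>J. of_int B * x j)) * torsion_sum l (affine_point c A J x)"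
    if z: "z 0 = qexp w" "\<And>j. j \<in> J \<Longrightarrow> z (Suc j) = qexp (x j)" for z w x
  proof -
    have "qexp (c i) * (z 0 * (\<Prod>j\<in>J. z (Suc j) ^ nat (A i j + B))) =
        qexp (w + (\<Sum>j\<in>J. of_int B * x j)) * qexp (affine_point c A J x i)" if "i < l" for i
    proof -
      have "(\<Prod>j\<in>J. z (Suc j) ^ nat (A i j + B)) = (\<Prod>j\<in>J. qexp (of_int (A i j + B) * x j))"
        by (intro prod.cong refl) (use B[OF that] in \<open>simp add: z qexp_power\<close>)
      also have "\<dots> = qexp (\<Sum>j\<in>J. of_int (A i j) * x j + of_int B * x j)"
        by (simp add: qexp_sum distrib_right)
      finally have "qexp (c i) * (z 0 * (\<Prod>j\<in>J. z (Suc j) ^ nat (A i j + B))) =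
          qexp (c i + (w + (\<Sum>j\<in>J. of_int (A i j) * x j + of_int B * x j)))" by (simp only: z qexp_add)
      also have "c i + (w + (\<Sum>j\<in>J. of_int (A i j) * x j + of_int B * x j)) =
          (w + (\<Sum>j\<in>J. of_int B * x j)) + affine_point c A J x i"
        by (simp add: affine_point_def sum.distrib)
      finally show ?thesis by (simp only: qexp_add)
    qed
    thus ?thesis by (simp add: eval torsion_sum_def sum_distrib_left)
  qed
  show ?thesis
  proof (rule exI[of _ n], rule exI[of _ P], rule conjI)
    show "P \<in> multi_polys_over cyclotomic_integers n"
      unfolding multi_polys_over_def
    proof (intro CollectI ballI conjI)
      fix m assume "m \<in> Poly_Mapping.keys P"
      then obtain i where "m = mon i" using keysP by blast
      thus "Poly_Mapping.keys m \<subseteq> {..<n}" using keys_mon n by blast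
      show "Poly_Mapping.lookup P m \<in> cyclotomic_integers"
        unfolding lookupP by (intro cyclotomic_integers_sum) (simp add: qexp_in_cyclotomic_integers cyclotomic_integers_0)
    qed
    show "{eval_multi_poly P \<zeta> | \<zeta>. \<forall>j<n. \<zeta> j \<in> roots_of_unity} = {qexp t * \<alpha> | t \<alpha>. \<alpha> \<in> torsion_family l (c, A, J)}"
    proof (intro equalityI subsetI)
      fix \<beta> assume "\<beta> \<in> {eval_multi_poly P \<zeta> | \<zeta>. \<forall>j<n. \<zeta> j \<in> roots_of_unity}"
      then obtain \<zeta> where \<zeta>: "\<beta> = eval_multi_poly P \<zeta>" "\<And>j. j < n \<Longrightarrow> \<zeta> j \<in> roots_of_unity" by blast
      have "\<exists>y. \<zeta> j = qexp y" if "j < n" for j using \<zeta>(2)[OF that] roots_of_unity_eq_range_qexp by blast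
      then obtain y where y: "\<And>j. j < n \<Longrightarrow> \<zeta> j = qexp (y j)" by metis
      have "\<beta> = qexp (y 0 + (\<Sum>j\<in>J. of_int B * y (Suc j))) * torsion_sum l (affine_point c A J (\<lambda>j. y (Suc j)))"
        unfolding \<zeta>(1) by (rule eval_qexp) (use y n in \<open>auto simp: V_def\<close>)
      thus "\<beta> \<in> {qexp t * \<alpha> | t \<alpha>. \<alpha> \<in> torsion_family l (c, A, J)}" by (auto simp: torsion_family_def)
    next
      fix \<beta> assume "\<beta> \<in> {qexp t * \<alpha> | t \<alpha>. \<alpha> \<in> torsion_family l (c, A, J)}"
      then obtain t x where \<beta>: "\<beta> = qexp t * torsion_sum l (affine_point c A J x)" by (auto simp: torsion_family_def)
      define \<zeta> where "\<zeta> j = (case j of 0 \<Rightarrow> qexp (t - (\<Sum>j\<in>J. of_int B * x j)) | Suc j \<Rightarrow> qexp (x j))" for j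
      have "eval_multi_poly P \<zeta> = \<beta>"
        using eval_qexp[of \<zeta> "t - (\<Sum>j\<in>J. of_int B * x j)" x] by (simp add: \<zeta>_def \<beta>)
      moreover have "\<zeta> j \<in> roots_of_unity" for j
        by (auto simp: \<zeta>_def roots_of_unity_eq_range_qexp split: nat.splits)
      ultimately show "\<beta> \<in> {eval_multi_poly P \<zeta> | \<zeta>. \<forall>j<n. \<zeta> j \<in> roots_of_unity}" by blast
    qed
  qed
qed

theorem theorem1p2:
  fixes C :: real
  assumes "C > 0"
  shows "\<exists>(I :: nat set) (n :: nat \<Rightarrow> nat) (P :: nat \<Rightarrow> multi_poly).
    finite I \<and>
    (\<forall>i\<in>I. P i \<in> multi_polys_over cyclotomic_integers (n i)) \<and>
    {\<alpha> \<in> cyclotomic_integers. (house \<alpha>)\<^sup>2 \<le> C} =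
      {eval_multi_poly (P i) \<zeta> | i \<zeta>. i \<in> I \<and> (\<forall>j < n i. \<zeta> j \<in> roots_of_unity)}"
proof -
  define S where "S = {\<alpha> \<in> cyclotomic_integers. (house \<alpha>)\<^sup>2 \<le> C}"
  obtain T where T: "finite T" "\<forall>(l, c, A, J)\<in>T. finite J" "S = (\<Union>(l, F)\<in>T. torsion_family l F)"
    using small_castle_torsion_families[of C, folded S_def] by (elim exE conjE) (rule that)
  define rot where "rot t = {qexp s * \<alpha> | s \<alpha>. \<alpha> \<in> torsion_family (fst t) (snd t)}" for t
  have "\<forall>t\<in>T. \<exists>n P. P \<in> multi_polys_over cyclotomic_integers n \<and>
      {eval_multi_poly P \<zeta> | \<zeta>. \<forall>j<n. \<zeta> j \<in> roots_of_unity} = rot t"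
  proof
    fix t assume tT: "t \<in> T"
    obtain l c A J where t: "t = (l, c, A, J)" by (cases t)
    have "finite J" using T(2) tT t by blast
    thus "\<exists>n P. P \<in> multi_polys_over cyclotomic_integers n \<and>
      {eval_multi_poly P \<zeta> | \<zeta>. \<forall>j<n. \<zeta> j \<in> roots_of_unity} = rot t"
      unfolding rot_def t fst_conv snd_conv by (rule torsion_family_polynomial)
  qed
  from bchoice[OF this] obtain n where
    "\<forall>t\<in>T. \<exists>P. P \<in> multi_polys_over cyclotomic_integers (n t) \<and>
      {eval_multi_poly P \<zeta> | \<zeta>. \<forall>j<n t. \<zeta> j \<in> roots_of_unity} = rot t" by (elim exE) (rule that)
  from bchoice[OF this] obtain P where nP: "\<forall>t\<in>T. P t \<in> multi_polys_over cyclotomic_integers (n t) \<and>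
      {eval_multi_poly (P t) \<zeta> | \<zeta>. \<forall>j<n t. \<zeta> j \<in> roots_of_unity} = rot t" by (elim exE) (rule that)
  \<comment> \<open>The polynomials produce all rotations of the families; this adds nothing,
    because \<open>S\<close> is stable under multiplication by roots of unity.\<close>
  have "S = (\<Union>t\<in>T. rot t)"
  proof (intro equalityI subsetI)
    fix \<alpha> assume "\<alpha> \<in> S"
    then obtain t where "t \<in> T" "\<alpha> \<in> torsion_family (fst t) (snd t)" unfolding T(3) by auto
    moreover have "\<alpha> = qexp 0 * \<alpha>" by simp
    ultimately show "\<alpha> \<in> (\<Union>t\<in>T. rot t)" unfolding rot_def by blast
  next
    fix \<beta> assume "\<beta> \<in> (\<Union>t\<in>T. rot t)"
    then obtain t s \<alpha> where t: "t \<in> T" "\<alpha> \<in> torsion_family (fst t) (snd t)" "\<beta> = qexp s * \<alpha>"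
      unfolding rot_def by blast
    hence "\<alpha> \<in> S" unfolding T(3) by (auto simp: case_prod_unfold)
    obtain y where y: "\<alpha> = torsion_sum (fst t) y" using t(2) by (auto simp: torsion_family_def split: prod.splits)
    have "\<beta> = torsion_sum (fst t) (\<lambda>l. s + y l)"
      by (simp add: t(3) y torsion_sum_def qexp_add sum_distrib_left)
    hence "\<beta> \<in> cyclotomic_integers" using torsion_sum_in_cyclotomic_integers by simp
    moreover have "(house \<beta>)\<^sup>2 \<le> C"
      using house_torsion_sum_rotate[of "fst t" y C s] \<open>\<alpha> \<in> S\<close> by (simp add: S_def t(3) y)
    ultimately show "\<beta> \<in> S" by (simp add: S_def)
  qed
  moreover obtain g :: "nat \<Rightarrow> _" and k where g: "T = g ` {i. i < k}"
    using finite_imp_nat_seg_image_inj_on[OF T(1)] by metis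
  ultimately have S: "S = (\<Union>i\<in>{..<k}. rot (g i))" by auto
  have gT: "g i \<in> T" if "i \<in> {..<k}" for i using that g by auto
  show ?thesis
  proof (intro exI[of _ "{..<k}"] exI[of _ "\<lambda>i. n (g i)"] exI[of _ "\<lambda>i. P (g i)"] conjI ballI)
    show "P (g i) \<in> multi_polys_over cyclotomic_integers (n (g i))" if "i \<in> {..<k}" for i
      using nP gT[OF that] by blast
    have "S = (\<Union>i\<in>{..<k}. {eval_multi_poly (P (g i)) \<zeta> | \<zeta>. \<forall>j<n (g i). \<zeta> j \<in> roots_of_unity})"
      unfolding S
    proof (intro SUP_cong refl)
      fix i assume "i \<in> {..<k}"
      from bspec[OF nP gT[OF this]]
      show "rot (g i) = {eval_multi_poly (P (g i)) \<zeta> | \<zeta>. \<forall>j<n (g i). \<zeta> j \<in> roots_of_unity}"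
        by (elim conjE) (rule sym)
    qed
    also have "\<dots> = {eval_multi_poly (P (g i)) \<zeta> | i \<zeta>. i \<in> {..<k} \<and> (\<forall>j < n (g i). \<zeta> j \<in> roots_of_unity)}"
      by blast
    finally show "{\<alpha> \<in> cyclotomic_integers. (house \<alpha>)\<^sup>2 \<le> C} =
        {eval_multi_poly (P (g i)) \<zeta> | i \<zeta>. i \<in> {..<k} \<and> (\<forall>j < n (g i). \<zeta> j \<in> roots_of_unity)}"
      unfolding S_def .
  qed simp
qed

end
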